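(* There exists an absolute constant $C>0$ such that for every integer $d\ge 1$, every integer $m$ with $1\le m\le d$, and every origin-symmetric convex body $K\subset\mathbb{R}^d$ with $\dim(K\cap\mathbb{Z}^d)=d$, $$\#K \;\le\; C^d\, d^{\,d-m}\, \max\{\#(K\cap H): H\in \mathrm{G}_{\mathbb{Z}}(m,d)\}\; \mathrm{vol}_d(K)^{\frac{d-m}{d}}.$$
   Context: A convex body in $\mathbb{R}^d$ is a convex compact subset equal to the closure of its interior; it is origin-symmetric if $K=-K$. For a set $A\subset\mathbb{R}^d$, $\#A=\mathrm{card}(A\cap\mathbb{Z}^d)$ and $\dim(A)$ is the dimension of the affine hull of $A$; thus, for origin-symmetric $K$, $\dim(K\cap\mathbb{Z}^d)=d$ means that $K$ contains $d$ linearly independent points of $\mathbb{Z}^d$. $\mathrm{vol}_d$ is $d$-dimensional volume. $\mathrm{G}_{\mathbb{Z}}(m,d)$ is the set of all $m$-dimensional linear subspaces of $\mathbb{R}^d$ containing $m$ linearly independent vectors of $\mathbb{Z}^d$. *)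

theory Defs
  imports "HOL-Analysis.Analysis" "HOL-Library.Function_Algebras"
begin

text \<open>
  The constant of the theorem does not depend on the dimension, so the dimension has to be a term.
  As in the library's \<^const>\<open>Euclidean_space\<close>, the space \<open>\<real>\<^sup>d\<close> consists of the functions
  \<open>x :: nat \<Rightarrow> real\<close> with \<open>x i = 0\<close> for all \<open>i \<ge> d\<close>, with the product topology. The pointwise scalar
  multiplication below makes the library's notions for real vector spaces (\<^const>\<open>convex\<close>,
  \<^const>\<open>subspace\<close>, \<^const>\<open>dim\<close>, \<^const>\<open>hull\<close>, linear independence) available on these functions.
\<close>

instantiation "fun" :: (type, real_vector) real_vector
begin

definition scaleR_fun :: "real \<Rightarrow> ('a \<Rightarrow> 'b) \<Rightarrow> 'a \<Rightarrow> 'b"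
  where "scaleR_fun c f = (\<lambda>x. c *\<^sub>R f x)"

instance
  by standard (simp_all add: scaleR_fun_def fun_eq_iff scaleR_add_right scaleR_add_left)

end

definition convex_body :: "nat \<Rightarrow> (nat \<Rightarrow> real) set \<Rightarrow> bool"
  where "convex_body d K \<longleftrightarrow>
    convex K \<and> compactin (Euclidean_space d) K \<and>
    K = Euclidean_space d closure_of (Euclidean_space d interior_of K)"

definition origin_symmetric :: "(nat \<Rightarrow> real) set \<Rightarrow> bool"
  where "origin_symmetric K \<longleftrightarrow> K = uminus ` K"

definition int_lattice :: "nat \<Rightarrow> (nat \<Rightarrow> real) set"
  where "int_lattice d = {x \<in> topspace (Euclidean_space d). \<forall>i. x i \<in> \<int>}"

definition lattice_count :: "nat \<Rightarrow> (nat \<Rightarrow> real) set \<Rightarrow> nat"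
  where "lattice_count d A = card (A \<inter> int_lattice d)"

text \<open>
  The library's \<^const>\<open>aff_dim\<close> is restricted to the class \<^class>\<open>euclidean_space\<close>; here the dimension
  of the affine hull is that of its direction space. The empty set gets the value 0.
\<close>

definition affine_dimension :: "(nat \<Rightarrow> real) set \<Rightarrow> nat"
  where "affine_dimension A = dim {x - y |x y. x \<in> affine hull A \<and> y \<in> affine hull A}"

text \<open>
  The elements of the product measure space are functions that are \<^const>\<open>undefined\<close> outside of
  \<open>{..<d}\<close>, not 0, hence the \<^const>\<open>restrict\<close>.
\<close>

definition vol :: "nat \<Rightarrow> (nat \<Rightarrow> real) set \<Rightarrow> real"
  where "vol d K = measure (Pi\<^sub>M {..<d} (\<lambda>_. lborel)) ((\<lambda>x. restrict x {..<d}) ` K)"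

definition rational_subspaces :: "nat \<Rightarrow> nat \<Rightarrow> (nat \<Rightarrow> real) set set"
  where "rational_subspaces m d =
    {H. subspace H \<and> H \<subseteq> topspace (Euclidean_space d) \<and> dim H = m \<and>
        (\<exists>B \<subseteq> H \<inter> int_lattice d. finite B \<and> independent B \<and> card B = m)}"

end

theory Submission
  imports Defs "Jordan_Normal_Form.Determinant"
begin

text \<open>
  Let \<open>k = d - m\<close>. If \<open>H\<close> is cut out by \<open>k\<close> integer functionals, then pigeonhole on the values of these
  functionals and on parities bounds \<open>#K\<close> by \<open>2\<^sup>d #(K \<inter> H)\<close> times the number of value vectors. To choose
  the functionals, put \<open>K\<close> between an ellipsoid \<open>E\<close> and \<open>E / (2 sqrt d)\<close> (John) and take the first \<open>k\<close>
  vectors of a Hermite--Korkine--Zolotarev reduced basis of the dual lattice with respect to \<open>E\<close>,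
  with Gram--Schmidt lengths \<open>b\<^sub>1, \<dots>, b\<^sub>d\<close>. The number of value vectors is at most \<open>C\<^sup>d\<close> times the
  product of the \<open>b\<^sub>i / sqrt d + 1\<close>, \<open>i \<le> k\<close>, and a grid count in \<open>E / (2 sqrt d)\<close> gives
  \<open>b\<^sub>1 \<cdots> b\<^sub>d \<le> (4 d)\<^sup>d vol K\<close>. It remains to see that the first \<open>k\<close> factors take at most their share
  \<open>k / d\<close> of the full product. By Minkowski's argument \<open>b\<^sub>i\<close> is at most \<open>2 sqrt d\<close> times the geometric
  mean of \<open>b\<^sub>i, \<dots>, b\<^sub>q\<close> for every \<open>q \<ge> i\<close>, and all products \<open>b\<^sub>1 \<cdots> b\<^sub>j\<close> are at least 1 because \<open>E\<close>
  contains \<open>d\<close> independent lattice points. These two facts imply the claim by comparison with the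
  convex minorant of the partial sums of the \<open>ln b\<^sub>i\<close>.
\<close>

text \<open>The functionals come from the dual lattice because its vectors are exactly the
  functionals that are integral on lattice points, and a short one takes few values on
  \<open>K\<close>. The allowance of one factor \<open>d\<close> per cut is already spent by the
  volume comparison: \<open>(4 d)^d\<close>, taken to the power \<open>k / d\<close>, is
  \<open>(4 d)^k\<close>. Every other step may lose only a constant per dimension. The bound of
  \<open>b\<^sub>i\<close> by \<open>2 sqrt d\<close> times a geometric mean violates this, and that
  shapes the count of value vectors: cutting the unit ball into cells of side
  \<open>1 / sqrt d\<close>, of which \<open>48^d\<close> suffice, divides each
  \<open>b\<^sub>i\<close> by the same \<open>sqrt d\<close>. A second obstacle is the summand 1 in
  \<open>b\<^sub>i / sqrt d + 1\<close>: a short vector cannot push its factor below 1. So positive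
  parts of \<open>ln (b\<^sub>i / (2 sqrt d))\<close> have to be compared with a sum of signed
  logarithms. The lower bound on every initial product, not only on the full one, keeps early
  negative logarithms from lowering that sum too far.\<close>

section \<open>Partial sums and slopes\<close>

text \<open>The least average \<open>\<sigma>\<close> of an initial segment is the slope of the
  first edge of the convex minorant of the partial sums \<open>P\<close>, and \<open>r\<close> lies
  on that edge. The slope hypothesis with \<open>q = r\<close> gives
  \<open>s i \<le> \<sigma>\<close> for \<open>i < r\<close>, and the sequence shifted by
  \<open>r\<close> satisfies the hypotheses again. Slopes never decrease along the minorant, so the
  first \<open>k\<close> positions carry at most their average share.\<close>

lemma sum_slope_bound:
  fixes h s :: "nat \<Rightarrow> real"
  assumes slope: "\<And>i q. i < q \<Longrightarrow> q \<le> d \<Longrightarrow> s i * real (q - i) \<le> (\<Sum>l\<in>{i..<q}. h l)"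
    and nonneg: "\<And>j. j \<le> d \<Longrightarrow> 0 \<le> (\<Sum>l<j. h l)"
    and k: "k \<le> d"
  shows "real d * (\<Sum>i<k. max 0 (s i)) \<le> real k * (\<Sum>l<d. h l)"
  using assms
proof (induction d arbitrary: h s k rule: less_induct)
  case (less d)
  show ?case
  proof (cases "d = 0")
    case True
    then show ?thesis using less.prems by simp
  next
    case False
    define P where "P j = (\<Sum>l<j. h l)" for j
    define R where "R j = P j / real j" for j
    define r where "r = arg_min_on R {1..d}"
    have "{1..d} \<noteq> {}" using False by simp
    then have r: "r \<in> {1..d}" "\<And>j. j \<in> {1..d} \<Longrightarrow> R r \<le> R j"
      unfolding r_def using arg_min_if_finite(1)[of "{1..d}" R] arg_min_least[of "{1..d}" _ R] by auto
    define \<sigma> where "\<sigma> = R r"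
    have Pr: "P r = \<sigma> * real r" using r(1) by (simp add: \<sigma>_def R_def)
    have Pj: "\<sigma> * real j \<le> P j" if "j \<le> d" for j
    proof (cases "j = 0")
      case True then show ?thesis by (simp add: P_def)
    next
      case False
      then have "\<sigma> \<le> P j / real j" using r(2)[of j] that by (simp add: \<sigma>_def R_def)
      then show ?thesis using False by (simp add: pos_le_divide_eq)
    qed
    have \<sigma>0: "0 \<le> \<sigma>" using r(1) less.prems(2)[of r] by (simp add: \<sigma>_def R_def P_def)
    have seg: "(\<Sum>l\<in>{i..<q}. h l) = P q - P i" if "i \<le> q" for i q
      using sum_diff_nat_ivl[of 0 i q h] that by (simp add: P_def lessThan_atLeast0)
    have s\<sigma>: "s i \<le> \<sigma>" if "i < r" for i
    proof -
      have "s i * real (r - i) \<le> P r - P i"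
        using less.prems(1)[of i r] that r(1) seg[of i r] by simp
      also have "\<dots> \<le> \<sigma> * real (r - i)"
        using Pr Pj[of i] that r(1) by (simp add: of_nat_diff algebra_simps)
      finally show ?thesis using that by simp
    qed
    have Pd: "\<sigma> * real d \<le> P d" using Pj by simp
    show ?thesis
    proof (cases "k \<le> r")
      case True
      have "(\<Sum>i<k. max 0 (s i)) \<le> (\<Sum>i<k. \<sigma>)"
        by (intro sum_mono) (use s\<sigma> \<sigma>0 True in auto)
      then have "real d * (\<Sum>i<k. max 0 (s i)) \<le> real d * (real k * \<sigma>)"
        by (intro mult_left_mono) auto
      also have "\<dots> = real k * (\<sigma> * real d)" by simp
      also have "\<dots> \<le> real k * P d" using Pd by (intro mult_left_mono) auto
      finally show ?thesis by (simp add: P_def)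
    next
      case False
      define h' s' where "h' l = h (r + l)" and "s' i = s (r + i)" for l i
      have shift: "(\<Sum>l\<in>{i..<q}. h' l) = P (r + q) - P (r + i)" if "i \<le> q" for i q
      proof -
        have "(\<Sum>l\<in>{i..<q}. h' l) = (\<Sum>l\<in>{i+r..<q+r}. h l)"
          unfolding h'_def sum.shift_bounds_nat_ivl by (simp add: add.commute)
        then show ?thesis using seg[of "i+r" "q+r"] that by (simp add: add.commute)
      qed
      have IH: "real (d - r) * (\<Sum>i<k - r. max 0 (s' i)) \<le> real (k - r) * (\<Sum>l<d - r. h' l)"
      proof (rule less.IH)
        show "d - r < d" using r(1) by auto
        show "s' i * real (q - i) \<le> (\<Sum>l\<in>{i..<q}. h' l)" if "i < q" "q \<le> d - r" for i q
          using less.prems(1)[of "r+i" "r+q"] that shift[of i q] seg[of "r+i" "r+q"] r(1)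
          by (simp add: s'_def)
        \<comment> \<open>By minimality of \<open>\<sigma>\<close> the shifted partial sums are even
          at least \<open>\<sigma> * j\<close>, because \<open>P r\<close> equals
          \<open>\<sigma> * r\<close>.\<close>
        show "0 \<le> (\<Sum>l<j. h' l)" if "j \<le> d - r" for j
        proof -
          have "\<sigma> * real (r + j) \<le> P (r + j)" using Pj[of "r+j"] that r(1) by auto
          moreover have "0 \<le> \<sigma> * real j" using \<sigma>0 by simp
          ultimately show ?thesis
            using shift[of 0 j] Pr by (simp add: lessThan_atLeast0 algebra_simps)
        qed
        show "k - r \<le> d - r" using less.prems(3) by simp
      qed
      have split: "(\<Sum>i<k. max 0 (s i)) = (\<Sum>i<r. max 0 (s i)) + (\<Sum>i<k - r. max 0 (s' i))"
      proof -
        have "(\<Sum>i<k. max 0 (s i)) = (\<Sum>i<r. max 0 (s i)) + (\<Sum>i\<in>{r..<k}. max 0 (s i))"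
          using sum.atLeastLessThan_concat[of 0 r k "\<lambda>i. max 0 (s i)"] False
          by (simp add: lessThan_atLeast0)
        moreover have "(\<Sum>i\<in>{r..<k}. max 0 (s i)) = (\<Sum>i<k - r. max 0 (s' i))"
          using sum.shift_bounds_nat_ivl[of "\<lambda>i. max 0 (s i)" 0 r "k - r"] False
          by (simp add: lessThan_atLeast0 s'_def add.commute)
        ultimately show ?thesis by simp
      qed
      have first: "(\<Sum>i<r. max 0 (s i)) \<le> real r * \<sigma>"
        using sum_mono[of "{..<r}" "\<lambda>i. max 0 (s i)" "\<lambda>_. \<sigma>"] s\<sigma> \<sigma>0 by auto
      define S where "S = (\<Sum>i<k - r. max 0 (s' i))"
      have IH': "(real d - real r) * S \<le> (real k - real r) * (P d - \<sigma> * real r)"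
        using IH shift[of 0 "d - r"] Pr r(1) False less.prems(3)
        by (simp add: S_def lessThan_atLeast0 of_nat_diff)
      have dr: "real d - real r > 0" using False less.prems(3) by simp
      \<comment> \<open>Multiplying by \<open>d - r\<close> lets the induction hypothesis enter
        without division. The term dropped at the end is nonnegative because \<open>\<sigma>\<close>
        is at most the overall average \<open>P d / d\<close>.\<close>
      have "(real d - real r) * (real d * (real r * \<sigma> + S))
          = real d * ((real d - real r) * (real r * \<sigma>)) + real d * ((real d - real r) * S)"
        by (simp add: algebra_simps)
      also have "\<dots> \<le> real d * ((real d - real r) * (real r * \<sigma>))
          + real d * ((real k - real r) * (P d - \<sigma> * real r))"
        using IH' by (intro add_left_mono mult_left_mono) auto
      also have "\<dots> = (real d - real r) * (real k * P d) - real r * (real d - real k) * (P d - \<sigma> * real d)"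
        by (simp add: algebra_simps)
      also have "\<dots> \<le> (real d - real r) * (real k * P d)"
        using Pd less.prems(3) by simp
      finally have "real d * (real r * \<sigma> + S) \<le> real k * P d"
        using dr by simp
      moreover have "real d * (\<Sum>i<k. max 0 (s i)) \<le> real d * (real r * \<sigma> + S)"
        unfolding split S_def using first by (intro mult_left_mono) auto
      ultimately show ?thesis by (simp add: P_def)
    qed
  qed
qed

section \<open>Counting integer points in triangular systems\<close>

lemma card_int_interval:
  fixes a t :: real
  assumes "0 \<le> t"
  shows "finite {z::int. a \<le> of_int z \<and> of_int z < a + t}"
    and "real (card {z::int. a \<le> of_int z \<and> of_int z < a + t}) \<le> t + 1"
    and "t - 1 \<le> real (card {z::int. a \<le> of_int z \<and> of_int z < a + t})"
proof -
  have eq: "{z::int. a \<le> of_int z \<and> of_int z < a + t} = {\<lceil>a\<rceil>..<\<lceil>a + t\<rceil>}"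
    by (auto simp: ceiling_le_iff less_ceiling_iff)
  show "finite {z::int. a \<le> of_int z \<and> of_int z < a + t}"
    unfolding eq by simp
  have "\<lceil>a\<rceil> \<le> \<lceil>a + t\<rceil>" using assms by (intro ceiling_mono) simp
  then have card: "real (card {\<lceil>a\<rceil>..<\<lceil>a + t\<rceil>}) = of_int \<lceil>a + t\<rceil> - of_int \<lceil>a\<rceil>"
    by simp
  show "real (card {z::int. a \<le> of_int z \<and> of_int z < a + t}) \<le> t + 1"
    unfolding eq card by linarith
  show "t - 1 \<le> real (card {z::int. a \<le> of_int z \<and> of_int z < a + t})"
    unfolding eq card by linarith
qed

text \<open>The integer points whose image under a triangular system with diagonal \<open>s\<close>
  lies in the box with corner \<open>\<alpha>\<close> and sides \<open>\<delta>\<close>. The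
  correction \<open>c i\<close> is meant to read only the coordinates below \<open>i\<close>, but
  may depend on them arbitrarily.\<close>

definition tri_box ::
  "nat \<Rightarrow> (nat \<Rightarrow> (nat \<Rightarrow> int) \<Rightarrow> real) \<Rightarrow> (nat \<Rightarrow> real) \<Rightarrow> (nat \<Rightarrow> real) \<Rightarrow> (nat \<Rightarrow> real) \<Rightarrow> (nat \<Rightarrow> int) set"
  where "tri_box k c s \<alpha> \<delta> =
    {y \<in> {..<k} \<rightarrow>\<^sub>E UNIV. \<forall>i<k. \<alpha> i \<le> s i * (of_int (y i) + c i y) \<and> s i * (of_int (y i) + c i y) < \<alpha> i + \<delta> i}"

text \<open>Once the coordinates below \<open>i\<close> are fixed, coordinate \<open>i\<close>
  ranges over the integers of a half-open interval of length \<open>\<delta> i / s i\<close>, so the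
  bounds multiply. The condition \<open>s i \<le> \<delta> i\<close> makes the factors of the lower
  bound nonnegative, which this multiplication requires.\<close>

lemma tri_box_count:
  assumes s: "\<And>i. i < k \<Longrightarrow> 0 < s i"
    and \<delta>: "\<And>i. i < k \<Longrightarrow> 0 \<le> \<delta> i"
    and c: "\<And>i y y'. i < k \<Longrightarrow> (\<And>l. l < i \<Longrightarrow> y l = y' l) \<Longrightarrow> c i y = c i y'"
  shows "finite (tri_box k c s \<alpha> \<delta>) \<and> real (card (tri_box k c s \<alpha> \<delta>)) \<le> (\<Prod>i<k. \<delta> i / s i + 1) \<and>
    ((\<forall>i<k. s i \<le> \<delta> i) \<longrightarrow> (\<Prod>i<k. \<delta> i / s i - 1) \<le> real (card (tri_box k c s \<alpha> \<delta>)))"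
  using assms
proof (induction k)
  case 0
  have "tri_box 0 c s \<alpha> \<delta> = {\<lambda>_. undefined}" by (auto simp: tri_box_def)
  then show ?case by simp
next
  case (Suc k)
  let ?T = "tri_box k c s \<alpha> \<delta>"
  define I where "I y = {z::int. \<alpha> k / s k - c k y \<le> of_int z \<and> of_int z < \<alpha> k / s k - c k y + \<delta> k / s k}"
    for y :: "nat \<Rightarrow> int"
  have sk: "s k > 0" and \<delta>k0: "\<delta> k \<ge> 0" using Suc.prems(1,2) by auto
  have \<delta>k: "\<delta> k / s k \<ge> 0" using sk \<delta>k0 by simp
  note I = card_int_interval[OF \<delta>k, of "\<alpha> k / s k - c k y" for y, folded I_def]
  have mem: "z \<in> I y \<longleftrightarrow> \<alpha> k \<le> s k * (of_int z + c k y) \<and> s k * (of_int z + c k y) < \<alpha> k + \<delta> k" for y z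
    using sk by (auto simp: I_def field_simps)
  have IH: "finite ?T" "real (card ?T) \<le> (\<Prod>i<k. \<delta> i / s i + 1)"
    "(\<forall>i<k. s i \<le> \<delta> i) \<Longrightarrow> (\<Prod>i<k. \<delta> i / s i - 1) \<le> real (card ?T)"
  proof -
    have *: "finite ?T \<and> real (card ?T) \<le> (\<Prod>i<k. \<delta> i / s i + 1) \<and>
        ((\<forall>i<k. s i \<le> \<delta> i) \<longrightarrow> (\<Prod>i<k. \<delta> i / s i - 1) \<le> real (card ?T))"
    proof (rule Suc.IH)
      show "c i y = c i y'" if "i < k" "\<And>l. l < i \<Longrightarrow> y l = y' l" for i y y'
        by (rule Suc.prems(3)) (use that in simp_all)
    qed (use Suc.prems(1,2) in simp_all)
    then show "finite ?T" "real (card ?T) \<le> (\<Prod>i<k. \<delta> i / s i + 1)" by simp_all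
    show "(\<Prod>i<k. \<delta> i / s i - 1) \<le> real (card ?T)" if "\<forall>i<k. s i \<le> \<delta> i"
      using * that by simp
  qed
  have cupd: "c i (y(k := z)) = c i y" if "i \<le> k" for i y z
    by (rule Suc.prems(3)) (use that in simp_all)
  let ?g = "\<lambda>(y, z). y(k := z)"
  have eq: "tri_box (Suc k) c s \<alpha> \<delta> = ?g ` (Sigma ?T I)"
  proof (intro equalityI subsetI)
    fix y assume y: "y \<in> tri_box (Suc k) c s \<alpha> \<delta>"
    define y' where "y' = y(k := undefined)"
    have yy: "y = y'(k := y k)" by (simp add: y'_def)
    have cc: "c i y = c i y'" if "i \<le> k" for i using cupd[OF that, of y' "y k"] yy by simp
    have "y' \<in> ?T"
      using y cc by (auto simp: tri_box_def y'_def PiE_def extensional_def)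
    moreover have "y k \<in> I y'" using y cc[of k] by (auto simp: tri_box_def mem)
    ultimately show "y \<in> ?g ` (Sigma ?T I)" using yy by (intro image_eqI[of _ _ "(y', y k)"]) auto
  next
    fix y assume "y \<in> ?g ` (Sigma ?T I)"
    then obtain y' z where y': "y' \<in> ?T" "z \<in> I y'" "y = y'(k := z)" by auto
    show "y \<in> tri_box (Suc k) c s \<alpha> \<delta>"
      using y' cupd[of _ y' z] by (auto simp: tri_box_def mem less_Suc_eq PiE_def extensional_def)
  qed
  have inj: "inj_on ?g (Sigma ?T I)"
  proof (rule inj_onI, clarify)
    fix y z y' z' assume y: "y \<in> ?T" "y' \<in> ?T" and e: "y(k := z) = y'(k := z')"
    have "y k = y' k" using y by (simp add: tri_box_def PiE_def extensional_def)
    moreover have "y i = y' i" if "i \<noteq> k" for i using fun_cong[OF e, of i] that by simp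
    ultimately have "y = y'" by (metis ext)
    then show "y = y' \<and> z = z'" using fun_cong[OF e, of k] by auto
  qed
  have fin: "finite (Sigma ?T I)" using IH(1) I(1) by blast
  have "card (tri_box (Suc k) c s \<alpha> \<delta>) = (\<Sum>y\<in>?T. card (I y))"
    unfolding eq card_image[OF inj] using IH(1) I(1) by (subst card_SigmaI) auto
  then have card: "real (card (tri_box (Suc k) c s \<alpha> \<delta>)) = (\<Sum>y\<in>?T. real (card (I y)))" by simp
  have up: "(\<Sum>y\<in>?T. real (card (I y))) \<le> (\<Prod>i<Suc k. \<delta> i / s i + 1)"
  proof -
    have "(\<Sum>y\<in>?T. real (card (I y))) \<le> (\<Sum>y\<in>?T. \<delta> k / s k + 1)"
      by (intro sum_mono I)
    also have "\<dots> = real (card ?T) * (\<delta> k / s k + 1)" by simp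
    also have "\<dots> \<le> (\<Prod>i<k. \<delta> i / s i + 1) * (\<delta> k / s k + 1)"
      using IH(2) \<delta>k by (intro mult_right_mono) auto
    finally show ?thesis by simp
  qed
  have low: "(\<Prod>i<Suc k. \<delta> i / s i - 1) \<le> (\<Sum>y\<in>?T. real (card (I y)))" if le: "\<forall>i<Suc k. s i \<le> \<delta> i"
  proof -
    have "(\<Prod>i<Suc k. \<delta> i / s i - 1) = (\<Prod>i<k. \<delta> i / s i - 1) * (\<delta> k / s k - 1)" by simp
    also have "\<dots> \<le> real (card ?T) * (\<delta> k / s k - 1)"
      using IH(3) le sk by (intro mult_right_mono) (auto simp: divide_simps)
    also have "\<dots> = (\<Sum>y\<in>?T. \<delta> k / s k - 1)" by simp
    also have "\<dots> \<le> (\<Sum>y\<in>?T. real (card (I y)))" by (intro sum_mono I)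
    finally show ?thesis .
  qed
  show ?case using fin up low card unfolding eq by auto
qed

text \<open>Give an integer \<open>z\<close> the weight \<open>(1/2) ^ \<bar>z\<bar>\<close>. These
  weights sum to at most 3, and the product of the weights over a counted vector is at least
  \<open>(1/2) ^ n\<close>.\<close>

lemma card_small_int_vectors:
  shows "finite {m \<in> {..<k} \<rightarrow>\<^sub>E (UNIV::int set). (\<Sum>i<k. \<bar>m i\<bar>) \<le> int n}"
    and "real (card {m \<in> {..<k} \<rightarrow>\<^sub>E (UNIV::int set). (\<Sum>i<k. \<bar>m i\<bar>) \<le> int n}) \<le> 2 ^ n * 3 ^ k"
proof -
  let ?M = "{m \<in> {..<k} \<rightarrow>\<^sub>E (UNIV::int set). (\<Sum>i<k. \<bar>m i\<bar>) \<le> int n}"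
  let ?B = "{- int n..int n}"
  let ?g = "\<lambda>z::int. (1/2::real) ^ nat \<bar>z\<bar>"
  have sub: "?M \<subseteq> {..<k} \<rightarrow>\<^sub>E ?B"
  proof
    fix m assume m: "m \<in> ?M"
    have "m i \<in> ?B" if "i < k" for i
    proof -
      have "\<bar>m i\<bar> \<le> (\<Sum>i<k. \<bar>m i\<bar>)"
        by (rule member_le_sum) (use that in simp_all)
      also have "\<dots> \<le> int n" using m by blast
      finally show ?thesis by (simp add: abs_le_iff)
    qed
    moreover have "m \<in> extensional {..<k}" using m by (simp add: PiE_def)
    ultimately show "m \<in> {..<k} \<rightarrow>\<^sub>E ?B" by (simp add: PiE_def)
  qed
  have finB: "finite ({..<k} \<rightarrow>\<^sub>E ?B)" by (intro finite_PiE) auto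
  show fin: "finite ?M" using finite_subset[OF sub finB] .
  have half: "(\<Sum>z\<in>{0..int N}. ?g z) = 2 - (1/2) ^ N" for N
  proof (induction N)
    case (Suc N)
    have "{0..int (Suc N)} = insert (int (Suc N)) {0..int N}" by auto
    then show ?case using Suc by (simp add: nat_add_distrib nat_power_eq)
  qed simp
  have bound: "(\<Sum>z\<in>?B. ?g z) \<le> 3"
  proof -
    have "?B = {0..int n} \<union> uminus ` {1..int n}" by (auto simp: image_iff)
    then have "(\<Sum>z\<in>?B. ?g z) \<le> (\<Sum>z\<in>{0..int n}. ?g z) + (\<Sum>z\<in>uminus ` {1..int n}. ?g z)"
      by (simp add: sum_Un sum_nonneg)
    also have "(\<Sum>z\<in>uminus ` {1..int n}. ?g z) = (\<Sum>z\<in>{1..int n}. ?g z)"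
      by (subst sum.reindex) auto
    also have "{0..int n} = insert 0 {1..int n}" by auto
    then have "(\<Sum>z\<in>{1..int n}. ?g z) = (\<Sum>z\<in>{0..int n}. ?g z) - 1" by simp
    finally have "(\<Sum>z\<in>?B. ?g z) \<le> 3 - 2 * (1/2) ^ n" unfolding half by simp
    moreover have "(0::real) \<le> (1/2) ^ n" by simp
    ultimately show ?thesis by linarith
  qed
  have "real (card ?M) = (\<Sum>m\<in>?M. 1)" by simp
  also have "\<dots> \<le> (\<Sum>m\<in>?M. 2 ^ n * (\<Prod>i<k. ?g (m i)))"
  proof (rule sum_mono)
    fix m assume m: "m \<in> ?M"
    have "(\<Prod>i<k. ?g (m i)) = (1/2) ^ (\<Sum>i<k. nat \<bar>m i\<bar>)" by (simp add: power_sum)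
    moreover have "(\<Sum>i<k. nat \<bar>m i\<bar>) \<le> n"
    proof -
      have "int (\<Sum>i<k. nat \<bar>m i\<bar>) = (\<Sum>i<k. \<bar>m i\<bar>)" by (simp add: of_nat_sum)
      moreover have "(\<Sum>i<k. \<bar>m i\<bar>) \<le> int n" using m by blast
      ultimately show ?thesis by linarith
    qed
    then have "(1/2::real) ^ n \<le> (1/2) ^ (\<Sum>i<k. nat \<bar>m i\<bar>)" by (intro power_decreasing) auto
    moreover have "(2::real) ^ n * (1/2) ^ n = 1" by (simp flip: power_mult_distrib)
    ultimately show "1 \<le> 2 ^ n * (\<Prod>i<k. ?g (m i))"
      by (metis mult_left_mono zero_le_numeral zero_le_power)
  qed
  also have "\<dots> \<le> (\<Sum>m\<in>{..<k} \<rightarrow>\<^sub>E ?B. 2 ^ n * (\<Prod>i<k. ?g (m i)))"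
    using sub finB by (intro sum_mono2) (auto intro!: mult_nonneg_nonneg prod_nonneg)
  also have "\<dots> = 2 ^ n * (\<Prod>i<k. \<Sum>z\<in>?B. ?g z)"
    by (subst prod_sum_PiE) (auto simp: sum_distrib_left)
  also have "\<dots> \<le> 2 ^ n * 3 ^ k"
    using bound by (auto intro!: mult_left_mono power_mono sum_nonneg)
  finally show "real (card ?M) \<le> 2 ^ n * 3 ^ k" .
qed

text \<open>Cutting the unit ball into cells of side \<open>1/sqrt d\<close> yields only exponentially many of them.\<close>

lemma tri_ball_count:
  fixes b :: "nat \<Rightarrow> real"
  assumes b: "\<And>i. i < k \<Longrightarrow> 0 < b i"
    and c: "\<And>i y y'. i < k \<Longrightarrow> (\<And>l. l < i \<Longrightarrow> y l = y' l) \<Longrightarrow> c i y = c i y'"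
    and d: "k \<le> d" "0 < d"
  defines "Y \<equiv> {y \<in> {..<k} \<rightarrow>\<^sub>E (UNIV::int set). (\<Sum>i<k. ((of_int (y i) + c i y) / b i)\<^sup>2) \<le> 1}"
  shows "finite Y \<and> real (card Y) \<le> 48 ^ d * (\<Prod>i<k. b i / sqrt d + 1)"
proof -
  define \<delta> where "\<delta> = 1 / sqrt (real d)"
  have \<delta>: "\<delta> > 0" "1 / \<delta> = sqrt d" using d by (auto simp: \<delta>_def)
  \<comment> \<open>A coordinate \<open>t\<close>, measured in units of \<open>\<delta>\<close>,
    satisfies \<open>\<bar>\<lfloor>t\<rfloor>\<bar> \<le> 2 * t\<^sup>2 + 2\<close>. On the unit
    ball the squares \<open>t\<^sup>2\<close> sum to at most \<open>d\<close>, so the cell indices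
    sum to at most \<open>2 * d + 2 * k\<close>, hence to at most \<open>4 * d\<close>.\<close>
  define M where "M = {m \<in> {..<k} \<rightarrow>\<^sub>E (UNIV::int set). (\<Sum>i<k. \<bar>m i\<bar>) \<le> int (4 * d)}"
  define T where "T m = tri_box k c (\<lambda>i. 1 / b i) (\<lambda>i. \<delta> * of_int (m i)) (\<lambda>i. \<delta>)" for m :: "nat \<Rightarrow> int"
  have M: "finite M" "real (card M) \<le> 2 ^ (4 * d) * 3 ^ k"
    using card_small_int_vectors[of k "4 * d"] by (auto simp: M_def)
  have T: "finite (T m)" "real (card (T m)) \<le> (\<Prod>i<k. b i / sqrt d + 1)" for m
  proof -
    have *: "finite (T m) \<and> real (card (T m)) \<le> (\<Prod>i<k. \<delta> / (1 / b i) + 1) \<and>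
        ((\<forall>i<k. 1 / b i \<le> \<delta>) \<longrightarrow> (\<Prod>i<k. \<delta> / (1 / b i) - 1) \<le> real (card (T m)))"
      unfolding T_def
      by (rule tri_box_count) (use b \<delta>(1) in simp, use \<delta>(1) in simp, rule c)
    have "\<delta> / (1 / b i) = b i / sqrt d" for i by (simp add: \<delta>_def)
    then show "finite (T m)" "real (card (T m)) \<le> (\<Prod>i<k. b i / sqrt d + 1)" using * by simp_all
  qed
  have sub: "Y \<subseteq> (\<Union>m\<in>M. T m)"
  proof
    fix y assume y: "y \<in> Y"
    define p where "p i = (of_int (y i) + c i y) / b i" for i
    define m where "m = (\<lambda>i\<in>{..<k}. \<lfloor>p i / \<delta>\<rfloor>)"
    have "\<bar>m i\<bar> \<le> 2 * (p i)\<^sup>2 * d + 2" if "i < k" for i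
    proof -
      define t where "t = p i / \<delta>"
      have t2: "t\<^sup>2 = (p i)\<^sup>2 * d" using \<delta>(2) by (simp add: t_def \<delta>_def power_mult_distrib)
      have "of_int \<bar>\<lfloor>t\<rfloor>\<bar> \<le> \<bar>t\<bar> + 1" by linarith
      also have "\<dots> \<le> 2 * t\<^sup>2 + 2"
        using sum_power2_ge_zero[of "\<bar>t\<bar> - 1/2" 0] by (simp add: power2_eq_square algebra_simps abs_mult_self_eq)
      finally show ?thesis using that unfolding m_def t_def[symmetric] using t2 by (simp add: algebra_simps t_def)
    qed
    then have "(\<Sum>i<k. real_of_int \<bar>m i\<bar>) \<le> (\<Sum>i<k. 2 * (p i)\<^sup>2 * d + 2)" by (intro sum_mono) auto
    also have "\<dots> = 2 * d * (\<Sum>i<k. (p i)\<^sup>2) + 2 * k"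
      by (simp add: sum.distrib sum_distrib_left algebra_simps)
    also have "\<dots> \<le> real (2 * d) * 1 + real (2 * d)"
      using y d by (intro add_mono mult_left_mono) (auto simp: Y_def p_def)
    finally have "real_of_int (\<Sum>i<k. \<bar>m i\<bar>) \<le> real_of_int (int (4 * d))" by simp
    then have "m \<in> M" unfolding M_def of_int_le_iff by (auto simp: m_def)
    moreover have "y \<in> T m"
    proof -
      have "\<delta> * of_int (m i) \<le> p i \<and> p i < \<delta> * of_int (m i) + \<delta>" if "i < k" for i
      proof -
        have "of_int \<lfloor>p i / \<delta>\<rfloor> \<le> p i / \<delta>" "p i / \<delta> < of_int \<lfloor>p i / \<delta>\<rfloor> + 1" by linarith+
        then have "of_int \<lfloor>p i / \<delta>\<rfloor> * \<delta> \<le> p i" "p i < (of_int \<lfloor>p i / \<delta>\<rfloor> + 1) * \<delta>"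
          using \<delta>(1) by (simp_all only: pos_le_divide_eq pos_divide_less_eq)
        then show ?thesis using that by (simp add: m_def algebra_simps)
      qed
      then show ?thesis using y by (auto simp: T_def tri_box_def Y_def p_def)
    qed
    ultimately show "y \<in> (\<Union>m\<in>M. T m)" by blast
  qed
  have fin: "finite Y" using finite_subset[OF sub] M T by auto
  have pos: "0 \<le> (\<Prod>i<k. b i / sqrt d + 1)"
    using b by (intro prod_nonneg ballI add_nonneg_nonneg divide_nonneg_nonneg) (auto intro: less_imp_le)
  have "real (card Y) \<le> real (card (\<Union>m\<in>M. T m))"
    using sub M T by (intro of_nat_mono card_mono) auto
  also have "\<dots> \<le> real (\<Sum>m\<in>M. card (T m))" using M by (intro of_nat_mono card_UN_le)
  also have "\<dots> = (\<Sum>m\<in>M. real (card (T m)))" by simp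
  also have "\<dots> \<le> (\<Sum>m\<in>M. \<Prod>i<k. b i / sqrt d + 1)" by (intro sum_mono T)
  also have "\<dots> = real (card M) * (\<Prod>i<k. b i / sqrt d + 1)" by simp
  also have "\<dots> \<le> (2 ^ (4 * d) * 3 ^ k) * (\<Prod>i<k. b i / sqrt d + 1)"
    using M pos by (intro mult_right_mono) auto
  also have "\<dots> \<le> (2 ^ (4 * d) * 3 ^ d) * (\<Prod>i<k. b i / sqrt d + 1)"
    using d pos by (intro mult_right_mono mult_left_mono power_increasing) auto
  also have "(2 ^ (4 * d) * 3 ^ d :: real) = 48 ^ d"
    by (simp add: power_mult flip: power_mult_distrib)
  finally show ?thesis using fin by blast
qed

section \<open>Gram--Schmidt orthogonalisation\<close>

definition coord_space :: "nat \<Rightarrow> (nat \<Rightarrow> real) set"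
  where "coord_space d = {x. \<forall>i\<ge>d. x i = 0}"

definition ip :: "nat \<Rightarrow> (nat \<Rightarrow> real) \<Rightarrow> (nat \<Rightarrow> real) \<Rightarrow> real"
  where "ip d x y = (\<Sum>i<d. x i * y i)"

definition std_vec :: "nat \<Rightarrow> nat \<Rightarrow> real"
  where "std_vec j = (\<lambda>i. of_bool (i = j))"

definition orthonormal_fam :: "nat \<Rightarrow> nat \<Rightarrow> (nat \<Rightarrow> nat \<Rightarrow> real) \<Rightarrow> bool"
  where "orthonormal_fam d p f \<longleftrightarrow> (\<forall>i<p. f i \<in> coord_space d) \<and>
    (\<forall>i<p. \<forall>j<p. ip d (f i) (f j) = of_bool (i = j))"

text \<open>For an orthonormal family, the component of \<open>w\<close> orthogonal to its first
  \<open>p\<close> members. Its length is the length of \<open>w\<close> modulo those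
  members.\<close>

definition resid :: "nat \<Rightarrow> nat \<Rightarrow> (nat \<Rightarrow> nat \<Rightarrow> real) \<Rightarrow> (nat \<Rightarrow> real) \<Rightarrow> nat \<Rightarrow> real"
  where "resid d p f w = (\<lambda>i. w i - (\<Sum>l<p. ip d w (f l) * f l i))"

lemma coord_space_eq: "coord_space d = topspace (Euclidean_space d)"
  by (simp add: coord_space_def topspace_Euclidean_space)

lemma subspace_coord_space: "subspace (coord_space d)"
  by (auto simp: subspace_def coord_space_def scaleR_fun_def)

lemma coord_space_ext:
  "x \<in> coord_space d \<Longrightarrow> y \<in> coord_space d \<Longrightarrow> (\<And>i. i < d \<Longrightarrow> x i = y i) \<Longrightarrow> x = y"
  by (rule ext) (metis (mono_tags, lifting) coord_space_def mem_Collect_eq not_le)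

lemma std_vec_in [simp]: "j < d \<Longrightarrow> std_vec j \<in> coord_space d"
  by (auto simp: std_vec_def coord_space_def)

lemma ip_cong:
  "(\<And>i. i < d \<Longrightarrow> x i = x' i) \<Longrightarrow> (\<And>i. i < d \<Longrightarrow> y i = y' i) \<Longrightarrow> ip d x y = ip d x' y'"
  by (simp add: ip_def)

lemma ip_commute: "ip d x y = ip d y x"
  by (simp add: ip_def mult.commute)

lemma ip_add_left: "ip d (\<lambda>i. x i + y i) z = ip d x z + ip d y z"
  and ip_diff_left: "ip d (\<lambda>i. x i - y i) z = ip d x z - ip d y z"
  and ip_scale_left: "ip d (\<lambda>i. a * x i) z = a * ip d x z"
  and ip_zero_left: "ip d (\<lambda>i. 0) z = 0"
  and ip_sum_left: "ip d (\<lambda>i. \<Sum>l\<in>S. g l i) z = (\<Sum>l\<in>S. ip d (g l) z)"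
proof -
  show "ip d (\<lambda>i. \<Sum>l\<in>S. g l i) z = (\<Sum>l\<in>S. ip d (g l) z)"
    unfolding ip_def sum_distrib_right by (rule sum.swap)
qed (simp_all add: ip_def sum.distrib sum_subtractf sum_distrib_left algebra_simps)

lemma ip_add_right: "ip d z (\<lambda>i. x i + y i) = ip d z x + ip d z y"
  and ip_diff_right: "ip d z (\<lambda>i. x i - y i) = ip d z x - ip d z y"
  and ip_scale_right: "ip d z (\<lambda>i. a * x i) = a * ip d z x"
  and ip_zero_right: "ip d z (\<lambda>i. 0) = 0"
  and ip_sum_right: "ip d z (\<lambda>i. \<Sum>l\<in>S. g l i) = (\<Sum>l\<in>S. ip d z (g l))"
  unfolding ip_commute[of d z]
  by (rule ip_add_left ip_diff_left ip_scale_left ip_zero_left ip_sum_left)+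

lemmas ip_linear = ip_add_left ip_diff_left ip_scale_left ip_zero_left ip_sum_left
  ip_add_right ip_diff_right ip_scale_right ip_zero_right ip_sum_right

lemma ip_self_nonneg: "0 \<le> ip d x x"
  by (simp add: ip_def sum_nonneg)

lemma ip_self_eq_0:
  assumes x: "x \<in> coord_space d"
  shows "ip d x x = 0 \<longleftrightarrow> x = (\<lambda>_. 0)"
proof
  assume "ip d x x = 0"
  then have "x i = 0" if "i < d" for i using that by (simp add: ip_def sum_nonneg_eq_0_iff)
  then show "x = (\<lambda>_. 0)" using x by (intro coord_space_ext[OF x]) (auto simp: coord_space_def)
qed (simp add: ip_zero_left)

lemma ip_std_vec: "j < d \<Longrightarrow> ip d x (std_vec j) = x j"
  by (simp add: ip_def std_vec_def if_distrib of_bool_def cong: if_cong)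

lemma ip_cauchy_schwarz: "(ip d x y)\<^sup>2 \<le> ip d x x * ip d y y"
  using Cauchy_Schwarz_ineq_sum[of x y "{..<d}"] by (simp add: ip_def power2_eq_square)

lemma subspace_perp: "subspace {x. ip d x z = 0}"
  by (auto simp: subspace_def scaleR_fun_def plus_fun_def zero_fun_def ip_linear)

lemma std_vec_independent: "independent (std_vec ` {..<d})"
proof
  assume "dependent (std_vec ` {..<d})"
  then obtain j where j: "j < d" "std_vec j \<in> span (std_vec ` {..<d} - {std_vec j})"
    by (auto simp: dependent_def)
  have "span (std_vec ` {..<d} - {std_vec j}) \<subseteq> {x. ip d x (std_vec j) = 0}"
    using j(1) by (intro span_minimal subspace_perp) (auto simp: ip_std_vec, auto simp: std_vec_def)
  then have "ip d (std_vec j) (std_vec j) = 0" using j by auto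
  then show False using j(1) by (simp add: ip_std_vec) (simp add: std_vec_def)
qed

lemma inj_std_vec: "inj std_vec"
proof (rule injI)
  fix i j assume "std_vec i = std_vec j"
  from fun_cong[OF this, of i] show "i = j" by (simp add: std_vec_def split: if_splits)
qed

lemma sum_apply: "(\<Sum>l\<in>S. g l) i = (\<Sum>l\<in>S. (g l :: nat \<Rightarrow> real) i)"
  by (induction S rule: infinite_finite_induct) auto

lemma coord_space_subset_span: "coord_space d \<subseteq> span (std_vec ` {..<d})"
proof
  fix x :: "nat \<Rightarrow> real" assume x: "x \<in> coord_space d"
  have "x = (\<Sum>j<d. x j *\<^sub>R std_vec j)"
    using x by (auto simp: fun_eq_iff sum_apply scaleR_fun_def std_vec_def coord_space_def
        if_distrib of_bool_def cong: if_cong)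
  also have "\<dots> \<in> span (std_vec ` {..<d})"
    by (intro span_sum span_scale span_base) auto
  finally show "x \<in> span (std_vec ` {..<d})" .
qed

lemma independent_coord_space_card:
  assumes "independent S" "S \<subseteq> coord_space d"
  shows "finite S \<and> card S \<le> d"
proof -
  have "finite S \<and> card S \<le> card (std_vec ` {..<d})"
    by (rule independent_span_bound) (use assms coord_space_subset_span in auto)
  then show ?thesis using card_image_le[of "{..<d}" std_vec] by auto
qed

lemma orthonormal_fam_independent:
  assumes f: "orthonormal_fam d p f"
  shows "independent (f ` {..<p})" "inj_on f {..<p}"
proof -
  have one: "ip d (f i) (f j) = of_bool (i = j)" if "i < p" "j < p" for i j
    using f that by (simp add: orthonormal_fam_def)
  show "inj_on f {..<p}" 
  proof (rule inj_onI)
    fix i j assume "i \<in> {..<p}" "j \<in> {..<p}" "f i = f j"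
    then show "i = j" using one[of i i] one[of i j] by (auto split: if_splits)
  qed
  show "independent (f ` {..<p})"
  proof
    assume "dependent (f ` {..<p})"
    then obtain j where j: "j < p" "f j \<in> span (f ` {..<p} - {f j})"
      by (auto simp: dependent_def)
    have "span (f ` {..<p} - {f j}) \<subseteq> {x. ip d x (f j) = 0}"
      using one j(1) by (intro span_minimal subspace_perp) auto
    then have "ip d (f j) (f j) = 0" using j(2) by blast
    then show False using one[OF j(1) j(1)] by simp
  qed
qed

lemma orthonormal_fam_le: "orthonormal_fam d p f \<Longrightarrow> p \<le> d"
proof -
  assume f: "orthonormal_fam d p f"
  then have "f ` {..<p} \<subseteq> coord_space d" by (auto simp: orthonormal_fam_def)
  then show "p \<le> d"
    using orthonormal_fam_independent[OF f] independent_coord_space_card[of "f ` {..<p}" d]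
    by (simp add: card_image)
qed

lemma resid_in: "orthonormal_fam d p f \<Longrightarrow> w \<in> coord_space d \<Longrightarrow> resid d p f w \<in> coord_space d"
  by (auto simp: resid_def coord_space_def orthonormal_fam_def)

lemma ip_resid:
  assumes "orthonormal_fam d p f" "l < p"
  shows "ip d (resid d p f w) (f l) = 0"
proof -
  have "(\<Sum>m<p. ip d w (f m) * ip d (f m) (f l)) = (\<Sum>m<p. if m = l then ip d w (f m) else 0)"
    using assms by (intro sum.cong) (auto simp: orthonormal_fam_def)
  then show ?thesis using assms(2) by (simp add: resid_def ip_linear)
qed

lemma ip_resid_resid:
  assumes "orthonormal_fam d p f"
  shows "ip d (resid d p f w) (resid d p f v) = ip d (resid d p f w) v"
    and "ip d (resid d p f w) (resid d p f w) = ip d w w - (\<Sum>l<p. (ip d w (f l))\<^sup>2)"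
proof -
  show *: "ip d (resid d p f w) (resid d p f v) = ip d (resid d p f w) v" for v
    by (subst (2) resid_def) (simp add: ip_linear ip_resid[OF assms])
  show "ip d (resid d p f w) (resid d p f w) = ip d w w - (\<Sum>l<p. (ip d w (f l))\<^sup>2)"
    unfolding * by (simp add: resid_def ip_linear power2_eq_square ip_commute)
qed

lemma resid_cong: "(\<And>l. l < p \<Longrightarrow> f l = f' l) \<Longrightarrow> resid d p f = resid d p f'"
  by (intro ext) (simp add: resid_def)

lemma orthonormal_fam_extend:
  assumes f: "orthonormal_fam d p f" and w: "w \<in> coord_space d" "resid d p f w \<noteq> (\<lambda>_. 0)"
  defines "r \<equiv> resid d p f w"
  defines "v \<equiv> (\<lambda>i. r i / sqrt (ip d r r))"
  shows "orthonormal_fam d (Suc p) (f(p := v))"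
    and "ip d w v = sqrt (ip d r r)" "0 < ip d r r"
    and "\<And>z. (\<And>l. l < p \<Longrightarrow> ip d (f l) z = 0) \<Longrightarrow> ip d v z = 0 \<Longrightarrow> ip d w z = 0"
proof -
  have r: "r \<in> coord_space d" using resid_in[OF f w(1)] by (simp add: r_def)
  then show pos: "0 < ip d r r" using ip_self_eq_0[of r d] ip_self_nonneg[of d r] w(2) r_def by force
  have v: "v = (\<lambda>i. (1 / sqrt (ip d r r)) * r i)" by (simp add: v_def)
  have vv: "ip d v v = 1" unfolding v ip_linear using pos by (simp add: field_simps)
  have vf: "ip d v (f l) = 0" if "l < p" for l
    unfolding v ip_linear using ip_resid[OF f that] by (simp add: r_def)
  have fv: "ip d (f l) v = 0" if "l < p" for l
    using vf[OF that] by (simp add: ip_commute)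
  have "v \<in> coord_space d" using r by (simp add: v_def coord_space_def)
  then show "orthonormal_fam d (Suc p) (f(p := v))"
    using f vv vf fv by (auto simp: orthonormal_fam_def less_Suc_eq)
  have "ip d w r = ip d r r" using ip_resid_resid(1)[OF f, of w w] by (simp add: r_def ip_commute)
  then show "ip d w v = sqrt (ip d r r)" unfolding v ip_linear using pos by (simp add: real_div_sqrt)
  show "ip d w z = 0" if "\<And>l. l < p \<Longrightarrow> ip d (f l) z = 0" "ip d v z = 0" for z
  proof -
    have "ip d r z = 0" using that(2) pos unfolding v ip_linear by simp
    then show ?thesis using that(1) unfolding r_def resid_def by (simp add: ip_linear)
  qed
qed

lemma resid_full:
  assumes f: "orthonormal_fam d d f" and x: "x \<in> coord_space d"
  shows "resid d d f x = (\<lambda>_. 0)"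
proof (rule ccontr)
  assume "resid d d f x \<noteq> (\<lambda>_. 0)"
  from orthonormal_fam_le[OF orthonormal_fam_extend(1)[OF f x this]] show False by simp
qed

lemma parseval:
  assumes f: "orthonormal_fam d d f" and x: "x \<in> coord_space d"
  shows "x = (\<lambda>i. \<Sum>l<d. ip d x (f l) * f l i)"
    and "ip d x y = (\<Sum>l<d. ip d x (f l) * ip d y (f l))"
proof -
  show *: "x = (\<lambda>i. \<Sum>l<d. ip d x (f l) * f l i)"
    using resid_full[OF f x] by (simp add: resid_def fun_eq_iff)
  show "ip d x y = (\<Sum>l<d. ip d x (f l) * ip d y (f l))"
    by (subst *) (simp add: ip_linear ip_commute[of d y])
qed

text \<open>The residuals of the standard vectors cannot all vanish, because fewer than
  \<open>d\<close> vectors do not span them; any nonzero residual serves.\<close>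

lemma exists_perp:
  assumes f: "orthonormal_fam d p f" and p: "p < d"
  obtains z where "z \<in> coord_space d" "z \<noteq> (\<lambda>_. 0)" "\<And>l. l < p \<Longrightarrow> ip d z (f l) = 0"
proof -
  have "\<exists>j<d. resid d p f (std_vec j) \<noteq> (\<lambda>_. 0)"
  proof (rule ccontr)
    assume "\<not> ?thesis"
    then have z: "std_vec j i = (\<Sum>l<p. ip d (std_vec j) (f l) * f l i)" if "j < d" for i j
      using that by (auto simp: resid_def fun_eq_iff)
    have "std_vec j \<in> span (f ` {..<p})" if "j < d" for j
    proof -
      have "std_vec j = (\<Sum>l<p. ip d (std_vec j) (f l) *\<^sub>R f l)"
        using z[OF that] by (simp add: fun_eq_iff sum_apply scaleR_fun_def)
      also have "\<dots> \<in> span (f ` {..<p})" by (intro span_sum span_scale span_base) auto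
      finally show ?thesis .
    qed
    then have "card (std_vec ` {..<d}) \<le> card (f ` {..<p})"
      using independent_span_bound[OF _ std_vec_independent, of "f ` {..<p}" d] by blast
    moreover have "card (std_vec ` {..<d}) = d"
      using inj_std_vec by (simp add: card_image inj_on_subset)
    moreover have "card (f ` {..<p}) \<le> p" using card_image_le[of "{..<p}" f] by simp
    ultimately show False using p by simp
  qed
  then obtain j where "j < d" "resid d p f (std_vec j) \<noteq> (\<lambda>_. 0)" by blast
  then show thesis using that[of "resid d p f (std_vec j)"] resid_in[OF f] ip_resid[OF f] by auto
qed

text \<open>Gram--Schmidt in which each new vector is chosen from \<open>X\<close> only after the
  earlier ones have been orthonormalised, so that the choice may refer to them. That
  \<open>Q p\<close> looks at the first \<open>p\<close> vectors only is what makes a property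
  secured at one stage survive the later extensions. The selection serves both for the reduced basis
  and for picking lattice points with independent projections.\<close>

lemma gram_schmidt_select:
  fixes X :: "(nat \<Rightarrow> real) set"
    and Q :: "nat \<Rightarrow> (nat \<Rightarrow> nat \<Rightarrow> real) \<Rightarrow> (nat \<Rightarrow> real) \<Rightarrow> bool"
  assumes X: "X \<subseteq> coord_space d"
    and sel: "\<And>p f u. p < d \<Longrightarrow> orthonormal_fam d p f \<Longrightarrow>
      (\<And>i. i < p \<Longrightarrow> u i \<in> X) \<Longrightarrow> (\<And>i. i < p \<Longrightarrow> 0 < ip d (u i) (f i)) \<Longrightarrow>
      (\<And>i. i < p \<Longrightarrow> resid d (Suc i) f (u i) = (\<lambda>_. 0)) \<Longrightarrow>
      \<exists>x\<in>X. resid d p f x \<noteq> (\<lambda>_. 0) \<and> Q p f x"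
    and Q: "\<And>p f f' x. (\<And>l. l < p \<Longrightarrow> f l = f' l) \<Longrightarrow> Q p f x \<Longrightarrow> Q p f' x"
  obtains u f where "orthonormal_fam d d f"
    "\<And>i. i < d \<Longrightarrow> u i \<in> X" "\<And>i. i < d \<Longrightarrow> Q i f (u i)" "\<And>i. i < d \<Longrightarrow> 0 < ip d (u i) (f i)"
    "\<And>i. i < d \<Longrightarrow> (ip d (u i) (f i))\<^sup>2 = ip d (resid d i f (u i)) (resid d i f (u i))"
    "\<And>i l. i < l \<Longrightarrow> l < d \<Longrightarrow> ip d (u i) (f l) = 0"
proof -
  \<comment> \<open>The last clause says that \<open>u i\<close> lies in the span of
    \<open>f 0, ..., f i\<close>. In this orthogonal form it gives the triangularity directly and is
    easily carried from stage to stage.\<close>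
  define good where "good p u f \<longleftrightarrow> orthonormal_fam d p f \<and> (\<forall>i<p. u i \<in> X \<and> Q i f (u i) \<and>
      0 < ip d (u i) (f i) \<and> (ip d (u i) (f i))\<^sup>2 = ip d (resid d i f (u i)) (resid d i f (u i)) \<and>
      (\<forall>z. (\<forall>l\<le>i. ip d (f l) z = 0) \<longrightarrow> ip d (u i) z = 0))" for p and u f :: "nat \<Rightarrow> nat \<Rightarrow> real"
  have "\<exists>u f. good p u f" if "p \<le> d" for p
    using that
  proof (induction p)
    case 0
    then show ?case by (auto simp: good_def orthonormal_fam_def)
  next
    case (Suc p)
    then obtain u f where g: "good p u f" by auto
    then have f: "orthonormal_fam d p f" by (simp add: good_def)
    \<comment> \<open>The residual is orthogonal to \<open>f 0, ..., f i\<close>, hence by the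
      invariant to \<open>u i\<close>, and therefore to itself.\<close>
    have "resid d (Suc i) f (u i) = (\<lambda>_. 0)" if i: "i < p" for i
    proof -
      have fi: "orthonormal_fam d (Suc i) f" using f i by (simp add: orthonormal_fam_def)
      let ?r = "resid d (Suc i) f (u i)"
      have "ip d (f l) ?r = 0" if "l \<le> i" for l
        using ip_resid[OF fi, of l "u i"] that by (simp add: ip_commute)
      then have "ip d (u i) ?r = 0" using g i by (simp add: good_def)
      then have "ip d ?r ?r = 0" using ip_resid_resid(1)[OF fi, of "u i" "u i"] by (simp add: ip_commute)
      moreover have "?r \<in> coord_space d" using resid_in[OF fi] g i X by (auto simp: good_def)
      ultimately show ?thesis by (simp add: ip_self_eq_0)
    qed
    then obtain x where x: "x \<in> X" "resid d p f x \<noteq> (\<lambda>_. 0)" "Q p f x"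
      using sel[OF _ f, of u] Suc.prems g by (auto simp: good_def)
    define r v where "r = resid d p f x" and "v = (\<lambda>i. r i / sqrt (ip d r r))"
    note ext = orthonormal_fam_extend[OF f _ x(2), folded r_def, folded v_def]
    have xc: "x \<in> coord_space d" using x X by auto
    let ?f = "f(p := v)" and ?u = "u(p := x)"
    have "good (Suc p) ?u ?f"
      unfolding good_def
    proof (intro conjI allI impI)
      show "orthonormal_fam d (Suc p) ?f" using ext(1)[OF xc] .
    next
      fix i assume i: "i < Suc p"
      have Qi: "Q i f y \<Longrightarrow> Q i ?f y" for y using Q[of i f ?f y] i by auto
      have ri: "resid d i ?f = resid d i f" using i by (intro resid_cong) auto
      show "?u i \<in> X" using g i x(1) by (auto simp: good_def less_Suc_eq)
      show "Q i ?f (?u i)" using Qi g i x(3) by (auto simp: good_def less_Suc_eq)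
      show "0 < ip d (?u i) (?f i)"
        using g i ext(2,3)[OF xc] by (auto simp: good_def less_Suc_eq)
      show "(ip d (?u i) (?f i))\<^sup>2 = ip d (resid d i ?f (?u i)) (resid d i ?f (?u i))"
        using g i ext(2,3)[OF xc] unfolding ri by (auto simp: good_def less_Suc_eq r_def)
      fix z assume z: "\<forall>l\<le>i. ip d (?f l) z = 0"
      show "ip d (?u i) z = 0"
      proof (cases "i = p")
        case True
        have "ip d (f l) z = 0" if "l < p" for l using z[rule_format, of l] that True by simp
        moreover have "ip d v z = 0" using z[rule_format, of p] True by simp
        ultimately show ?thesis using ext(4)[OF xc, of z] True by simp
      next
        case False
        then have "\<forall>l\<le>i. ip d (f l) z = 0" using z i by (metis fun_upd_apply le_less_trans less_Suc_eq_le nat_less_le)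
        then show ?thesis using g i False by (simp add: good_def)
      qed
    qed
    then show ?case by blast
  qed
  then obtain u f where g: "good d u f" by blast
  show thesis
  proof (rule that[of f u])
    show "orthonormal_fam d d f" using g by (simp add: good_def)
    show "ip d (u i) (f l) = 0" if "i < l" "l < d" for i l
    proof -
      have "\<forall>m\<le>i. ip d (f m) (f l) = 0" using g that by (auto simp: good_def orthonormal_fam_def)
      then show ?thesis using g that by (simp add: good_def)
    qed
  qed (use g in \<open>auto simp: good_def\<close>)
qed

section \<open>Reduced bases of the dual lattice\<close>

lemma resid_linear:
  "resid d p f (\<lambda>i. x i - c * y i) = (\<lambda>i. resid d p f x i - c * resid d p f y i)"
  by (auto simp: resid_def fun_eq_iff ip_linear sum_subtractf sum_distrib_left algebra_simps)

lemma resid_eq_0_perp: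
  assumes "resid d p f x = (\<lambda>_. 0)" and z: "\<And>l. l < p \<Longrightarrow> ip d z (f l) = 0"
  shows "ip d x z = 0"
proof -
  have e: "x = (\<lambda>i. \<Sum>l<p. ip d x (f l) * f l i)" using assms(1) by (simp add: resid_def fun_eq_iff)
  have "ip d x z = (\<Sum>l<p. ip d x (f l) * ip d z (f l))"
    by (subst e) (simp add: ip_linear ip_commute[of d z])
  then show ?thesis using z by simp
qed

lemma resid_eq_0_mono:
  assumes f: "orthonormal_fam d p f" and q: "q \<le> p" and y: "resid d q f y = (\<lambda>_. 0)"
  shows "resid d p f y = (\<lambda>_. 0)"
    and "\<And>l. q \<le> l \<Longrightarrow> l < p \<Longrightarrow> ip d y (f l) = 0"
proof -
  have yq: "y = (\<lambda>i. \<Sum>m<q. ip d y (f m) * f m i)"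
    using y by (simp add: resid_def fun_eq_iff)
  show z: "ip d y (f l) = 0" if "q \<le> l" "l < p" for l
    by (subst yq) (use f that in \<open>auto simp: ip_linear orthonormal_fam_def\<close>)
  have "(\<Sum>l<p. ip d y (f l) * f l i) = (\<Sum>l<q. ip d y (f l) * f l i)" for i
    using q z by (intro sum.mono_neutral_right) auto
  then show "resid d p f y = (\<lambda>_. 0)" using y by (simp add: resid_def)
qed

lemma ip_resid_eq_tail:
  assumes f: "orthonormal_fam d d f" and p: "p \<le> d" and y: "y \<in> coord_space d"
  shows "ip d (resid d p f y) (resid d p f y) = (\<Sum>l\<in>{p..<d}. (ip d y (f l))\<^sup>2)"
proof -
  have fp: "orthonormal_fam d p f" using f p by (simp add: orthonormal_fam_def)
  have "ip d y y = (\<Sum>l<p. (ip d y (f l))\<^sup>2) + (\<Sum>l\<in>{p..<d}. (ip d y (f l))\<^sup>2)"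
    using parseval(2)[OF f y, of y] sum.atLeastLessThan_concat[of 0 p d "\<lambda>l. (ip d y (f l))\<^sup>2"] p
    by (simp add: power2_eq_square lessThan_atLeast0)
  then show ?thesis using ip_resid_resid(2)[OF fp, of y] by simp
qed

text \<open>The \<open>a j\<close> form a basis of a lattice and the \<open>w j\<close> the dual basis; \<open>dlat\<close> is the dual lattice.\<close>

locale dual_frame =
  fixes d :: nat and a w :: "nat \<Rightarrow> nat \<Rightarrow> real"
  assumes w_in: "j < d \<Longrightarrow> w j \<in> coord_space d"
    and a_in: "j < d \<Longrightarrow> a j \<in> coord_space d"
    and biorth: "i < d \<Longrightarrow> j < d \<Longrightarrow> ip d (w i) (a j) = of_bool (i = j)"
    and expand: "z \<in> coord_space d \<Longrightarrow> z = (\<lambda>i. \<Sum>j<d. ip d (w j) z * a j i)"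
begin

definition dlat :: "(nat \<Rightarrow> real) set"
  where "dlat = range (\<lambda>n::nat \<Rightarrow> int. \<lambda>i. \<Sum>j<d. of_int (n j) * w j i)"

text \<open>The linear map that sends integer coordinates to the lattice spanned by the
  \<open>a j\<close>. In the application it coincides with \<open>lin d A\<close> for the matrix of
  the ellipsoid, so the ellipsoid becomes the unit ball.\<close>

definition emb :: "(nat \<Rightarrow> real) \<Rightarrow> nat \<Rightarrow> real"
  where "emb x = (\<lambda>i. \<Sum>j<d. x j * a j i)"

lemma dlat_subset: "dlat \<subseteq> coord_space d"
proof
  fix y assume "y \<in> dlat"
  then obtain n :: "nat \<Rightarrow> int" where "y = (\<lambda>i. \<Sum>j<d. of_int (n j) * w j i)"
    by (auto simp: dlat_def)
  then show "y \<in> coord_space d" using w_in by (auto simp: coord_space_def)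
qed

lemma dlat_w: "j < d \<Longrightarrow> w j \<in> dlat"
  unfolding dlat_def
  by (rule range_eqI[of _ _ "\<lambda>i. if i = j then 1 else 0"])
    (simp add: fun_eq_iff if_distrib if_distribR cong: if_cong)

lemma dlat_diff: "x \<in> dlat \<Longrightarrow> y \<in> dlat \<Longrightarrow> (\<lambda>i. x i - of_int c * y i) \<in> dlat"
proof -
  assume "x \<in> dlat" "y \<in> dlat"
  then obtain n m :: "nat \<Rightarrow> int" where
    n: "x = (\<lambda>i. \<Sum>j<d. of_int (n j) * w j i)" and m: "y = (\<lambda>i. \<Sum>j<d. of_int (m j) * w j i)"
    by (auto simp: dlat_def)
  have "(\<lambda>i. x i - of_int c * y i) = (\<lambda>i. \<Sum>j<d. of_int (n j - c * m j) * w j i)"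
    unfolding n m by (simp add: fun_eq_iff algebra_simps sum_subtractf sum_distrib_left)
  then show "(\<lambda>i. x i - of_int c * y i) \<in> dlat"
    unfolding dlat_def by (rule range_eqI[of _ _ "\<lambda>j. n j - c * m j"])
qed

lemma dlat_zero: "(\<lambda>_. 0) \<in> dlat"
  unfolding dlat_def by (rule range_eqI[of _ _ "\<lambda>_. 0"]) simp

lemma dlat_sum:
  assumes "finite S" "\<And>i. i \<in> S \<Longrightarrow> u i \<in> dlat"
  shows "(\<lambda>m. \<Sum>i\<in>S. of_int (z i) * u i m) \<in> dlat"
  using assms
proof (induction S rule: finite_induct)
  case empty
  then show ?case by (simp add: dlat_zero)
next
  case (insert x S)
  then have "(\<lambda>m. (\<Sum>i\<in>S. of_int (z i) * u i m) - of_int (- z x) * u x m) \<in> dlat"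
    by (intro dlat_diff) auto
  then show ?case using insert.hyps by (simp add: add.commute)
qed

lemma perp_w_eq_0:
  assumes "z \<in> coord_space d" "\<And>j. j < d \<Longrightarrow> ip d (w j) z = 0"
  shows "z = (\<lambda>_. 0)"
  using expand[OF assms(1)] assms(2) by (simp add: fun_eq_iff)

text \<open>The integer coefficients of a dual vector are its inner products with the
  \<open>a j\<close>, so Cauchy--Schwarz bounds them in terms of its length.\<close>

lemma finite_dlat_bounded: "finite {y \<in> dlat. ip d y y \<le> R}"
proof -
  define B where "B = (\<Sum>j<d. ip d (a j) (a j) * \<bar>R\<bar> + 1)"
  let ?N = "{..<d} \<rightarrow>\<^sub>E {- \<lceil>B\<rceil>..\<lceil>B\<rceil>}"
  let ?g = "\<lambda>n::nat \<Rightarrow> int. \<lambda>i. \<Sum>j<d. of_int (n j) * w j i"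
  have "{y \<in> dlat. ip d y y \<le> R} \<subseteq> ?g ` ?N"
  proof
    fix y assume "y \<in> {y \<in> dlat. ip d y y \<le> R}"
    then obtain n :: "nat \<Rightarrow> int" where n: "y = ?g n" and R: "ip d y y \<le> R"
      by (auto simp: dlat_def)
    have "n j \<in> {- \<lceil>B\<rceil>..\<lceil>B\<rceil>}" if j: "j < d" for j
    proof -
      have "ip d y (a j) = (\<Sum>i<d. of_int (n i) * ip d (w i) (a j))"
        unfolding n by (simp add: ip_linear)
      also have "\<dots> = (\<Sum>i<d. if i = j then of_int (n i) else 0)"
        using j by (intro sum.cong) (auto simp: biorth)
      finally have nj: "ip d y (a j) = of_int (n j)" using j by simp
      have "real_of_int (\<bar>n j\<bar>) \<le> real_of_int ((n j)\<^sup>2)"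
        unfolding of_int_le_iff by (metis abs_ge_zero abs_le_square_iff abs_of_nonneg power2_abs self_le_power
            zero_less_numeral int_one_le_iff_zero_less le_less power_zero_numeral zero_le_power2 pos2)
      also have "\<dots> \<le> ip d y y * ip d (a j) (a j)"
        using ip_cauchy_schwarz[of d y "a j"] by (simp add: nj)
      also have "\<dots> \<le> \<bar>R\<bar> * ip d (a j) (a j)" using R by (intro mult_right_mono ip_self_nonneg) auto
      also have "\<dots> \<le> ip d (a j) (a j) * \<bar>R\<bar> + 1" by simp
      also have "\<dots> \<le> B" unfolding B_def
        using j by (intro member_le_sum) (auto intro!: add_nonneg_nonneg mult_nonneg_nonneg ip_self_nonneg)
      finally have "\<bar>n j\<bar> \<le> \<lceil>B\<rceil>" by linarith
      then show ?thesis by (simp add: abs_le_iff)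
    qed
    then have "restrict n {..<d} \<in> ?N" by auto
    moreover have "y = ?g (restrict n {..<d})" unfolding n by simp
    ultimately show "y \<in> ?g ` ?N" by blast
  qed
  then show ?thesis by (rule finite_subset) (intro finite_imageI finite_PiE, auto)
qed

text \<open>Size reduction from \<open>f (p - 1)\<close> downwards; \<open>t\<close> is the number
  of coordinates already treated. Since \<open>u i\<close> lies in the span of
  \<open>f 0, ..., f i\<close>, subtracting a multiple of it changes neither the coordinates beyond
  \<open>i\<close> nor the residual modulo the first \<open>p\<close> vectors.\<close>

lemma dlat_reduce:
  assumes f: "orthonormal_fam d p f" and u: "\<And>i. i < p \<Longrightarrow> u i \<in> dlat"
    and pos: "\<And>i. i < p \<Longrightarrow> 0 < ip d (u i) (f i)"
    and tri: "\<And>i. i < p \<Longrightarrow> resid d (Suc i) f (u i) = (\<lambda>_. 0)"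
    and y: "y \<in> dlat" and t: "t \<le> p"
  shows "\<exists>y'\<in>dlat. resid d p f y' = resid d p f y \<and>
    (\<forall>l. p - t \<le> l \<and> l < p \<longrightarrow> \<bar>ip d y' (f l)\<bar> \<le> ip d (u l) (f l))"
  using t
proof (induction t)
  case 0
  then show ?case using y by auto
next
  case (Suc t)
  then obtain y' where y': "y' \<in> dlat" "resid d p f y' = resid d p f y"
    "\<And>l. p - t \<le> l \<Longrightarrow> l < p \<Longrightarrow> \<bar>ip d y' (f l)\<bar> \<le> ip d (u l) (f l)" by auto
  define i where "i = p - Suc t"
  have i: "i < p" "Suc i = p - t" using Suc.prems by (auto simp: i_def)
  define c where "c = \<lfloor>ip d y' (f i) / ip d (u i) (f i)\<rfloor>"
  define y'' where "y'' = (\<lambda>m. y' m - of_int c * u i m)"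
  have z: "resid d p f (u i) = (\<lambda>_. 0)" "\<And>l. Suc i \<le> l \<Longrightarrow> l < p \<Longrightarrow> ip d (u i) (f l) = 0"
    using resid_eq_0_mono[OF f _ tri[OF i(1)]] i by auto
  have "resid d p f y'' = resid d p f y" unfolding y''_def resid_linear z y'(2) by simp
  moreover have "\<bar>ip d y'' (f l)\<bar> \<le> ip d (u l) (f l)" if "i \<le> l" "l < p" for l
  proof (cases "l = i")
    case True
    let ?b = "ip d (u i) (f i)"
    have b: "?b > 0" using pos i by simp
    have "of_int c \<le> ip d y' (f i) / ?b" "ip d y' (f i) / ?b < of_int c + 1"
      unfolding c_def by linarith+
    then have "of_int c * ?b \<le> ip d y' (f i)" "ip d y' (f i) < (of_int c + 1) * ?b"
      using b by (simp_all only: pos_le_divide_eq pos_divide_less_eq)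
    then show ?thesis using True by (simp add: y''_def ip_linear algebra_simps)
  next
    case False
    then have "Suc i \<le> l" using that by simp
    then show ?thesis using y'(3)[of l] z(2)[of l] that i by (simp add: y''_def ip_linear)
  qed
  moreover have "y'' \<in> dlat" unfolding y''_def using y' u i by (intro dlat_diff) auto
  ultimately show ?case unfolding i_def by blast
qed

text \<open>The Hermite--Korkine--Zolotarev condition: the projection of \<open>x\<close> is no
  longer than any nonzero vector of the dual lattice projected orthogonally to
  \<open>f 0, ..., f (p - 1)\<close>.\<close>

definition shortest_mod :: "nat \<Rightarrow> (nat \<Rightarrow> nat \<Rightarrow> real) \<Rightarrow> (nat \<Rightarrow> real) \<Rightarrow> bool"
  where "shortest_mod p f x \<longleftrightarrow> (\<forall>y\<in>dlat. resid d p f y \<noteq> (\<lambda>_. 0) \<longrightarrow>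
    ip d (resid d p f x) (resid d p f x) \<le> ip d (resid d p f y) (resid d p f y))"

text \<open>The projected lattice must be seen to have a shortest nonzero vector. By
  \<open>dlat_reduce\<close>, each projection has a representative whose squared length exceeds that
  of the projection by at most \<open>B\<close>; hence all projections no longer than that of
  \<open>w j\<close> have representatives in the finite set \<open>F\<close>. The vector
  \<open>z\<close>, orthogonal to the earlier \<open>f l\<close>, guarantees a \<open>w j\<close>
  with nonzero projection.\<close>

lemma exists_shortest_mod:
  assumes p: "p < d" and f: "orthonormal_fam d p f" and u: "\<And>i. i < p \<Longrightarrow> u i \<in> dlat"
    and pos: "\<And>i. i < p \<Longrightarrow> 0 < ip d (u i) (f i)"
    and tri: "\<And>i. i < p \<Longrightarrow> resid d (Suc i) f (u i) = (\<lambda>_. 0)"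
  shows "\<exists>x\<in>dlat. resid d p f x \<noteq> (\<lambda>_. 0) \<and> shortest_mod p f x"
proof -
  let ?N = "\<lambda>y. ip d (resid d p f y) (resid d p f y)"
  define B where "B = (\<Sum>l<p. (ip d (u l) (f l))\<^sup>2)"
  obtain z where z: "z \<in> coord_space d" "z \<noteq> (\<lambda>_. 0)" "\<And>l. l < p \<Longrightarrow> ip d z (f l) = 0"
    by (rule exists_perp[OF f p]) blast
  obtain j where j: "j < d" "ip d (w j) z \<noteq> 0" using perp_w_eq_0[OF z(1)] z(2) by blast
  have wj: "resid d p f (w j) \<noteq> (\<lambda>_. 0)" using resid_eq_0_perp z(3) j(2) by blast
  have red: "\<exists>y'\<in>dlat. resid d p f y' = resid d p f y \<and> ip d y' y' \<le> ?N y + B" if y: "y \<in> dlat" for y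
  proof -
    obtain y' where y': "y' \<in> dlat" "resid d p f y' = resid d p f y"
      "\<And>l. l < p \<Longrightarrow> \<bar>ip d y' (f l)\<bar> \<le> ip d (u l) (f l)"
      using dlat_reduce[OF f u pos tri y, of p] by auto
    have "(ip d y' (f l))\<^sup>2 \<le> (ip d (u l) (f l))\<^sup>2" if "l < p" for l
      using power_mono[OF y'(3)[OF that], of 2] by simp
    then have "(\<Sum>l<p. (ip d y' (f l))\<^sup>2) \<le> B" unfolding B_def by (intro sum_mono) simp
    then have "ip d y' y' \<le> ?N y + B" using ip_resid_resid(2)[OF f, of y'] y'(2) by simp
    then show ?thesis using y' by blast
  qed
  define F where "F = {y \<in> dlat. ip d y y \<le> ?N (w j) + B \<and> resid d p f y \<noteq> (\<lambda>_. 0)}"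
  have finF: "finite F" using finite_subset[OF _ finite_dlat_bounded[of "?N (w j) + B"], of F]
    by (auto simp: F_def)
  obtain w' where "w' \<in> dlat" "resid d p f w' = resid d p f (w j)" "ip d w' w' \<le> ?N (w j) + B"
    using red[OF dlat_w[OF j(1)]] by blast
  then have w': "w' \<in> F" "?N w' = ?N (w j)" using wj by (simp_all add: F_def)
  define x where "x = arg_min_on ?N F"
  have x: "x \<in> F" "\<And>y. y \<in> F \<Longrightarrow> ?N x \<le> ?N y"
    using arg_min_if_finite(1)[OF finF, of ?N] arg_min_least[OF finF, of _ ?N] w' by (auto simp: x_def)
  have "?N x \<le> ?N y" if y: "y \<in> dlat" "resid d p f y \<noteq> (\<lambda>_. 0)" for y
  proof (cases "?N y \<le> ?N (w j)")
    case True
    obtain y' where "y' \<in> dlat" "resid d p f y' = resid d p f y" "ip d y' y' \<le> ?N y + B"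
      using red[OF y(1)] by blast
    then show ?thesis using x(2)[of y'] True y by (auto simp: F_def)
  next
    case False
    then show ?thesis using x(2)[OF w'(1)] w'(2) by linarith
  qed
  then show ?thesis using x(1) by (auto simp: F_def shortest_mod_def)
qed

end

text \<open>A Hermite--Korkine--Zolotarev reduced basis \<open>u\<close> of the dual lattice, with Gram--Schmidt vectors \<open>f\<close>.\<close>

locale hkz_frame = dual_frame +
  fixes u f :: "nat \<Rightarrow> nat \<Rightarrow> real"
  assumes f: "orthonormal_fam d d f"
    and u: "i < d \<Longrightarrow> u i \<in> dlat"
    and shortest: "i < d \<Longrightarrow> shortest_mod i f (u i)"
    and pos: "i < d \<Longrightarrow> 0 < ip d (u i) (f i)"
    and norm: "i < d \<Longrightarrow> (ip d (u i) (f i))\<^sup>2 = ip d (resid d i f (u i)) (resid d i f (u i))"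
    and tri: "i < l \<Longrightarrow> l < d \<Longrightarrow> ip d (u i) (f l) = 0"

lemma (in dual_frame) exists_hkz_frame: "\<exists>u f. hkz_frame d a w u f"
proof -
  obtain u f where "orthonormal_fam d d f"
    "\<And>i. i < d \<Longrightarrow> u i \<in> dlat" "\<And>i. i < d \<Longrightarrow> shortest_mod i f (u i)" "\<And>i. i < d \<Longrightarrow> 0 < ip d (u i) (f i)"
    "\<And>i. i < d \<Longrightarrow> (ip d (u i) (f i))\<^sup>2 = ip d (resid d i f (u i)) (resid d i f (u i))"
    "\<And>i l. i < l \<Longrightarrow> l < d \<Longrightarrow> ip d (u i) (f l) = 0"
  proof (rule gram_schmidt_select[of dlat d shortest_mod])
    show "shortest_mod p f' x" if "\<And>l. l < p \<Longrightarrow> f l = f' l" "shortest_mod p f x" for p f f' x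
      using that resid_cong[of p f f' d] by (simp add: shortest_mod_def)
  qed (use dlat_subset exists_shortest_mod in blast)+
  then have "hkz_frame d a w u f" by unfold_locales auto
  then show ?thesis by blast
qed

context hkz_frame
begin

abbreviation "b i \<equiv> ip d (u i) (f i)"

text \<open>By Parseval, the tail sum from \<open>i\<close> is the squared length of
  \<open>y\<close> modulo \<open>f 0, ..., f (i - 1)\<close>. In this form minimality of
  \<open>u i\<close> is tested against explicitly constructed dual vectors.\<close>

lemma b_le_resid:
  assumes "i < d" "y \<in> dlat" "(\<Sum>l\<in>{i..<d}. (ip d y (f l))\<^sup>2) \<noteq> 0"
  shows "(b i)\<^sup>2 \<le> (\<Sum>l\<in>{i..<d}. (ip d y (f l))\<^sup>2)"
proof -
  have y: "y \<in> coord_space d" using assms(2) dlat_subset by blast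
  have "resid d i f y \<noteq> (\<lambda>_. 0)"
    using ip_resid_eq_tail[OF f _ y, of i] assms by (auto simp: ip_linear)
  then have "ip d (resid d i f (u i)) (resid d i f (u i)) \<le> ip d (resid d i f y) (resid d i f y)"
    using shortest[OF assms(1)] assms(2) by (simp add: shortest_mod_def)
  then show ?thesis using ip_resid_eq_tail[OF f _ y, of i] norm[OF assms(1)] assms(1) by simp
qed

text \<open>Size reduction with remainder at most half is shorter than \<open>u i\<close>, so it leaves remainder 0.\<close>

lemma dlat_u_combination:
  assumes y: "y \<in> dlat"
  obtains n :: "nat \<Rightarrow> int" where "y = (\<lambda>m. \<Sum>i<d. of_int (n i) * u i m)"
proof -
  have "\<exists>n::nat \<Rightarrow> int. \<forall>l. d - t \<le> l \<and> l < d \<longrightarrow>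
      ip d (\<lambda>m. y m - (\<Sum>i\<in>{d - t..<d}. of_int (n i) * u i m)) (f l) = 0" if "t \<le> d" for t
    using that
  proof (induction t)
    case 0
    then show ?case by auto
  next
    case (Suc t)
    then obtain n :: "nat \<Rightarrow> int" where n: "\<And>l. d - t \<le> l \<Longrightarrow> l < d \<Longrightarrow>
      ip d (\<lambda>m. y m - (\<Sum>i\<in>{d - t..<d}. of_int (n i) * u i m)) (f l) = 0" by auto
    define y' where "y' = (\<lambda>m. y m - (\<Sum>i\<in>{d - t..<d}. of_int (n i) * u i m))"
    define i where "i = d - Suc t"
    have i: "i < d" "Suc i = d - t" using Suc.prems by (auto simp: i_def)
    define c where "c = round (ip d y' (f i) / b i)"
    define y'' where "y'' = (\<lambda>m. y' m - of_int c * u i m)"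
    have "(\<lambda>m. y m - of_int 1 * (\<Sum>i\<in>{d - t..<d}. of_int (n i) * u i m)) \<in> dlat"
      by (intro dlat_diff y dlat_sum u) auto
    then have "y' \<in> dlat" by (simp add: y'_def)
    then have y''L: "y'' \<in> dlat" unfolding y''_def by (intro dlat_diff u i)
    have zero: "ip d y'' (f l) = 0" if "Suc i \<le> l" "l < d" for l
      using n[of l] tri[of i l] that i(2) by (simp add: y''_def y'_def ip_linear)
    have b0: "b i > 0" using pos i by simp
    have eq: "ip d y'' (f i) = (ip d y' (f i) / b i - of_int c) * b i"
      using b0 by (simp add: y''_def ip_linear algebra_simps)
    have "\<bar>ip d y' (f i) / b i - of_int c\<bar> \<le> 1/2"
      unfolding c_def using of_int_round_abs_le[of "ip d y' (f i) / b i"] by (simp add: abs_minus_commute)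
    then have "\<bar>ip d y'' (f i)\<bar> \<le> 1/2 * b i"
      unfolding eq abs_mult using b0 by (intro mult_mono) auto
    then have "\<bar>ip d y'' (f i)\<bar> < b i" using b0 by linarith
    then have lt: "(ip d y'' (f i))\<^sup>2 < (b i)\<^sup>2"
      using b0 by (metis abs_ge_zero power2_abs power_strict_mono pos2)
    \<comment> \<open>Beyond \<open>i\<close> the coordinates already vanish, so the tail is one
      square below \<open>(b i)\<^sup>2\<close>; minimality then leaves only zero.\<close>
    have "{i..<d} = insert i {Suc i..<d}" using i(1) by auto
    then have "(\<Sum>l\<in>{i..<d}. (ip d y'' (f l))\<^sup>2) = (ip d y'' (f i))\<^sup>2" using zero by simp
    then have zi: "ip d y'' (f i) = 0" using b_le_resid[OF i(1) y''L] lt by fastforce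
    have "{d - Suc t..<d} = insert i {d - t..<d}" using i by (auto simp: i_def)
    then have y''eq: "y'' = (\<lambda>m. y m - (\<Sum>k\<in>{d - Suc t..<d}. of_int ((n(i := c)) k) * u k m))"
      using i by (simp add: y''_def y'_def fun_eq_iff)
    have "ip d y'' (f l) = 0" if "d - Suc t \<le> l" "l < d" for l
      using zero[of l] zi that by (cases "l = i") (auto simp: i_def)
    then show ?case unfolding y''eq by blast
  qed
  from this[of d] obtain n :: "nat \<Rightarrow> int" where n: "\<And>l. l < d \<Longrightarrow>
    ip d (\<lambda>m. y m - (\<Sum>i<d. of_int (n i) * u i m)) (f l) = 0"
    by (auto simp: lessThan_atLeast0)
  let ?r = "\<lambda>m. y m - (\<Sum>i<d. of_int (n i) * u i m)"
  have "(\<lambda>m. y m - of_int 1 * (\<Sum>i<d. of_int (n i) * u i m)) \<in> dlat"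
    by (intro dlat_diff y dlat_sum u) auto
  then have "?r \<in> coord_space d" using dlat_subset by auto
  then have "?r = (\<lambda>_. 0)" using parseval(1)[OF f, of ?r] n by (simp add: fun_eq_iff)
  then show thesis using that[of n] by (simp add: fun_eq_iff)
qed

end

section \<open>Upper and lower bounds for the Gram--Schmidt lengths of the reduced basis\<close>

lemma det_diag_prod:
  "A \<in> carrier_mat n n \<Longrightarrow> prod_list (diag_mat A) = (\<Prod>i<n. A $$ (i, i))"
  by (simp add: prod_list_diag_prod lessThan_atLeast0)

lemma det_in_Ints:
  assumes A: "A \<in> carrier_mat n n" and int: "\<And>i j. i < n \<Longrightarrow> j < n \<Longrightarrow> (A $$ (i, j) :: real) \<in> \<int>"
  shows "Determinant.det A \<in> \<int>"
  unfolding det_def'[OF A]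
  by (intro Ints_sum Ints_mult Ints_prod int) (auto simp: sign_def lessThan_atLeast0 dest: permutes_in_image)

context hkz_frame
begin

text \<open>Pigeonhole: about \<open>(N / G) ^ n\<close> integer combinations of
  \<open>u p, ..., u (q - 1)\<close> have their \<open>f\<close>-coordinates from \<open>p\<close>
  to \<open>q - 1\<close> in \<open>[0, N)\<close>, whereas about \<open>(N / (2 * G)) ^ n\<close>
  cells of side \<open>2 * G\<close> cover that cube. Two combinations in one cell differ by a dual
  vector whose coordinates are at most \<open>2 * G\<close> between \<open>p\<close> and
  \<open>q\<close> and vanish from \<open>q\<close> on, and \<open>b_le_resid\<close> applies to
  it.\<close>

lemma b_le_geometric_mean:
  assumes pq: "p < q" "q \<le> d" and G: "0 < G" "G ^ (q - p) = (\<Prod>i\<in>{p..<q}. b i)"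
  shows "b p \<le> 2 * sqrt (real d) * G"
proof -
  define n where "n = q - p"
  have n: "0 < n" "n \<le> d" using pq by (auto simp: n_def)
  \<comment> \<open>The coordinate along \<open>f l\<close> involves only those \<open>u i\<close>
    with \<open>i \<ge> l\<close>. Counting downwards from \<open>q - 1\<close> turns this into
    dependence on earlier coordinates, as \<open>tri_box\<close> expects.\<close>
  define r where "r j = q - Suc j" for j
  have r: "r j < d" "p \<le> r j" "r j < q" if "j < n" for j
    using that pq by (auto simp: r_def n_def)
  have r_bij: "bij_betw r {..<n} {p..<q}"
    by (rule bij_betw_byWitness[of _ r]) (use pq in \<open>auto simp: r_def n_def\<close>)
  \<comment> \<open>From \<open>8 * G \<le> N\<close> each factor \<open>N / (2 * G) + 1\<close> of
    the number of cells is at most \<open>5/8 * (N / G)\<close>; from \<open>4 * b i \<le> N\<close>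
    each factor \<open>N / b i - 1\<close> of the number of points is at least
    \<open>3/4 * (N / b i)\<close>. So points outnumber cells.\<close>
  define N where "N = 8 * G + (\<Sum>i<d. 4 * \<bar>b i\<bar>)"
  have Nb: "4 * b i \<le> N" if "i < d" for i
  proof -
    have "4 * \<bar>b i\<bar> \<le> (\<Sum>i<d. 4 * \<bar>b i\<bar>)" by (rule member_le_sum) (use that in auto)
    then show ?thesis using G unfolding N_def by linarith
  qed
  have NG: "8 * G \<le> N" unfolding N_def by (simp add: sum_nonneg)
  have N0: "0 < N" using NG G by linarith
  define c where "c j y = (\<Sum>j'<j. of_int (y j') * ip d (u (r j')) (f (r j))) / b (r j)"
    for j and y :: "nat \<Rightarrow> int"
  define T where "T = tri_box n c (\<lambda>j. b (r j)) (\<lambda>_. 0) (\<lambda>_. N)"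
  have T: "finite T" "(\<Prod>j<n. N / b (r j) - 1) \<le> real (card T)"
  proof -
    have *: "finite T \<and> real (card T) \<le> (\<Prod>j<n. N / b (r j) + 1) \<and>
      ((\<forall>j<n. b (r j) \<le> N) \<longrightarrow> (\<Prod>j<n. N / b (r j) - 1) \<le> real (card T))"
      unfolding T_def
    proof (rule tri_box_count)
      show "c i y = c i y'" if "\<And>l. l < i \<Longrightarrow> y l = y' l" for i y y'
        using that by (simp add: c_def)
    qed (use pos r N0 in \<open>auto intro: less_imp_le\<close>)
    have "b (r j) \<le> N" if "j < n" for j
      using Nb[OF r(1)[OF that]] pos[OF r(1)[OF that]] by linarith
    then show "finite T" "(\<Prod>j<n. N / b (r j) - 1) \<le> real (card T)" using * by auto
  qed
  define comb where "comb y = (\<lambda>m. \<Sum>j<n. of_int (y j) * u (r j) m)" for y :: "nat \<Rightarrow> int"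
  have comb_in: "comb y \<in> dlat" for y unfolding comb_def by (intro dlat_sum u r) auto
  have ip_comb: "ip d (comb y) (f (r j)) = b (r j) * (of_int (y j) + c j y)" if j: "j < n" for y j
  proof -
    have "ip d (comb y) (f (r j)) = (\<Sum>j'<n. of_int (y j') * ip d (u (r j')) (f (r j)))"
      by (simp add: comb_def ip_linear)
    also have "\<dots> = (\<Sum>j'<Suc j. of_int (y j') * ip d (u (r j')) (f (r j)))"
    proof (rule sum.mono_neutral_right)
      show "\<forall>i\<in>{..<n} - {..<Suc j}. of_int (y i) * ip d (u (r i)) (f (r j)) = 0"
      proof
        fix i assume "i \<in> {..<n} - {..<Suc j}"
        then have "i < n" "j < i" by auto
        then have "r i < r j" using pq by (auto simp: r_def n_def)
        then show "of_int (y i) * ip d (u (r i)) (f (r j)) = 0" using tri r(1)[OF j] by simp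
      qed
    qed (use j in auto)
    also have "\<dots> = b (r j) * (of_int (y j) + c j y)"
      using pos[OF r(1)[OF j]] by (simp add: c_def field_simps)
    finally show ?thesis .
  qed
  have ip_comb0: "ip d (comb y) (f l) = 0" if "q \<le> l" "l < d" for y l
    using that r by (auto simp: comb_def ip_linear intro!: sum.neutral tri) (meson less_le_trans)
  define cell where "cell y = (\<lambda>j\<in>{..<n}. \<lfloor>ip d (comb y) (f (r j)) / (2 * G)\<rfloor>)" for y
  define M where "M = {..<n} \<rightarrow>\<^sub>E {0..\<lfloor>N / (2 * G)\<rfloor>}"
  have M: "finite M" "real (card M) \<le> (N / (2 * G) + 1) ^ n"
  proof -
    show "finite M" unfolding M_def by (intro finite_PiE) auto
    have "real (nat (\<lfloor>N / (2 * G)\<rfloor> + 1)) \<le> N / (2 * G) + 1" using N0 G by simp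
    then have "real (nat (\<lfloor>N / (2 * G)\<rfloor> + 1)) ^ n \<le> (N / (2 * G) + 1) ^ n"
      by (intro power_mono) auto
    then show "real (card M) \<le> (N / (2 * G) + 1) ^ n" by (simp add: M_def card_PiE)
  qed
  have cell: "cell ` T \<subseteq> M"
  proof (rule image_subsetI)
    fix y assume y: "y \<in> T"
    have "0 \<le> ip d (comb y) (f (r j)) / (2 * G)" "ip d (comb y) (f (r j)) / (2 * G) \<le> N / (2 * G)"
      if j: "j < n" for j
    proof -
      have "0 \<le> ip d (comb y) (f (r j))" "ip d (comb y) (f (r j)) \<le> N"
        using y j by (auto simp: T_def tri_box_def ip_comb)
      then show "0 \<le> ip d (comb y) (f (r j)) / (2 * G)" "ip d (comb y) (f (r j)) / (2 * G) \<le> N / (2 * G)"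
        using G by (simp_all add: divide_right_mono)
    qed
    then show "cell y \<in> M" unfolding M_def cell_def by (auto intro!: floor_mono)
  qed
  have "real (card M) < real (card T)"
  proof -
    have "(N / (2 * G) + 1) ^ n \<le> ((5/8) * (N / G)) ^ n"
      using NG G N0 by (intro power_mono) (auto simp: field_simps)
    also have "\<dots> < ((3/4) * (N / G)) ^ n"
      using NG G N0 n by (intro power_strict_mono) (auto simp: field_simps)
    also have "\<dots> = (3/4) ^ n * (N ^ n / (\<Prod>i\<in>{p..<q}. b i))"
      using G(2) by (simp add: power_mult_distrib power_divide n_def)
    also have "(\<Prod>i\<in>{p..<q}. b i) = (\<Prod>j<n. b (r j))"
      by (rule prod.reindex_bij_betw[OF r_bij, symmetric])
    also have "(3/4) ^ n * (N ^ n / (\<Prod>j<n. b (r j))) = (\<Prod>j<n. (3/4) * (N / b (r j)))"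
      by (simp add: prod.distrib prod_dividef power_divide)
    also have "\<dots> \<le> (\<Prod>j<n. N / b (r j) - 1)"
    proof (rule prod_mono)
      fix j assume "j \<in> {..<n}"
      then show "0 \<le> (3/4) * (N / b (r j)) \<and> (3/4) * (N / b (r j)) \<le> N / b (r j) - 1"
        using Nb[OF r(1), of j] pos[OF r(1), of j] N0 by (simp add: field_simps)
    qed
    finally show ?thesis using T M by linarith
  qed
  then have "card (cell ` T) < card T" using card_mono[OF M(1) cell] by simp
  then have "\<not> inj_on cell T" by (metis card_image less_irrefl)
  then obtain y y' where y: "y \<in> T" "y' \<in> T" "cell y = cell y'" "y \<noteq> y'" by (auto simp: inj_on_def)
  define v where "v = (\<lambda>m. comb y m - of_int 1 * comb y' m)"
  have v_in: "v \<in> dlat" unfolding v_def by (intro dlat_diff comb_in)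
  have ip_v: "ip d v z = ip d (comb y) z - ip d (comb y') z" for z by (simp add: v_def ip_linear)
  have small: "(ip d v (f l))\<^sup>2 \<le> (if l < q then (2 * G)\<^sup>2 else 0)" if l: "p \<le> l" "l < d" for l
  proof (cases "l < q")
    case True
    define j where "j = q - Suc l"
    have j: "j < n" "r j = l" using True l by (auto simp: j_def r_def n_def)
    let ?x = "ip d (comb y) (f l)" and ?x' = "ip d (comb y') (f l)"
    have e: "\<lfloor>?x / (2 * G)\<rfloor> = \<lfloor>?x' / (2 * G)\<rfloor>"
      using fun_cong[OF y(3), of j] j by (simp add: cell_def)
    have "\<bar>?x / (2 * G) - ?x' / (2 * G)\<bar> \<le> 1" using e by linarith
    then have "\<bar>(?x - ?x') / (2 * G)\<bar> \<le> 1" by (simp add: diff_divide_distrib)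
    then have "\<bar>ip d v (f l)\<bar> \<le> 2 * G" using G by (simp add: ip_v abs_divide)
    then show ?thesis using power_mono[of "\<bar>ip d v (f l)\<bar>" "2 * G" 2] True by simp
  next
    case False
    then show ?thesis using ip_comb0 l by (simp add: ip_v)
  qed
  have nz: "(\<Sum>l\<in>{p..<d}. (ip d v (f l))\<^sup>2) \<noteq> 0"
  proof -
    have "\<exists>j. j < n \<and> y j \<noteq> y' j"
    proof (rule ccontr)
      assume "\<not> ?thesis"
      then have "y = y'" using y(1,2) by (intro PiE_ext[of y "{..<n}" "\<lambda>_. UNIV"]) (auto simp: T_def tri_box_def)
      then show False using y(4) by simp
    qed
    \<comment> \<open>At the first difference the corrections \<open>c j\<close> agree, so the
      coordinate of \<open>v\<close> along \<open>f (r j)\<close> is a nonzero integer multiple of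
      \<open>b (r j)\<close>.\<close>
    then obtain j where j: "j < n" "y j \<noteq> y' j" "\<And>j'. j' < j \<Longrightarrow> y j' = y' j'"
      using exists_least_iff[of "\<lambda>j. j < n \<and> y j \<noteq> y' j"] by (metis less_trans)
    then have "c j y = c j y'" by (simp add: c_def)
    then have "ip d v (f (r j)) \<noteq> 0" using j pos[OF r(1)[OF j(1)]] by (simp add: ip_v ip_comb)
    then show ?thesis using r[OF j(1)] by (auto simp: sum_nonneg_eq_0_iff)
  qed
  have "(b p)\<^sup>2 \<le> (\<Sum>l\<in>{p..<d}. (ip d v (f l))\<^sup>2)"
    using pq nz by (intro b_le_resid v_in) auto
  also have "\<dots> \<le> (\<Sum>l\<in>{p..<d}. (if l < q then (2 * G)\<^sup>2 else 0))"
    using small by (intro sum_mono) auto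
  also have "\<dots> \<le> (\<Sum>l\<in>{p..<d}. (2 * G)\<^sup>2)" by (intro sum_mono) auto
  also have "\<dots> \<le> real d * (2 * G)\<^sup>2" by (auto intro!: mult_right_mono)
  also have "\<dots> = (2 * sqrt (real d) * G)\<^sup>2" by (simp add: power_mult_distrib)
  finally show ?thesis using G by (intro power2_le_imp_le[of "b p"]) auto
qed

lemma ip_w_emb: "j < d \<Longrightarrow> ip d (w j) (emb x) = x j"
  by (simp add: emb_def ip_linear biorth of_bool_def if_distrib cong: if_cong)

lemma emb_in: "emb x \<in> coord_space d"
  using a_in by (auto simp: emb_def coord_space_def)

lemma ip_dlat_emb:
  assumes "y \<in> dlat" "\<And>j. j < d \<Longrightarrow> x j \<in> \<int>"
  shows "ip d y (emb x) \<in> \<int>"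
proof -
  obtain n :: "nat \<Rightarrow> int" where n: "y = (\<lambda>i. \<Sum>j<d. of_int (n j) * w j i)"
    using assms(1) by (auto simp: dlat_def)
  have "ip d y (emb x) = (\<Sum>j<d. of_int (n j) * x j)" by (simp add: n ip_linear ip_w_emb)
  then show ?thesis using assms(2) by (auto intro!: Ints_sum Ints_mult)
qed

text \<open>The determinant of the integer matrix \<open>(u i \<cdot> v l)\<close> is the product of the \<open>b i\<close> and of the
  Gram--Schmidt lengths of the projections of \<open>v l\<close>, which are at most 1.\<close>

lemma prod_b_ge_1:
  assumes X: "\<And>x j. x \<in> X \<Longrightarrow> j < d \<Longrightarrow> x j \<in> \<int>" "\<And>x. x \<in> X \<Longrightarrow> ip d (emb x) (emb x) \<le> 1"
    and spans: "\<And>z. z \<in> coord_space d \<Longrightarrow> (\<And>x. x \<in> X \<Longrightarrow> ip d z (emb x) = 0) \<Longrightarrow> z = (\<lambda>_. 0)"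
    and k: "k \<le> d"
  shows "1 \<le> (\<Prod>i<k. b i)"
proof -
  \<comment> \<open>The projection of \<open>emb x\<close> onto the span of
    \<open>f 0, ..., f (k - 1)\<close>, written as a vector of the \<open>k\<close>-dimensional
    coordinate space.\<close>
  define \<psi> where "\<psi> x = (\<lambda>i. if i < k then ip d (emb x) (f i) else 0)" for x
  have \<psi>1: "ip k (\<psi> x) (\<psi> x) \<le> 1" if "x \<in> X" for x
  proof -
    have "ip k (\<psi> x) (\<psi> x) = (\<Sum>i<k. (ip d (emb x) (f i))\<^sup>2)"
      by (simp add: ip_def[of k] \<psi>_def power2_eq_square)
    also have "\<dots> \<le> (\<Sum>i<d. (ip d (emb x) (f i))\<^sup>2)" using k by (intro sum_mono2) auto
    also have "\<dots> \<le> 1" using parseval(2)[OF f emb_in, of x "emb x"] X(2)[OF that] by (simp add: power2_eq_square)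
    finally show ?thesis .
  qed
  \<comment> \<open>With a trivial predicate the selection just finds points of \<open>X\<close>
    with independent projections. A vector \<open>z\<close> orthogonal to the family built so far
    lifts to the combination \<open>z'\<close> of the \<open>f i\<close>; as \<open>X\<close> spans,
    some \<open>x\<close> is not orthogonal to \<open>z'\<close>, so \<open>\<psi> x\<close> has a
    nonzero residual.\<close>
  obtain v g where g: "orthonormal_fam k k g"
    and v: "\<And>i. i < k \<Longrightarrow> v i \<in> \<psi> ` X" and vpos: "\<And>i. i < k \<Longrightarrow> 0 < ip k (v i) (g i)"
    and vtri: "\<And>i l. i < l \<Longrightarrow> l < k \<Longrightarrow> ip k (v i) (g l) = 0"
  proof (rule gram_schmidt_select[of "\<psi> ` X" k "\<lambda>_ _ _. True"])
    show "\<psi> ` X \<subseteq> coord_space k" by (auto simp: \<psi>_def coord_space_def)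
    show "\<exists>x\<in>\<psi> ` X. resid k p g x \<noteq> (\<lambda>_. 0) \<and> True" if p: "p < k" and g: "orthonormal_fam k p g" for p g
    proof -
      obtain z where z: "z \<in> coord_space k" "z \<noteq> (\<lambda>_. 0)" "\<And>l. l < p \<Longrightarrow> ip k z (g l) = 0"
        by (rule exists_perp[OF g p]) blast
      define z' where "z' = (\<lambda>m. \<Sum>i<k. z i * f i m)"
      have z'_in: "z' \<in> coord_space d" using f k by (auto simp: z'_def coord_space_def orthonormal_fam_def)
      have "ip d z' (f i) = z i" if "i < k" for i
      proof -
        have "ip d z' (f i) = (\<Sum>m<k. if m = i then z m else 0)"
          unfolding z'_def ip_linear using that k f
          by (intro sum.cong) (auto simp: orthonormal_fam_def)
        then show ?thesis using that by simp
      qed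
      moreover obtain i where "i < k" "z i \<noteq> 0" using z(1,2) by (auto simp: coord_space_def fun_eq_iff not_le)
          (metis not_le)
      ultimately have "z' \<noteq> (\<lambda>_. 0)" by (auto simp: ip_linear)
      then obtain x where x: "x \<in> X" "ip d z' (emb x) \<noteq> 0" using spans[OF z'_in] by blast
      have "ip d z' (emb x) = ip k (\<psi> x) z"
        by (simp add: z'_def ip_linear ip_def[of k] \<psi>_def ip_commute[of d "emb x"] mult.commute)
      then have "resid k p g (\<psi> x) \<noteq> (\<lambda>_. 0)" using resid_eq_0_perp[of k p g "\<psi> x" z] z(3) x(2) by auto
      then show ?thesis using x(1) by auto
    qed
  qed auto
  obtain x where x: "\<And>i. i < k \<Longrightarrow> x i \<in> X" "\<And>i. i < k \<Longrightarrow> v i = \<psi> (x i)"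
  proof -
    have "\<forall>i. \<exists>x. i < k \<longrightarrow> x \<in> X \<and> v i = \<psi> x" using v by blast
    then show thesis using that by metis
  qed
  \<comment> \<open>\<open>Y = Lt * Gm * Tm\<close> with \<open>Lt\<close> lower triangular
    (Gram--Schmidt for the \<open>v l\<close>), \<open>Gm\<close> orthogonal and \<open>Tm\<close>
    upper triangular with diagonal \<open>b i\<close>. Only coordinates below \<open>k\<close>
    enter, because \<open>u i\<close> with \<open>i < k\<close> has none beyond.\<close>
  define Y where "Y = mat k k (\<lambda>(l, i). ip d (u i) (emb (x l)))"
  define Lt where "Lt = mat k k (\<lambda>(l, m). ip k (v l) (g m))"
  define Gm where "Gm = mat k k (\<lambda>(m, t). g m t)"
  define Tm where "Tm = mat k k (\<lambda>(t, i). ip d (u i) (f t))"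
  have car: "Y \<in> carrier_mat k k" "Lt \<in> carrier_mat k k" "Gm \<in> carrier_mat k k" "Tm \<in> carrier_mat k k"
    by (auto simp: Y_def Lt_def Gm_def Tm_def)
  have v_in: "v l \<in> coord_space k" if "l < k" for l using x(2)[OF that] by (simp add: \<psi>_def coord_space_def)
  have LG: "(Lt * Gm) $$ (l, t) = ip d (emb (x l)) (f t)" if "l < k" "t < k" for l t
  proof -
    have "(Lt * Gm) $$ (l, t) = (\<Sum>m<k. ip k (v l) (g m) * g m t)"
      using that by (simp add: Lt_def Gm_def scalar_prod_def lessThan_atLeast0)
    also have "\<dots> = v l t" using parseval(1)[OF g v_in[OF that(1)]] by (metis (no_types, lifting))
    finally show ?thesis using that x(2) by (simp add: \<psi>_def)
  qed
  define P where "P = Lt * Gm"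
  have P: "P \<in> carrier_mat k k" using car by (simp add: P_def)
  have "Y = P * Tm"
  proof (rule eq_matI)
    fix l i assume li: "l < dim_row (P * Tm)" "i < dim_col (P * Tm)"
    then have li: "l < k" "i < k" using car P by auto
    have "(P * Tm) $$ (l, i) = (\<Sum>t<k. P $$ (l, t) * Tm $$ (t, i))"
      using li car P by (simp add: scalar_prod_def lessThan_atLeast0)
    also have "\<dots> = (\<Sum>t<k. ip d (emb (x l)) (f t) * ip d (u i) (f t))"
      using li by (intro sum.cong) (auto simp: LG P_def Tm_def)
    also have "\<dots> = (\<Sum>t<d. ip d (emb (x l)) (f t) * ip d (u i) (f t))"
      using k li tri by (intro sum.mono_neutral_left) auto
    also have "\<dots> = ip d (u i) (emb (x l))"
      using parseval(2)[OF f emb_in, of "x l" "u i"] by (simp add: ip_commute)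
    finally show "Y $$ (l, i) = (P * Tm) $$ (l, i)" using li by (simp add: Y_def)
  qed (use car P in auto)
  have posp: "0 < (\<Prod>i<k. ip k (v i) (g i))" "0 < (\<Prod>i<k. b i)"
    using vpos pos k by (auto intro!: prod_pos)
  have "Determinant.det Y = Determinant.det Lt * Determinant.det Gm * Determinant.det Tm"
    unfolding \<open>Y = P * Tm\<close> using car P by (simp add: det_mult[of _ k] P_def)
  moreover have "Determinant.det Lt = (\<Prod>i<k. ip k (v i) (g i))"
  proof -
    have "Determinant.det Lt = prod_list (diag_mat Lt)"
      by (rule det_lower_triangular[OF _ car(2)]) (simp add: Lt_def vtri)
    then show ?thesis using det_diag_prod[OF car(2)] by (simp add: Lt_def)
  qed
  moreover have "Determinant.det Tm = (\<Prod>i<k. b i)"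
  proof -
    have "upper_triangular Tm" using k tri by (auto simp: Tm_def)
    then have "Determinant.det Tm = prod_list (diag_mat Tm)" by (rule det_upper_triangular[OF _ car(4)])
    then show ?thesis using det_diag_prod[OF car(4)] by (simp add: Tm_def)
  qed
  moreover have "\<bar>Determinant.det Gm\<bar> = 1"
  proof -
    have "Gm * transpose_mat Gm = 1\<^sub>m k"
    proof (rule eq_matI)
      fix i j assume "i < dim_row (1\<^sub>m k :: real mat)" "j < dim_col (1\<^sub>m k :: real mat)"
      then have ij: "i < k" "j < k" by auto
      have "(Gm * transpose_mat Gm) $$ (i, j) = ip k (g i) (g j)"
        using ij by (simp add: Gm_def scalar_prod_def ip_def lessThan_atLeast0)
      then show "(Gm * transpose_mat Gm) $$ (i, j) = 1\<^sub>m k $$ (i, j)"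
        using g ij by (simp add: orthonormal_fam_def)
    qed (use car in auto)
    then have "Determinant.det Gm * Determinant.det Gm = 1"
      using det_mult[OF car(3), of "transpose_mat Gm"] det_transpose[OF car(3)] car(3) by simp
    then show ?thesis by (metis abs_mult_self_eq abs_1 abs_ge_zero mult_cancel_right1 abs_mult
          power2_eq_square power2_eq_1_iff abs_minus_cancel)
  qed
  ultimately have det: "\<bar>Determinant.det Y\<bar> = (\<Prod>i<k. ip k (v i) (g i)) * (\<Prod>i<k. b i)"
    using posp by (simp add: abs_mult)
  have "Determinant.det Y \<in> \<int>"
    by (rule det_in_Ints[OF car(1)]) (use x(1) X(1) k in \<open>auto simp: Y_def intro!: ip_dlat_emb u\<close>)
  then obtain m where m: "Determinant.det Y = of_int m" by (auto elim: Ints_cases)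
  have "m \<noteq> 0"
  proof
    assume "m = 0"
    then have "\<bar>Determinant.det Y\<bar> = 0" using m by simp
    then show False using det mult_pos_pos[OF posp] by linarith
  qed
  then have "1 \<le> \<bar>Determinant.det Y\<bar>" unfolding m by simp
  also have "\<dots> \<le> 1 * (\<Prod>i<k. b i)"
    unfolding det
  proof (intro mult_right_mono prod_le_1)
    fix i assume "i \<in> {..<k}"
    then have i: "i < k" by simp
    have "(ip k (v i) (g i))\<^sup>2 \<le> ip k (v i) (v i) * ip k (g i) (g i)" by (rule ip_cauchy_schwarz)
    also have "\<dots> = ip k (v i) (v i)" using g i by (simp add: orthonormal_fam_def)
    also have "\<dots> \<le> 1" using \<psi>1 x i by simp
    finally show "0 \<le> ip k (v i) (g i) \<and> ip k (v i) (g i) \<le> 1"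
      using vpos[OF i] by (simp add: abs_square_le_1)
  qed (use posp in simp)
  finally show ?thesis by simp
qed

end

section \<open>An ellipsoid close to the body\<close>

definition mdet :: "nat \<Rightarrow> (nat \<Rightarrow> nat \<Rightarrow> real) \<Rightarrow> real"
  where "mdet d A = Determinant.det (mat d d (\<lambda>(i, j). A i j))"

definition lin :: "nat \<Rightarrow> (nat \<Rightarrow> nat \<Rightarrow> real) \<Rightarrow> (nat \<Rightarrow> real) \<Rightarrow> nat \<Rightarrow> real"
  where "lin d A x = (\<lambda>i. if i < d then \<Sum>j<d. A i j * x j else 0)"

lemma lin_in: "lin d A x \<in> coord_space d"
  by (simp add: lin_def coord_space_def)

lemma lin_linear:
  "lin d A (\<lambda>i. x i + c * y i) = (\<lambda>i. lin d A x i + c * lin d A y i)"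
  "lin d A (\<lambda>i. x i - y i) = (\<lambda>i. lin d A x i - lin d A y i)"
  "lin d A (\<lambda>i. - x i) = (\<lambda>i. - lin d A x i)"
  by (auto simp: lin_def fun_eq_iff sum.distrib sum_subtractf sum_negf sum_distrib_left algebra_simps)

lemma lin_eq_0:
  assumes A: "mdet d A \<noteq> 0" and x: "x \<in> coord_space d" "lin d A x = (\<lambda>_. 0)"
  shows "x = (\<lambda>_. 0)"
proof (rule ccontr)
  assume nz: "x \<noteq> (\<lambda>_. 0)"
  define M where "M = mat d d (\<lambda>(i, j). A i j)"
  have M: "M \<in> carrier_mat d d" by (simp add: M_def)
  have "vec d x \<noteq> 0\<^sub>v d"
  proof
    assume e: "vec d x = 0\<^sub>v d"
    have "x i = 0" if "i < d" for i
    proof -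
      have "vec_index (vec d x) i = vec_index (0\<^sub>v d) i" using e by simp
      then show ?thesis using that by simp
    qed
    then have "x = (\<lambda>_. 0)" by (intro coord_space_ext[OF x(1)]) (auto simp: coord_space_def)
    then show False using nz by simp
  qed
  moreover have "M *\<^sub>v vec d x = 0\<^sub>v d"
  proof (rule eq_vecI)
    fix i assume "i < dim_vec (0\<^sub>v d :: real vec)"
    then have i: "i < d" by simp
    have "vec_index (M *\<^sub>v vec d x) i = (\<Sum>j<d. A i j * x j)"
      using i by (simp add: M_def scalar_prod_def lessThan_atLeast0)
    also have "\<dots> = 0" using fun_cong[OF x(2), of i] i by (simp add: lin_def)
    finally show "vec_index (M *\<^sub>v vec d x) i = vec_index (0\<^sub>v d) i" using i by simp
  qed (use M in auto)
  ultimately have "Determinant.det M = 0"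
    unfolding det_0_iff_vec_prod_zero_field[OF M] by (intro exI[of _ "vec d x"]) auto
  then show False using A by (simp add: mdet_def M_def)
qed

text \<open>The two sides are the determinants of the same two block matrices multiplied in opposite
  orders.\<close>

lemma det_identity_plus_outer:
  fixes U V :: "'a :: idom mat"
  assumes U: "U \<in> carrier_mat n 1" and V: "V \<in> carrier_mat 1 n"
  shows "Determinant.det (1\<^sub>m n + U * V) = 1 + (V * U) $$ (0, 0)"
proof -
  let ?M = "four_block_mat (1\<^sub>m n) (- U) V (1\<^sub>m 1)" and ?N = "four_block_mat (1\<^sub>m n) U (0\<^sub>m 1 n) (1\<^sub>m 1)"
  have car: "?M \<in> carrier_mat (n + 1) (n + 1)" "?N \<in> carrier_mat (n + 1) (n + 1)" using U V by auto
  have "?M * ?N = four_block_mat (1\<^sub>m n * 1\<^sub>m n + - U * 0\<^sub>m 1 n) (1\<^sub>m n * U + - U * 1\<^sub>m 1)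
      (V * 1\<^sub>m n + 1\<^sub>m 1 * 0\<^sub>m 1 n) (V * U + 1\<^sub>m 1 * 1\<^sub>m 1)"
    using U V by (intro mult_four_block_mat) auto
  also have "\<dots> = four_block_mat (1\<^sub>m n) (0\<^sub>m n 1) V (V * U + 1\<^sub>m 1)"
    using U V by (intro arg_cong4[of _ _ _ _ _ _ _ _ four_block_mat]) auto
  finally have MN: "Determinant.det (?M * ?N) = Determinant.det (V * U + 1\<^sub>m 1)"
    using U V det_four_block_mat_upper_right_zero[of "1\<^sub>m n" n "0\<^sub>m n 1" 1 V "V * U + 1\<^sub>m 1"] by simp
  have "?N * ?M = four_block_mat (1\<^sub>m n * 1\<^sub>m n + U * V) (1\<^sub>m n * - U + U * 1\<^sub>m 1)
      (0\<^sub>m 1 n * 1\<^sub>m n + 1\<^sub>m 1 * V) (0\<^sub>m 1 n * - U + 1\<^sub>m 1 * 1\<^sub>m 1)"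
    using U V by (intro mult_four_block_mat) auto
  also have "\<dots> = four_block_mat (1\<^sub>m n + U * V) (0\<^sub>m n 1) V (1\<^sub>m 1)"
    using U V by (intro arg_cong4[of _ _ _ _ _ _ _ _ four_block_mat]) auto
  finally have NM: "Determinant.det (?N * ?M) = Determinant.det (1\<^sub>m n + U * V)"
    using U V det_four_block_mat_upper_right_zero[of "1\<^sub>m n + U * V" n "0\<^sub>m n 1" 1 V "1\<^sub>m 1"] by simp
  have "Determinant.det (?M * ?N) = Determinant.det (?N * ?M)"
    using det_mult[OF car] det_mult[OF car(2,1)] by (simp add: mult.commute)
  moreover have "Determinant.det (V * U + 1\<^sub>m 1) = 1 + (V * U) $$ (0, 0)"
    using U V by (subst det_single) auto
  ultimately show ?thesis using MN NM by simp
qed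

text \<open>The left matrix is \<open>r (1 + c v v\<^sup>T) A\<close>, a uniform scaling combined
  with a stretching along \<open>v\<close>. This is the change of ellipsoid that
  \<open>john_ellipsoid\<close> uses for the improvement.\<close>

lemma mdet_rank_one_update:
  "mdet d (\<lambda>i j. r * (A i j + c * v i * (\<Sum>l<d. v l * A l j))) = r ^ d * (1 + c * ip d v v) * mdet d A"
proof -
  let ?A = "mat d d (\<lambda>(i, j). A i j)"
  let ?U = "mat d 1 (\<lambda>(i, j). c * v i)" and ?V = "mat 1 d (\<lambda>(i, j). v j)"
  let ?Q = "mat d d (\<lambda>(i, j). of_bool (i = j) + c * v i * v j)"
  have Q: "1\<^sub>m d + ?U * ?V = ?Q" by (rule eq_matI) (auto simp: scalar_prod_def)
  have "mat d d (\<lambda>(i, j). r * (A i j + c * v i * (\<Sum>l<d. v l * A l j))) = r \<cdot>\<^sub>m (?Q * ?A)"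
  proof (rule eq_matI)
    fix i j assume "i < dim_row (r \<cdot>\<^sub>m (?Q * ?A))" "j < dim_col (r \<cdot>\<^sub>m (?Q * ?A))"
    then have ij: "i < d" "j < d" by auto
    have "(?Q * ?A) $$ (i, j) = (\<Sum>l<d. (of_bool (i = l) + c * v i * v l) * A l j)"
      using ij by (simp add: scalar_prod_def lessThan_atLeast0)
    also have "\<dots> = (\<Sum>l<d. of_bool (i = l) * A l j) + (\<Sum>l<d. c * v i * (v l * A l j))"
      by (simp add: algebra_simps sum.distrib)
    also have "(\<Sum>l<d. of_bool (i = l) * A l j) = (\<Sum>l<d. if i = l then A l j else 0)"
      by (intro sum.cong) auto
    also have "\<dots> = A i j" using ij by simp
    finally show "mat d d (\<lambda>(i, j). r * (A i j + c * v i * (\<Sum>l<d. v l * A l j))) $$ (i, j)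
        = (r \<cdot>\<^sub>m (?Q * ?A)) $$ (i, j)"
      using ij by (simp add: sum_distrib_left)
  qed auto
  then have "mdet d (\<lambda>i j. r * (A i j + c * v i * (\<Sum>l<d. v l * A l j)))
      = r ^ d * (Determinant.det ?Q * Determinant.det ?A)"
    using det_mult[of ?Q d ?A] by (simp add: mdet_def)
  also have "Determinant.det ?Q = 1 + (?V * ?U) $$ (0, 0)"
    unfolding Q[symmetric] by (rule det_identity_plus_outer) auto
  also have "(?V * ?U) $$ (0, 0) = c * ip d v v"
    by (simp add: scalar_prod_def ip_def sum_distrib_left lessThan_atLeast0 algebra_simps)
  finally show ?thesis by (simp add: mdet_def)
qed

text \<open>A crude bound from the Leibniz formula; its purpose is to make the supremum of the
  squared determinants in \<open>john_ellipsoid\<close> finite.\<close>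

lemma mdet_bounded:
  assumes "\<And>i j. i < d \<Longrightarrow> j < d \<Longrightarrow> \<bar>A i j\<bar> \<le> M"
  shows "\<bar>mdet d A\<bar> \<le> real (card {p. p permutes {0..<d}}) * M ^ d"
proof -
  have "\<bar>mdet d A\<bar> \<le> (\<Sum>p\<in>{p. p permutes {0..<d}}. \<bar>signof p * (\<Prod>i = 0..<d. A i (p i))\<bar>)"
  proof -
    have "mdet d A = (\<Sum>p\<in>{p. p permutes {0..<d}}. signof p * (\<Prod>i = 0..<d. A i (p i)))"
      unfolding mdet_def by (subst det_def'[of _ d]) (auto intro!: sum.cong prod.cong arg_cong2[of _ _ _ _ "(*)"] dest: permutes_in_image)
    then show ?thesis by simp
  qed
  also have "\<dots> \<le> (\<Sum>p\<in>{p. p permutes {0..<d}}. M ^ d)"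
  proof (rule sum_mono)
    fix p assume p: "p \<in> {p. p permutes {0..<d}}"
    have "\<bar>signof p * (\<Prod>i = 0..<d. A i (p i))\<bar> = (\<Prod>i = 0..<d. \<bar>A i (p i)\<bar>)"
      by (simp add: abs_mult abs_prod sign_def)
    also have "\<dots> \<le> (\<Prod>i = 0..<d. M)"
      using assms p by (intro prod_mono) (auto dest: permutes_in_image)
    finally show "\<bar>signof p * (\<Prod>i = 0..<d. A i (p i))\<bar> \<le> M ^ d" by simp
  qed
  finally show ?thesis by simp
qed

lemma continuous_on_lin_form:
  "continuous_on S (\<lambda>x. ip d (lin d A (\<lambda>i. x0 i - x i)) (lin d A (\<lambda>i. x0 i - x i)))"
proof -
  have c: "continuous_on S (\<lambda>x::nat \<Rightarrow> real. x j)" for j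
    using continuous_on_product_coordinates[of j] continuous_on_subset by blast
  show ?thesis unfolding ip_def lin_def
    by (intro continuous_intros continuous_on_sum) (auto intro!: continuous_intros c)
qed

text \<open>If a point \<open>x\<close> of the small ellipsoid is missing, the point of \<open>K\<close> nearest to \<open>x\<close> in the norm
  given by \<open>A\<close> yields a slab containing \<open>K\<close>.\<close>

lemma separating_slab:
  assumes K: "compact K" "convex K" "K = uminus ` K" "K \<subseteq> coord_space d" "K \<noteq> {}"
    and A: "mdet d A \<noteq> 0" and x: "x \<in> coord_space d" "x \<notin> K"
  obtains v where "ip d v v = 1" "\<And>y. y \<in> K \<Longrightarrow> (ip d v (lin d A y))\<^sup>2 \<le> ip d (lin d A x) (lin d A x)"
proof -
  let ?q = "\<lambda>z. ip d (lin d A z) (lin d A z)"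
  obtain p where p: "p \<in> K" "\<And>y. y \<in> K \<Longrightarrow> ?q (\<lambda>i. x i - p i) \<le> ?q (\<lambda>i. x i - y i)"
    using continuous_attains_inf[OF K(1) K(5) continuous_on_lin_form] by blast
  define w where "w = lin d A (\<lambda>i. x i - p i)"
  have "(\<lambda>i. x i - p i) \<in> coord_space d" using x K(4) p(1) by (auto simp: coord_space_def)
  moreover have "(\<lambda>i. x i - p i) \<noteq> (\<lambda>_. 0)" 
  proof
    assume e: "(\<lambda>i. x i - p i) = (\<lambda>_. 0)"
    have "x = p" by (rule ext) (use fun_cong[OF e] in simp)
    then show False using x(2) p(1) by simp
  qed
  ultimately have "w \<noteq> (\<lambda>_. 0)" using lin_eq_0[OF A] unfolding w_def by blast
  then have ww: "0 < ip d w w"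
    using ip_self_eq_0[of w d] ip_self_nonneg[of d w] lin_in by (simp add: w_def less_le)
  have le: "ip d w (lin d A y) \<le> ip d w (lin d A p)" if y: "y \<in> K" for y
  proof (rule ccontr)
    assume neg: "\<not> ?thesis"
    define D where "D = lin d A (\<lambda>i. y i - p i)"
    define \<alpha> where "\<alpha> = ip d w D"
    have \<alpha>: "0 < \<alpha>" using neg unfolding \<alpha>_def D_def lin_linear ip_linear by simp
    define \<beta> where "\<beta> = ip d D D"
    have \<beta>: "0 \<le> \<beta>" by (simp add: \<beta>_def ip_self_nonneg)
    \<comment> \<open>Moving from \<open>p\<close> towards \<open>y\<close> by \<open>t\<close>
      changes the squared distance to \<open>x\<close> by
      \<open>t\<^sup>2 * \<beta> - 2 * t * \<alpha>\<close>. This step is short enough for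
      \<open>t * \<beta> \<le> \<alpha>\<close>, so the change is negative, against the choice of
      \<open>p\<close>.\<close>
    define t where "t = min 1 (\<alpha> / (\<beta> + 1))"
    have t: "0 < t" "t \<le> 1" using \<alpha> \<beta> by (auto simp: t_def)
    have "(1 - t) *\<^sub>R p + t *\<^sub>R y \<in> K" using K(2) p(1) y t by (intro convexD) auto
    moreover have "(1 - t) *\<^sub>R p + t *\<^sub>R y = (\<lambda>i. p i + t * (y i - p i))"
      by (auto simp: scaleR_fun_def plus_fun_def fun_eq_iff algebra_simps)
    ultimately have in_K: "(\<lambda>i. p i + t * (y i - p i)) \<in> K" by simp
    have "lin d A (\<lambda>i. x i - (p i + t * (y i - p i))) = (\<lambda>i. w i + (- t) * D i)"
    proof -
      have "(\<lambda>i. x i - (p i + t * (y i - p i))) = (\<lambda>i. (x i - p i) + (- t) * (y i - p i))"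
        by (simp add: fun_eq_iff algebra_simps)
      then show ?thesis by (simp only: lin_linear(1) w_def D_def)
    qed
    then have "ip d w w \<le> ip d (\<lambda>i. w i + (- t) * D i) (\<lambda>i. w i + (- t) * D i)"
      using p(2)[OF in_K] by (simp only: w_def)
    also have "\<dots> = ip d w w + (- t) * \<alpha> + ((- t) * \<alpha> + (- t) * ((- t) * \<beta>))"
      unfolding ip_add_left ip_add_right ip_scale_left ip_scale_right \<alpha>_def \<beta>_def ip_commute[of d D w]
      by (rule refl)
    finally have "t * (2 * \<alpha>) \<le> t * (t * \<beta>)" by (simp add: algebra_simps)
    then have "2 * \<alpha> \<le> t * \<beta>" using t(1) by (simp only: mult_le_cancel_left_pos)
    also have "t * \<beta> \<le> \<alpha> / (\<beta> + 1) * \<beta>" using \<beta> by (intro mult_right_mono) (auto simp: t_def)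
    also have "\<dots> \<le> \<alpha>" using \<alpha> \<beta> by (simp add: field_simps)
    finally show False using \<alpha> by simp
  qed
  have wp: "ip d w (lin d A p) \<le> ip d w (lin d A x)"
  proof -
    have "ip d w w = ip d w (lin d A x) - ip d w (lin d A p)"
      by (subst (2) w_def) (simp add: lin_linear ip_linear)
    then show ?thesis using ww by simp
  qed
  have abs: "\<bar>ip d w (lin d A y)\<bar> \<le> ip d w (lin d A x)" if y: "y \<in> K" for y
  proof -
    have "- y \<in> K" using K(3) y by blast
    moreover have "- y = (\<lambda>i. - y i)" by (simp add: fun_eq_iff)
    ultimately have "ip d w (lin d A (\<lambda>i. - y i)) \<le> ip d w (lin d A x)"
      using le[of "- y"] wp by simp
    moreover have "ip d w (lin d A (\<lambda>i. - y i)) = - ip d w (lin d A y)"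
      unfolding lin_linear by (simp add: ip_def sum_negf)
    ultimately show ?thesis using le[OF y] wp by linarith
  qed
  define v where "v = (\<lambda>i. (1 / sqrt (ip d w w)) * w i)"
  show thesis
  proof (rule that[of v])
    show "ip d v v = 1" unfolding v_def ip_linear using ww by simp
    fix y assume y: "y \<in> K"
    have "(ip d w (lin d A y))\<^sup>2 \<le> (ip d w (lin d A x))\<^sup>2"
      using power_mono[OF abs[OF y], of 2] by simp
    also have "\<dots> \<le> ip d w w * ?q x" by (rule ip_cauchy_schwarz)
    finally have "(ip d w (lin d A y))\<^sup>2 / ip d w w \<le> ?q x" using ww by (simp add: divide_le_eq mult.commute)
    then show "(ip d v (lin d A y))\<^sup>2 \<le> ?q x"
      unfolding v_def ip_linear using ww by (simp add: power_mult_distrib power_divide)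
  qed
qed

lemma compact_coords_bounded:
  fixes K :: "(nat \<Rightarrow> real) set"
  assumes "compact K"
  obtains R where "0 < R" "\<And>x i. x \<in> K \<Longrightarrow> i < d \<Longrightarrow> \<bar>x i\<bar> \<le> R"
proof -
  have "\<exists>r. \<forall>x\<in>K. \<bar>x i\<bar> \<le> r" for i
  proof -
    have "continuous_on K (\<lambda>x::nat \<Rightarrow> real. x i)"
      using continuous_on_product_coordinates[of i] continuous_on_subset by blast
    then have "bounded ((\<lambda>x. x i) ` K)" using assms compact_continuous_image compact_imp_bounded by blast
    then show ?thesis by (simp add: bounded_real)
  qed
  then obtain r where r: "\<And>i x. x \<in> K \<Longrightarrow> \<bar>x i\<bar> \<le> r i" by metis
  have "\<bar>x i\<bar> \<le> 1 + (\<Sum>i<d. \<bar>r i\<bar>)" if "x \<in> K" "i < d" for x i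
    using r[OF that(1), of i] member_le_sum[of i "{..<d}" "\<lambda>i. \<bar>r i\<bar>"] that(2) by simp
  moreover have "0 < 1 + (\<Sum>i<d. \<bar>r i\<bar>)" by (simp add: add_pos_nonneg sum_nonneg)
  ultimately show thesis using that by blast
qed

text \<open>The optimal ellipsoid satisfies this with \<open>d\<close> in place of \<open>4 * d\<close>. With the weaker constant a
  determinant close to the supremum is enough, because every slab of half-width \<open>1/(2 sqrt d)\<close>
  improves the squared determinant by a factor of at least 5/4.\<close>

lemma john_ellipsoid:
  assumes d: "1 \<le> d" and K: "compact K" "convex K" "K = uminus ` K" "K \<subseteq> coord_space d"
    and inner: "\<And>j. j < d \<Longrightarrow> \<exists>\<epsilon>>0. (\<lambda>i. \<epsilon> * std_vec j i) \<in> K"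
  obtains A where "mdet d A \<noteq> 0" "\<And>x. x \<in> K \<Longrightarrow> ip d (lin d A x) (lin d A x) \<le> 1"
    "\<And>x. x \<in> coord_space d \<Longrightarrow> 4 * real d * ip d (lin d A x) (lin d A x) \<le> 1 \<Longrightarrow> x \<in> K"
proof -
  \<comment> \<open>The matrices whose ellipsoid \<open>|A x| \<le> 1\<close> contains
    \<open>K\<close>. A large determinant means a small volume, so the supremum of \<open>S\<close>
    belongs to the smallest enclosing ellipsoid.\<close>
  define \<A> where "\<A> = {A. \<forall>x\<in>K. ip d (lin d A x) (lin d A x) \<le> 1}"
  define S where "S = (\<lambda>A. (mdet d A)\<^sup>2) ` \<A>"
  have K_ne: "K \<noteq> {}" using inner[of 0] d by auto
  have bdd: "bdd_above S"
  proof -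
    obtain \<epsilon> where \<epsilon>: "\<And>j. j < d \<Longrightarrow> \<epsilon> j > 0" "\<And>j. j < d \<Longrightarrow> (\<lambda>i. \<epsilon> j * std_vec j i) \<in> K"
      using inner by metis
    define M where "M = (\<Sum>j<d. 1 / \<epsilon> j)"
    have "(mdet d A)\<^sup>2 \<le> (real (card {p. p permutes {0..<d}}) * M ^ d)\<^sup>2" if A: "A \<in> \<A>" for A
    proof -
      have "\<bar>A i j\<bar> \<le> M" if ij: "i < d" "j < d" for i j
      proof -
        have e: "lin d A (\<lambda>i. \<epsilon> j * std_vec j i) i = \<epsilon> j * A i j"
          using ij by (simp add: lin_def std_vec_def of_bool_def if_distrib cong: if_cong)
        have "(lin d A (\<lambda>i. \<epsilon> j * std_vec j i) i)\<^sup>2 \<le> ip d (lin d A (\<lambda>i. \<epsilon> j * std_vec j i)) (lin d A (\<lambda>i. \<epsilon> j * std_vec j i))"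
          unfolding ip_def power2_eq_square using ij(1) by (intro member_le_sum) auto
        also have "\<dots> \<le> 1" using A \<epsilon>(2)[OF ij(2)] by (simp add: \<A>_def)
        finally have "\<bar>\<epsilon> j * A i j\<bar> \<le> 1" unfolding e by (simp add: abs_square_le_1)
        then have "\<bar>A i j\<bar> \<le> 1 / \<epsilon> j" using \<epsilon>(1)[OF ij(2)] by (simp add: abs_mult field_simps)
        also have "\<dots> \<le> M" unfolding M_def using ij(2) \<epsilon>(1) by (intro member_le_sum) (auto intro: less_imp_le)
        finally show ?thesis .
      qed
      from mdet_bounded[OF this] show ?thesis using power_mono[of "\<bar>mdet d A\<bar>" _ 2] by simp
    qed
    then show ?thesis unfolding S_def by (intro bdd_aboveI2)
  qed
  have "\<exists>A\<in>\<A>. mdet d A \<noteq> 0"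
  proof -
    obtain R where R: "0 < R" "\<And>x i. x \<in> K \<Longrightarrow> i < d \<Longrightarrow> \<bar>x i\<bar> \<le> R"
      using compact_coords_bounded[OF K(1), of d] by blast
    \<comment> \<open>The ball of radius \<open>R * sqrt d\<close> contains the cube that encloses
      \<open>K\<close>.\<close>
    define \<eta> where "\<eta> = 1 / (R * sqrt d)"
    have \<eta>: "\<eta> \<noteq> 0" using R(1) d by (simp add: \<eta>_def)
    define A :: "nat \<Rightarrow> nat \<Rightarrow> real" where "A = (\<lambda>i j. \<eta> * of_bool (i = j))"
    have "ip d (lin d A x) (lin d A x) \<le> 1" if x: "x \<in> K" for x
    proof -
      have "lin d A x i = \<eta> * x i" if "i < d" for i
        using that by (simp add: lin_def A_def of_bool_def if_distrib if_distribR cong: if_cong)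
      then have "ip d (lin d A x) (lin d A x) = (\<Sum>i<d. \<eta>\<^sup>2 * (x i)\<^sup>2)"
        by (simp add: ip_def power2_eq_square algebra_simps)
      also have "\<dots> \<le> (\<Sum>i<d. \<eta>\<^sup>2 * R\<^sup>2)"
        using R x by (intro sum_mono mult_left_mono) (auto simp: abs_le_square_iff[symmetric])
      also have "\<dots> = 1" using R(1) d by (simp add: \<eta>_def power_divide power_mult_distrib)
      finally show ?thesis .
    qed
    moreover have "mat d d (\<lambda>(i, j). A i j) = \<eta> \<cdot>\<^sub>m 1\<^sub>m d" by (rule eq_matI) (auto simp: A_def)
    then have "mdet d A \<noteq> 0" using \<eta> by (simp add: mdet_def)
    ultimately show ?thesis by (auto simp: \<A>_def)
  qed
  then obtain A0 where A0: "A0 \<in> \<A>" "mdet d A0 \<noteq> 0" by blast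
  have "(mdet d A0)\<^sup>2 \<in> S" using A0(1) by (auto simp: S_def)
  then have "(mdet d A0)\<^sup>2 \<le> Sup S" by (rule cSup_upper[OF _ bdd])
  moreover have "0 < (mdet d A0)\<^sup>2" using A0(2) by simp
  ultimately have Sup0: "0 < Sup S" by linarith
  then have "(4/5) * Sup S < Sup S" by simp
  then obtain A where A: "A \<in> \<A>" "(4/5) * Sup S < (mdet d A)\<^sup>2"
    using less_cSup_iff[OF _ bdd, of "(4/5) * Sup S"] A0 by (auto simp: S_def)
  have A_nz: "mdet d A \<noteq> 0" using A(2) Sup0 by auto
  show thesis
  proof (rule that[OF A_nz])
    show "ip d (lin d A x) (lin d A x) \<le> 1" if "x \<in> K" for x using A(1) that by (simp add: \<A>_def)
    fix x assume x: "x \<in> coord_space d" and small: "4 * real d * ip d (lin d A x) (lin d A x) \<le> 1"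
    show "x \<in> K"
    proof (rule ccontr)
      assume "x \<notin> K"
      from separating_slab[OF K K_ne A_nz x this] obtain v where v: "ip d v v = 1"
        "\<And>y. y \<in> K \<Longrightarrow> (ip d v (lin d A y))\<^sup>2 \<le> ip d (lin d A x) (lin d A x)" by blast
      \<comment> \<open>Shrinking by \<open>r\<close> and stretching along \<open>v\<close> by
        \<open>1 + c\<close> replaces \<open>|A y|\<^sup>2\<close> by
        \<open>(1 - \<tau>) * |A y|\<^sup>2 + 2 * t\<^sup>2\<close>, where \<open>t\<close> is the
        component of \<open>A y\<close> along \<open>v\<close>. As
        \<open>t\<^sup>2 \<le> 1 / (4 d)\<close> on \<open>K\<close>, the choice
        \<open>\<tau> = 1 / (2 d)\<close> keeps this at most 1. The squared determinant gains
        \<open>(1 - \<tau>) ^ (d - 1) * (3 - \<tau>)\<close>, at least \<open>1/2 * 5/2\<close> by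
        Bernoulli.\<close>
      define \<tau> where "\<tau> = 1 / (2 * real d)"
      have \<tau>: "0 < \<tau>" "\<tau> \<le> 1/2" using d by (auto simp: \<tau>_def field_simps)
      define r where "r = sqrt (1 - \<tau>)"
      define c where "c = sqrt ((3 - \<tau>) / (1 - \<tau>)) - 1"
      have r2: "r\<^sup>2 = 1 - \<tau>" using \<tau> by (simp add: r_def)
      have c2: "(1 + c)\<^sup>2 = (3 - \<tau>) / (1 - \<tau>)" using \<tau> by (simp add: c_def)
      have c2': "2 * c + c\<^sup>2 = 2 / (1 - \<tau>)"
      proof -
        have "2 * c + c\<^sup>2 = (1 + c)\<^sup>2 - 1" by (simp add: power2_eq_square algebra_simps)
        also have "\<dots> = 2 / (1 - \<tau>)" unfolding c2 using \<tau> by (simp add: field_simps)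
        finally show ?thesis .
      qed
      define A' where "A' = (\<lambda>i j. r * (A i j + c * v i * (\<Sum>l<d. v l * A l j)))"
      have lin': "lin d A' y i = r * (lin d A y i + c * ip d v (lin d A y) * v i)" if i: "i < d" for y i
      proof -
        have "ip d v (lin d A y) = (\<Sum>l<d. \<Sum>j<d. v l * (A l j * y j))"
          by (simp add: ip_def lin_def sum_distrib_left)
        also have "\<dots> = (\<Sum>j<d. \<Sum>l<d. v l * (A l j * y j))" by (rule sum.swap)
        also have "\<dots> = (\<Sum>j<d. (\<Sum>l<d. v l * A l j) * y j)"
          by (simp add: sum_distrib_right mult.assoc)
        finally have e: "ip d v (lin d A y) = (\<Sum>j<d. (\<Sum>l<d. v l * A l j) * y j)" .
        have "lin d A' y i = (\<Sum>j<d. r * (A i j * y j) + r * c * v i * ((\<Sum>l<d. v l * A l j) * y j))"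
          using i by (simp add: lin_def A'_def algebra_simps)
        also have "\<dots> = r * (\<Sum>j<d. A i j * y j) + r * c * v i * ip d v (lin d A y)"
          unfolding e by (simp add: sum.distrib sum_distrib_left)
        finally show ?thesis using i by (simp add: lin_def algebra_simps)
      qed
      have "ip d (lin d A' y) (lin d A' y) \<le> 1" if y: "y \<in> K" for y
      proof -
        define t where "t = ip d v (lin d A y)"
        have "ip d (lin d A' y) (lin d A' y)
            = ip d (\<lambda>i. r * (lin d A y i + (c * t) * v i)) (\<lambda>i. r * (lin d A y i + (c * t) * v i))"
          by (rule ip_cong) (simp_all add: lin' t_def)
        also have "\<dots> = r\<^sup>2 * (ip d (lin d A y) (lin d A y) + (2 * c + c\<^sup>2) * t\<^sup>2)"
          unfolding ip_linear using v(1)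
          by (simp add: ip_commute[of d "lin d A y" v] t_def[symmetric] power2_eq_square algebra_simps)
        also have "\<dots> = (1 - \<tau>) * ip d (lin d A y) (lin d A y) + 2 * t\<^sup>2"
          unfolding r2 c2' using \<tau> by (simp add: field_simps)
        also have "\<dots> \<le> (1 - \<tau>) * 1 + 2 * (1 / (4 * real d))"
        proof (intro add_mono mult_left_mono)
          show "ip d (lin d A y) (lin d A y) \<le> 1" using A(1) y by (simp add: \<A>_def)
          have "t\<^sup>2 \<le> ip d (lin d A x) (lin d A x)" using v(2)[OF y] by (simp add: t_def)
          also have "\<dots> \<le> 1 / (4 * real d)" using small d by (simp add: field_simps)
          finally show "t\<^sup>2 \<le> 1 / (4 * real d)" .
        qed (use \<tau> in auto)
        also have "\<dots> = 1" by (simp add: \<tau>_def)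
        finally show ?thesis .
      qed
      then have "(mdet d A')\<^sup>2 \<in> S" by (auto simp: S_def \<A>_def)
      then have "(mdet d A')\<^sup>2 \<le> Sup S" using bdd by (rule cSup_upper)
      moreover have "(5/4) * (mdet d A)\<^sup>2 \<le> (mdet d A')\<^sup>2"
      proof -
        have "mdet d A' = r ^ d * (1 + c) * mdet d A"
          unfolding A'_def mdet_rank_one_update v(1) by simp
        then have "(mdet d A')\<^sup>2 = (r\<^sup>2) ^ d * (1 + c)\<^sup>2 * (mdet d A)\<^sup>2"
          by (simp add: power_mult_distrib power_mult[symmetric] mult.commute)
        also have "(r\<^sup>2) ^ d * (1 + c)\<^sup>2 = (1 - \<tau>) ^ (d - 1) * (3 - \<tau>)"
          unfolding r2 c2 using \<tau> d by (cases d) auto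
        finally have e: "(mdet d A')\<^sup>2 = (1 - \<tau>) ^ (d - 1) * (3 - \<tau>) * (mdet d A)\<^sup>2" .
        have "1 + real (d - 1) * (- \<tau>) \<le> (1 + (- \<tau>)) ^ (d - 1)"
          using \<tau> by (intro Bernoulli_inequality) simp
        moreover have "1/2 \<le> 1 + real (d - 1) * (- \<tau>)"
          using d by (simp add: \<tau>_def field_simps of_nat_diff)
        ultimately have "1/2 * (5/2) \<le> (1 - \<tau>) ^ (d - 1) * (3 - \<tau>)"
          using \<tau> by (intro mult_mono) auto
        then show ?thesis unfolding e by (intro mult_right_mono) auto
      qed
      ultimately show False using A(2) by linarith
    qed
  qed
qed

lemma mdet_inverse:
  assumes "mdet d A \<noteq> 0"
  obtains B where "\<And>i j. i < d \<Longrightarrow> j < d \<Longrightarrow> (\<Sum>l<d. A i l * B l j) = of_bool (i = j)"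
    "\<And>i j. i < d \<Longrightarrow> j < d \<Longrightarrow> (\<Sum>l<d. B i l * A l j) = of_bool (i = j)"
proof -
  let ?A = "mat d d (\<lambda>(i, j). A i j)"
  have "?A \<in> Units (ring_mat TYPE(real) d ())"
    using assms by (intro det_non_zero_imp_unit) (auto simp: mdet_def)
  then obtain M where M: "M \<in> carrier_mat d d" "?A * M = 1\<^sub>m d" "M * ?A = 1\<^sub>m d"
    by (auto simp: Units_def ring_mat_def)
  have "(\<Sum>l<d. A i l * M $$ (l, j)) = of_bool (i = j)" if "i < d" "j < d" for i j
  proof -
    have "(?A * M) $$ (i, j) = (\<Sum>l<d. A i l * M $$ (l, j))"
      using that M(1) by (simp add: scalar_prod_def lessThan_atLeast0)
    moreover have "(?A * M) $$ (i, j) = of_bool (i = j)" unfolding M(2) using that by simp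
    ultimately show ?thesis by simp
  qed
  moreover have "(\<Sum>l<d. M $$ (i, l) * A l j) = of_bool (i = j)" if "i < d" "j < d" for i j
  proof -
    have "(M * ?A) $$ (i, j) = (\<Sum>l<d. M $$ (i, l) * A l j)"
      using that M(1) by (simp add: scalar_prod_def lessThan_atLeast0)
    moreover have "(M * ?A) $$ (i, j) = of_bool (i = j)" unfolding M(3) using that by simp
    ultimately show ?thesis by simp
  qed
  ultimately show thesis using that[of "\<lambda>i j. M $$ (i, j)"] by blast
qed

section \<open>Integer points and volume\<close>

text \<open>Triangularity with positive diagonal: the product with \<open>f (d - 1)\<close> isolates
  the last coefficient, and the others follow downwards.\<close>

lemma (in hkz_frame) u_independent:
  assumes e: "\<And>m. (\<Sum>i<d. e i * u i m) = 0" and l: "l < d"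
  shows "e l = 0"
proof -
  have "e i = 0" if "d - t \<le> i" "i < d" for t i
    using that
  proof (induction t arbitrary: i)
    case (Suc t)
    show ?case
    proof (cases "d - t \<le> i")
      case True
      then show ?thesis using Suc by blast
    next
      case False
      then have i: "Suc i = d - t" using Suc.prems by auto
      have "0 = ip d (\<lambda>m. \<Sum>j<d. e j * u j m) (f i)" by (simp add: e ip_linear)
      also have "\<dots> = (\<Sum>j<d. e j * ip d (u j) (f i))" by (simp add: ip_linear)
      also have "\<dots> = (\<Sum>j\<in>{i}. e j * ip d (u j) (f i))"
      proof (rule sum.mono_neutral_right)
        show "\<forall>j\<in>{..<d} - {i}. e j * ip d (u j) (f i) = 0"
        proof
          fix j assume j: "j \<in> {..<d} - {i}"
          show "e j * ip d (u j) (f i) = 0"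
          proof (cases "j < i")
            case True
            then show ?thesis using tri Suc.prems by simp
          next
            case False
            then show ?thesis using Suc.IH[of j] j i by auto
          qed
        qed
      qed (use Suc.prems in auto)
      finally show ?thesis using pos[OF Suc.prems(2)] by simp
    qed
  qed simp
  from this[of d l] l show ?thesis by simp
qed

text \<open>The \<open>C i\<close> are the basis of the integer lattice dual to the functionals
  \<open>u l\<close>. They realise prescribed integer values of these functionals, and those with
  \<open>i \<ge> k\<close> span the section on which the first \<open>k\<close> functionals
  vanish.\<close>

locale hkz_dual_frame = hkz_frame +
  fixes C :: "nat \<Rightarrow> nat \<Rightarrow> real"
  assumes C_dual: "l < d \<Longrightarrow> i < d \<Longrightarrow> ip d (u l) (emb (C i)) = of_bool (l = i)"
    and C_int: "C i j \<in> \<int>"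
    and C_in: "C i \<in> coord_space d"

text \<open>The \<open>w j\<close> and the \<open>u i\<close> are integer combinations of each
  other. Their coefficient matrices are inverse to each other because the \<open>u i\<close> are
  independent, and the columns of the first give the \<open>C i\<close>.\<close>

lemma (in hkz_frame) exists_hkz_dual_frame: "\<exists>C. hkz_dual_frame d a w u f C"
proof -
  have "\<exists>n::nat \<Rightarrow> int. w j = (\<lambda>m. \<Sum>i<d. of_int (n i) * u i m)" if "j < d" for j
    using dlat_u_combination[OF dlat_w[OF that]] by metis
  then obtain n :: "nat \<Rightarrow> nat \<Rightarrow> int" where n: "\<And>j. j < d \<Longrightarrow> w j = (\<lambda>m. \<Sum>i<d. of_int (n j i) * u i m)"
    by metis
  have "\<exists>q::nat \<Rightarrow> int. u l = (\<lambda>m. \<Sum>j<d. of_int (q j) * w j m)" if "l < d" for l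
    using u[OF that] by (auto simp: dlat_def)
  then obtain q :: "nat \<Rightarrow> nat \<Rightarrow> int" where q: "\<And>l. l < d \<Longrightarrow> u l = (\<lambda>m. \<Sum>j<d. of_int (q l j) * w j m)"
    by metis
  define C where "C i = (\<lambda>j. if j < d then real_of_int (n j i) else 0)" for i
  have "ip d (u l) (emb (C i)) = of_bool (l = i)" if li: "l < d" "i < d" for l i
  proof -
    have "ip d (u l) (emb (C i)) = (\<Sum>j<d. of_int (q l j) * of_int (n j i))"
      by (subst q[OF li(1)]) (simp add: ip_linear ip_w_emb C_def)
    moreover have "(\<Sum>j<d. of_int (q l j) * real_of_int (n j i)) - of_bool (l = i) = 0"
    proof (rule u_independent[OF _ li(2)])
      fix m
      have "u l m = (\<Sum>j<d. of_int (q l j) * (\<Sum>i<d. of_int (n j i) * u i m))"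
        using q[OF li(1)] n by (simp add: fun_eq_iff)
      also have "\<dots> = (\<Sum>i<d. (\<Sum>j<d. of_int (q l j) * of_int (n j i)) * u i m)"
        unfolding sum_distrib_left sum_distrib_right by (subst sum.swap) (simp add: mult.assoc)
      finally have "(\<Sum>i<d. (\<Sum>j<d. of_int (q l j) * of_int (n j i)) * u i m) = u l m" by simp
      moreover have "(\<Sum>i<d. of_bool (l = i) * u i m) = u l m"
        using li(1) by (simp add: of_bool_def if_distribR if_distrib cong: if_cong)
      ultimately show "(\<Sum>i<d. ((\<Sum>j<d. of_int (q l j) * of_int (n j i)) - of_bool (l = i)) * u i m) = 0"
        by (simp add: left_diff_distrib sum_subtractf)
    qed
    ultimately show ?thesis by simp
  qed
  then have "hkz_dual_frame d a w u f C" by unfold_locales (auto simp: C_def coord_space_def)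
  then show ?thesis by blast
qed

context hkz_dual_frame
begin

lemma emb_linear:
  "emb (\<lambda>j. \<Sum>i\<in>S. y i * x i j) = (\<lambda>m. \<Sum>i\<in>S. y i * emb (x i) m)"
  "emb (\<lambda>j. c * x' j) = (\<lambda>m. c * emb x' m)"
  "emb (\<lambda>j. x' j - x'' j) = (\<lambda>m. emb x' m - emb x'' m)"
  "emb (\<lambda>j. x' j + x'' j) = (\<lambda>m. emb x' m + emb x'' m)"
proof -
  show "emb (\<lambda>j. \<Sum>i\<in>S. y i * x i j) = (\<lambda>m. \<Sum>i\<in>S. y i * emb (x i) m)"
    unfolding emb_def sum_distrib_left sum_distrib_right
    by (rule ext, subst sum.swap) (simp add: mult.assoc)
qed (simp_all add: emb_def fun_eq_iff sum_distrib_left sum_subtractf sum.distrib algebra_simps)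

lemma emb_inj:
  assumes "x \<in> coord_space d" "x' \<in> coord_space d" "emb x = emb x'"
  shows "x = x'"
  using assms ip_w_emb by (intro coord_space_ext[OF assms(1,2)]) metis

text \<open>The difference of the two sides is orthogonal to all \<open>u i\<close>, hence to their
  integer combinations \<open>w j\<close>, and so vanishes.\<close>

lemma emb_expand: "emb x = (\<lambda>m. \<Sum>i<d. ip d (u i) (emb x) * emb (C i) m)"
proof -
  define z where "z = (\<lambda>m. emb x m - (\<Sum>i<d. ip d (u i) (emb x) * emb (C i) m))"
  have uz: "ip d (u l) z = 0" if "l < d" for l
  proof -
    have "(\<Sum>i<d. ip d (u i) (emb x) * ip d (u l) (emb (C i)))
        = (\<Sum>i<d. if l = i then ip d (u i) (emb x) else 0)"
      using that by (intro sum.cong) (auto simp: C_dual)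
    then show ?thesis using that by (simp add: z_def ip_linear)
  qed
  have "z \<in> coord_space d" using emb_in by (auto simp: z_def coord_space_def)
  moreover have "ip d (w j) z = 0" if j: "j < d" for j
  proof -
    obtain n :: "nat \<Rightarrow> int" where n: "w j = (\<lambda>m. \<Sum>i<d. of_int (n i) * u i m)"
      using dlat_u_combination[OF dlat_w[OF j]] by metis
    show ?thesis unfolding n by (simp add: ip_linear uz)
  qed
  ultimately have "z = (\<lambda>_. 0)" by (rule perp_w_eq_0)
  then show ?thesis by (simp add: z_def fun_eq_iff)
qed

text \<open>In the coordinates given by \<open>f\<close>, the \<open>u l\<close> and the
  \<open>emb (C i)\<close> form matrices that are inverse up to transposition. The first is lower
  triangular with diagonal \<open>b l\<close>, so the second is upper triangular with the reciprocal
  diagonal.\<close>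

lemma ip_C_f:
  assumes "l < d" "i < d"
  shows "l < i \<Longrightarrow> ip d (emb (C i)) (f l) = 0" "ip d (emb (C i)) (f i) = 1 / b i"
proof -
  have ex: "of_bool (l = i) = (\<Sum>m<l. ip d (u l) (f m) * ip d (emb (C i)) (f m)) + b l * ip d (emb (C i)) (f l)"
    if l: "l < d" for l
  proof -
    have "u l \<in> coord_space d" using u[OF l] dlat_subset by blast
    from parseval(2)[OF f this, of "emb (C i)"]
    have "ip d (u l) (emb (C i)) = (\<Sum>m<d. ip d (u l) (f m) * ip d (emb (C i)) (f m))" .
    also have "\<dots> = (\<Sum>m<Suc l. ip d (u l) (f m) * ip d (emb (C i)) (f m))"
      using l tri[of l] by (intro sum.mono_neutral_right) auto
    finally show ?thesis using C_dual[OF l assms(2)] by simp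
  qed
  have zero: "ip d (emb (C i)) (f l) = 0" if "l < i" for l
    using that
  proof (induction l rule: less_induct)
    case (less l)
    then have "(\<Sum>m<l. ip d (u l) (f m) * ip d (emb (C i)) (f m)) = 0" by (intro sum.neutral) auto
    then show ?case using ex[of l] less.prems assms(2) pos[of l] by auto
  qed
  show "l < i \<Longrightarrow> ip d (emb (C i)) (f l) = 0" using zero .
  have "(\<Sum>m<i. ip d (u i) (f m) * ip d (emb (C i)) (f m)) = 0" using zero by (intro sum.neutral) auto
  then show "ip d (emb (C i)) (f i) = 1 / b i" using ex[OF assms(2)] pos[OF assms(2)] by (simp add: field_simps)
qed

text \<open>What the values \<open>y i\<close>, \<open>i < l\<close>, add to the coordinate of
  \<open>emb x\<close> along \<open>f l\<close>, in units of \<open>1 / b l\<close>. It makes the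
  Gram--Schmidt coordinates of a lattice point a triangular system with diagonal
  \<open>1 / b l\<close> in the values of the functionals \<open>u i\<close>.\<close>

definition shift :: "nat \<Rightarrow> (nat \<Rightarrow> int) \<Rightarrow> real"
  where "shift l y = b l * (\<Sum>i<l. of_int (y i) * ip d (emb (C i)) (f l))"

lemma ip_emb_f:
  assumes l: "l < d" and y: "\<And>i. i \<le> l \<Longrightarrow> ip d (u i) (emb x) = of_int (y i)"
  shows "ip d (emb x) (f l) = (of_int (y l) + shift l y) / b l"
proof -
  have "ip d (emb x) (f l) = (\<Sum>i<d. ip d (u i) (emb x) * ip d (emb (C i)) (f l))"
    by (subst emb_expand) (simp add: ip_linear)
  also have "\<dots> = (\<Sum>i<Suc l. ip d (u i) (emb x) * ip d (emb (C i)) (f l))"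
    using l ip_C_f(1)[OF l] by (intro sum.mono_neutral_right) auto
  also have "\<dots> = (\<Sum>i<l. of_int (y i) * ip d (emb (C i)) (f l)) + of_int (y l) * (1 / b l)"
    using y ip_C_f(2)[OF l l] by simp
  finally show ?thesis using pos[OF l] by (simp add: shift_def field_simps)
qed

lemma shift_cong: "(\<And>i. i < l \<Longrightarrow> y i = y' i) \<Longrightarrow> shift l y = shift l y'"
  by (simp add: shift_def)

end

text \<open>The image is the preimage of the closed set \<open>K\<close> under extension by zero,
  and this extension is measurable coordinate by coordinate.\<close>

lemma restrict_image_measurable:
  assumes K: "compact K" "K \<subseteq> coord_space d"
  shows "(\<lambda>x. restrict x {..<d}) ` K \<in> sets (Pi\<^sub>M {..<d} (\<lambda>_. lborel :: real measure))"
proof -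
  let ?M = "Pi\<^sub>M {..<d} (\<lambda>_. lborel :: real measure)"
  let ?e = "\<lambda>g::nat \<Rightarrow> real. \<lambda>j. if j < d then g j else 0"
  have "?e \<in> borel_measurable ?M"
  proof (rule measurable_coordinatewise_then_product)
    fix j show "(\<lambda>g. ?e g j) \<in> borel_measurable ?M"
    proof (cases "j < d")
      case True
      then have "(\<lambda>g. g j) \<in> measurable ?M lborel" by (intro measurable_component_singleton) simp
      then show ?thesis using True by simp
    qed simp
  qed
  then have "?e -` K \<inter> space ?M \<in> sets ?M"
    using compact_imp_closed[OF K(1)] by (intro measurable_sets) auto
  moreover have "(\<lambda>x. restrict x {..<d}) ` K = ?e -` K \<inter> space ?M"
  proof (intro equalityI subsetI)
    fix g assume "g \<in> (\<lambda>x. restrict x {..<d}) ` K"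
    then obtain x where x: "x \<in> K" "g = restrict x {..<d}" by auto
    have "?e g = x" using x K(2) by (auto simp: fun_eq_iff coord_space_def)
    then have "?e g \<in> K" using x(1) by simp
    moreover have "g \<in> space ?M" using x(2) by (simp add: space_PiM)
    ultimately show "g \<in> ?e -` K \<inter> space ?M" by simp
  next
    fix g assume g: "g \<in> ?e -` K \<inter> space ?M"
    then have "g = restrict (?e g) {..<d}"
      by (auto simp: space_PiM fun_eq_iff PiE_def extensional_def)
    moreover have "?e g \<in> K" using g by simp
    ultimately show "g \<in> (\<lambda>x. restrict x {..<d}) ` K" by (rule image_eqI)
  qed
  ultimately show ?thesis by simp
qed

text \<open>\<open>vol\<close> is a \<open>measure\<close>, which returns 0 when the
  \<open>emeasure\<close> is infinite; finiteness, from an enclosing cube, lets the two be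
  identified.\<close>

lemma emeasure_restrict_image_finite:
  assumes K: "compact K" "K \<subseteq> coord_space d"
  shows "emeasure (Pi\<^sub>M {..<d} (\<lambda>_. lborel :: real measure)) ((\<lambda>x. restrict x {..<d}) ` K) < \<infinity>"
proof -
  interpret product_sigma_finite "\<lambda>_::nat. lborel :: real measure" by standard
  obtain R where R: "0 < R" "\<And>x i. x \<in> K \<Longrightarrow> i < d \<Longrightarrow> \<bar>x i\<bar> \<le> R"
    using compact_coords_bounded[OF K(1), of d] by blast
  have "(\<lambda>x. restrict x {..<d}) ` K \<subseteq> {..<d} \<rightarrow>\<^sub>E {-R..R}"
  proof (rule image_subsetI)
    fix x assume "x \<in> K"
    then have "x i \<in> {-R..R}" if "i < d" for i using R(2)[of x i] that by (simp add: abs_le_iff)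
    then show "restrict x {..<d} \<in> {..<d} \<rightarrow>\<^sub>E {-R..R}" by (simp add: PiE_def Pi_def)
  qed
  then have "emeasure (Pi\<^sub>M {..<d} (\<lambda>_. lborel :: real measure)) ((\<lambda>x. restrict x {..<d}) ` K)
      \<le> emeasure (Pi\<^sub>M {..<d} (\<lambda>_. lborel :: real measure)) ({..<d} \<rightarrow>\<^sub>E {-R..R})"
    by (intro emeasure_mono) (auto intro!: sets_PiM_I_finite)
  also have "\<dots> = (\<Prod>i<d. emeasure lborel {-R..R})" by (intro emeasure_PiM) auto
  also have "\<dots> < \<infinity>" using R(1) by (simp add: ennreal_power less_top[symmetric])
  finally show ?thesis .
qed

context hkz_dual_frame
begin

text \<open>For a fine grid, the grid cubes that meet half of the parallelepiped
  \<open>\<bar>x \<bullet> f i\<bar> \<le> 1/(2 d)\<close> lie in the ellipsoid.\<close>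

lemma prod_b_le_vol:
  assumes d: "1 \<le> d" and K: "compact K" "K \<subseteq> coord_space d"
    and inner: "\<And>x. x \<in> coord_space d \<Longrightarrow> 4 * real d * ip d (emb x) (emb x) \<le> 1 \<Longrightarrow> x \<in> K"
  shows "(\<Prod>i<d. b i) \<le> (4 * real d) ^ d * vol d K"
proof -
  interpret P: product_sigma_finite "\<lambda>_::nat. lborel :: real measure" by standard
  let ?M = "Pi\<^sub>M {..<d} (\<lambda>_. lborel :: real measure)"
  define B where "B = (\<Sum>i<d. \<Sum>j<d. \<bar>ip d (a j) (f i)\<bar>)"
  have B: "(\<Sum>j<d. \<bar>ip d (a j) (f i)\<bar>) \<le> B" if "i < d" for i
    unfolding B_def by (rule member_le_sum) (use that in \<open>auto intro: sum_nonneg\<close>)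
  have B0: "0 \<le> B" by (simp add: B_def sum_nonneg)
  \<comment> \<open>The summand \<open>4 d B\<close> keeps the coordinates along \<open>f i\<close>
    within \<open>1 / (4 d)\<close> over a grid cube of side \<open>1 / N\<close>. The summands
    \<open>4 d / b i\<close> give \<open>N * b i / (2 d) \<ge> 2\<close>, so subtracting 1 in the
    grid count costs at most a factor 2. The summand 1 makes \<open>N\<close> positive.\<close>
  define N where "N = 1 + 4 * real d * B + (\<Sum>i<d. 4 * real d / b i)"
  have sum0: "0 \<le> (\<Sum>i<d. 4 * real d / b i)" using pos by (intro sum_nonneg) (auto intro: less_imp_le)
  have N0: "0 < N" using B0 sum0 by (simp add: N_def add_pos_nonneg)
  have NB: "B / N \<le> 1 / (4 * real d)"
  proof -
    have "4 * real d * B \<le> N" using sum0 by (simp add: N_def)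
    then show ?thesis using N0 d by (simp add: field_simps)
  qed
  have Nb: "4 * real d \<le> N * b i" if i: "i < d" for i
  proof -
    have "4 * real d / b i \<le> (\<Sum>i<d. 4 * real d / b i)"
      by (rule member_le_sum) (use i pos in \<open>auto intro: less_imp_le\<close>)
    also have "\<dots> \<le> N" using B0 by (simp add: N_def)
    finally show ?thesis using pos[OF i] by (simp add: field_simps)
  qed
  \<comment> \<open>The values, under the \<open>u l\<close>, of the integer points in the
    parallelepiped with half-side \<open>1 / (4 d)\<close> along the \<open>f l\<close>, magnified
    by \<open>N\<close>.\<close>
  define T where "T = tri_box d shift (\<lambda>i. 1 / b i) (\<lambda>_. - N / (4 * real d)) (\<lambda>_. N / (2 * real d))"
  have T: "finite T" "(\<Prod>i<d. N * b i / (4 * real d)) \<le> real (card T)"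
  proof -
    have *: "finite T \<and> real (card T) \<le> (\<Prod>i<d. N / (2 * real d) / (1 / b i) + 1) \<and>
      ((\<forall>i<d. 1 / b i \<le> N / (2 * real d)) \<longrightarrow> (\<Prod>i<d. N / (2 * real d) / (1 / b i) - 1) \<le> real (card T))"
      unfolding T_def
      by (rule tri_box_count) (use pos N0 in simp, use N0 in simp, rule shift_cong)
    have half: "2 \<le> N * b i / (2 * real d)" if "i < d" for i
      using Nb[OF that] d by (simp add: field_simps)
    have "1 / b i \<le> N / (2 * real d)" if "i < d" for i
      using half[OF that] pos[OF that] d by (simp add: field_simps)
    then have "(\<Prod>i<d. N / (2 * real d) / (1 / b i) - 1) \<le> real (card T)" using * by blast
    moreover have "(\<Prod>i<d. N * b i / (4 * real d)) \<le> (\<Prod>i<d. N / (2 * real d) / (1 / b i) - 1)"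
    proof (rule prod_mono)
      fix i assume "i \<in> {..<d}"
      then have i: "i < d" by simp
      have "N * b i / (4 * real d) = N * b i / (2 * real d) / 2" by simp
      also have "\<dots> \<le> N * b i / (2 * real d) - 1"
      proof -
        have "h / 2 \<le> h - 1" if "2 \<le> h" for h :: real using that by simp
        then show ?thesis using half[OF i] .
      qed
      finally show "0 \<le> N * b i / (4 * real d) \<and> N * b i / (4 * real d) \<le> N / (2 * real d) / (1 / b i) - 1"
        using N0 pos[OF i] by simp
    qed
    ultimately show "finite T" "(\<Prod>i<d. N * b i / (4 * real d)) \<le> real (card T)" using * by auto
  qed
  define X where "X y = (\<lambda>j. \<Sum>i<d. of_int (y i) * C i j)" for y :: "nat \<Rightarrow> int"
  have X_in: "X y \<in> coord_space d" for y using C_in by (auto simp: X_def coord_space_def)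
  have X_int: "X y j \<in> \<int>" for y j unfolding X_def using C_int by (auto intro!: Ints_sum Ints_mult)
  have uX: "ip d (u l) (emb (X y)) = of_int (y l)" if "l < d" for l y
  proof -
    have "ip d (u l) (emb (X y)) = (\<Sum>i<d. of_int (y i) * ip d (u l) (emb (C i)))"
      unfolding X_def emb_linear by (simp add: ip_linear)
    also have "\<dots> = (\<Sum>i<d. if l = i then of_int (y i) else 0)"
      using that by (intro sum.cong) (auto simp: C_dual)
    finally show ?thesis using that by simp
  qed
  have fX: "\<bar>ip d (emb (X y)) (f l)\<bar> \<le> N / (4 * real d)" if y: "y \<in> T" and l: "l < d" for y l
  proof -
    have "ip d (emb (X y)) (f l) = 1 / b l * (of_int (y l) + shift l y)"
      using ip_emb_f[OF l uX, of y] l by simp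
    moreover have "N / (2 * real d) = 2 * (N / (4 * real d))" by simp
    ultimately show ?thesis using y l by (auto simp: T_def tri_box_def abs_le_iff)
  qed
  \<comment> \<open>Half-open cubes with different integer corners \<open>X y\<close> are disjoint,
    and \<open>y\<close> can be read off from \<open>X y\<close>.\<close>
  define Q where "Q y = (\<Pi>\<^sub>E j\<in>{..<d}. {X y j / N ..< (X y j + 1) / N})" for y
  have Q_sets: "Q y \<in> sets ?M" for y unfolding Q_def by (intro sets_PiM_I_finite) auto
  have Q_em: "emeasure ?M (Q y) = ennreal ((1 / N) ^ d)" for y
  proof -
    have "emeasure ?M (Q y) = (\<Prod>j<d. emeasure lborel {X y j / N ..< (X y j + 1) / N})"
      unfolding Q_def by (intro P.emeasure_PiM) auto
    also have "\<dots> = (\<Prod>j<d. ennreal (1 / N))"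
      using N0 by (intro prod.cong) (auto simp: field_simps divide_right_mono diff_divide_distrib[symmetric])
    also have "\<dots> = ennreal ((1 / N) ^ d)" using N0 by (simp add: ennreal_power)
    finally show ?thesis .
  qed
  have Q_mem: "X y j / N \<le> g j \<and> g j < X y j / N + 1 / N" if "g \<in> Q y" "j < d" for g y j
  proof -
    have "g j \<in> {X y j / N ..< (X y j + 1) / N}"
      using PiE_mem[OF that(1)[unfolded Q_def], of j] that(2) by simp
    then show ?thesis by (simp add: add_divide_distrib)
  qed
  have Q_sub: "Q y \<subseteq> (\<lambda>x. restrict x {..<d}) ` K" if y: "y \<in> T" for y
  proof
    fix g assume g: "g \<in> Q y"
    define z where "z = (\<lambda>j. if j < d then g j else 0)"
    define e where "e = (\<lambda>j. z j - (1 / N) * X y j)"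
    have z_in: "z \<in> coord_space d" by (simp add: z_def coord_space_def)
    have e: "\<bar>e j\<bar> \<le> 1 / N" if "j < d" for j
    proof -
      have 1: "X y j / N \<le> g j" "g j < X y j / N + 1 / N" using Q_mem[OF g that] by auto
      have "e j = g j - X y j / N" using that by (simp add: e_def z_def)
      then show ?thesis using 1 by linarith
    qed
    have fz: "\<bar>ip d (emb z) (f l)\<bar> \<le> 1 / (2 * real d)" if l: "l < d" for l
    proof -
      have "ip d (emb e) (f l) = (\<Sum>j<d. e j * ip d (a j) (f l))" by (simp add: emb_def ip_linear)
      then have "\<bar>ip d (emb e) (f l)\<bar> \<le> (\<Sum>j<d. \<bar>e j * ip d (a j) (f l)\<bar>)" by simp
      also have "\<dots> \<le> (\<Sum>j<d. 1 / N * \<bar>ip d (a j) (f l)\<bar>)"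
        unfolding abs_mult using e by (intro sum_mono mult_right_mono) auto
      also have "\<dots> = (\<Sum>j<d. \<bar>ip d (a j) (f l)\<bar>) / N" by (simp add: sum_divide_distrib)
      also have "\<dots> \<le> B / N" using B[OF l] N0 by (intro divide_right_mono) auto
      also have "\<dots> \<le> 1 / (4 * real d)" by (rule NB)
      finally have 1: "\<bar>ip d (emb e) (f l)\<bar> \<le> 1 / (4 * real d)" .
      have "z = (\<lambda>j. (1 / N) * X y j + e j)" by (simp add: e_def)
      then have "ip d (emb z) (f l) = (1 / N) * ip d (emb (X y)) (f l) + ip d (emb e) (f l)"
        by (simp only: emb_linear ip_linear)
      moreover have "\<bar>(1 / N) * ip d (emb (X y)) (f l)\<bar> \<le> 1 / (4 * real d)"
        using fX[OF y l] N0 d by (simp add: abs_mult field_simps)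
      moreover have "1 / (2 * real d) = 1 / (4 * real d) + 1 / (4 * real d)" by simp
      ultimately show ?thesis using 1 by linarith
    qed
    have "ip d (emb z) (emb z) = (\<Sum>l<d. (ip d (emb z) (f l))\<^sup>2)"
      using parseval(2)[OF f emb_in, of z "emb z"] by (simp add: power2_eq_square)
    also have "\<dots> \<le> (\<Sum>l<d. (1 / (2 * real d))\<^sup>2)"
    proof (rule sum_mono)
      fix l assume "l \<in> {..<d}"
      then show "(ip d (emb z) (f l))\<^sup>2 \<le> (1 / (2 * real d))\<^sup>2"
        using power_mono[OF fz[of l], of 2] by simp
    qed
    \<comment> \<open>This is where the half-side \<open>1 / (2 d)\<close> comes from:
      \<open>d\<close> such squares add up to exactly the squared radius of the inner ball.\<close>
    also have "\<dots> = 1 / (4 * real d)" using d by (simp add: power2_eq_square)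
    finally have "4 * real d * ip d (emb z) (emb z) \<le> 1" using d by (simp add: field_simps)
    then have "z \<in> K" using inner[OF z_in] by simp
    moreover have "g = restrict z {..<d}"
      using g by (auto simp: Q_def z_def fun_eq_iff PiE_def extensional_def)
    ultimately show "g \<in> (\<lambda>x. restrict x {..<d}) ` K" by blast
  qed
  have Q_disj: "disjoint_family_on Q T"
    unfolding disjoint_family_on_def
  proof (intro ballI impI)
    fix y y' assume y: "y \<in> T" "y' \<in> T" "y \<noteq> y'"
    show "Q y \<inter> Q y' = {}"
    proof (rule ccontr)
      assume "Q y \<inter> Q y' \<noteq> {}"
      then obtain g where g: "g \<in> Q y" "g \<in> Q y'" by blast
      have "X y j = X y' j" if j: "j < d" for j
      proof -
        have "X y j / N < X y' j / N + 1 / N" "X y' j / N < X y j / N + 1 / N"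
          using Q_mem[OF g(1) j] Q_mem[OF g(2) j] by linarith+
        then have "X y j / N < (X y' j + 1) / N" "X y' j / N < (X y j + 1) / N"
          by (simp_all only: add_divide_distrib)
        then have "X y j < X y' j + 1" "X y' j < X y j + 1"
          using N0 by (simp_all only: divide_less_cancel)
        moreover obtain p q where "X y j = of_int p" "X y' j = of_int q"
          using X_int by (meson Ints_cases)
        ultimately show ?thesis by simp
      qed
      then have "X y = X y'" by (intro coord_space_ext[OF X_in X_in])
      then have "y l = y' l" if "l < d" for l using uX[OF that, of y] uX[OF that, of y'] by simp
      then have "y = y'" using y(1,2) by (intro PiE_ext[of y "{..<d}" "\<lambda>_. UNIV"]) (auto simp: T_def tri_box_def)
      then show False using y(3) by simp
    qed
  qed
  have "ennreal (real (card T) * (1 / N) ^ d) = (\<Sum>y\<in>T. ennreal ((1 / N) ^ d))"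
    using N0 by (simp add: ennreal_mult ennreal_of_nat_eq_real_of_nat)
  also have "\<dots> = (\<Sum>y\<in>T. emeasure ?M (Q y))" by (simp add: Q_em)
  also have "\<dots> = emeasure ?M (\<Union>y\<in>T. Q y)"
    using Q_sets Q_disj T(1) by (intro sum_emeasure) auto
  also have "\<dots> \<le> emeasure ?M ((\<lambda>x. restrict x {..<d}) ` K)"
    using Q_sub by (intro emeasure_mono restrict_image_measurable K) auto
  also have "\<dots> = ennreal (vol d K)"
    using emeasure_restrict_image_finite[OF K] unfolding vol_def
    by (intro emeasure_eq_ennreal_measure) auto
  finally have "real (card T) * (1 / N) ^ d \<le> vol d K"
    by (simp add: vol_def)
  moreover have "(\<Prod>i<d. N * b i / (4 * real d)) * (1 / N) ^ d \<le> real (card T) * (1 / N) ^ d"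
    using T N0 by (intro mult_right_mono) auto
  moreover have "(\<Prod>i<d. N * b i / (4 * real d)) * (1 / N) ^ d = (\<Prod>i<d. b i) / (4 * real d) ^ d"
    using N0 by (simp add: prod_dividef prod.distrib power_divide)
  ultimately have "(\<Prod>i<d. b i) / (4 * real d) ^ d \<le> vol d K" by linarith
  then show ?thesis using d by (simp add: divide_le_eq mult.commute)
qed

end

section \<open>Counting lattice points modulo a section\<close>

lemma coord_space_subset_span_independent:
  assumes B: "independent B" "B \<subseteq> coord_space d" "card B = d"
  shows "coord_space d \<subseteq> span B"
proof
  fix x assume x: "x \<in> coord_space d"
  show "x \<in> span B"
  proof (rule ccontr)
    assume n: "x \<notin> span B"
    then have "independent (insert x B)" using B(1) by (rule independent_insertI)
    then have "card (insert x B) \<le> d"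
      using independent_coord_space_card[of "insert x B" d] B x by auto
    moreover have "finite B" using independent_coord_space_card[OF B(1,2)] by simp
    moreover have "x \<notin> B" using n span_base by blast
    ultimately show False using B(3) by simp
  qed
qed

text \<open>Differences of points of the affine hull stay in \<open>span X\<close>, and
  \<open>d\<close> independent ones among them already span the space.\<close>

lemma affine_dimension_full_span:
  assumes X: "X \<subseteq> coord_space d" "affine_dimension X = d"
  shows "coord_space d \<subseteq> span X"
proof -
  let ?D = "{x - y |x y. x \<in> affine hull X \<and> y \<in> affine hull X}"
  have hull: "affine hull X \<subseteq> span X"
    by (intro hull_minimal span_superset subspace_imp_affine subspace_span)
  then have D: "?D \<subseteq> span X" by (auto intro!: span_diff)
  have span: "span X \<subseteq> coord_space d" using X(1) subspace_coord_space by (rule span_minimal)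
  obtain B where B: "B \<subseteq> ?D" "independent B" "card B = dim ?D"
    by (rule basis_exists[of ?D]) (rule that)
  have "card B = d" using B(3) X(2) unfolding affine_dimension_def by (rule trans)
  moreover have "B \<subseteq> coord_space d" by (rule order_trans[OF order_trans[OF B(1) D] span])
  ultimately have "coord_space d \<subseteq> span B" using B(2) by (intro coord_space_subset_span_independent)
  also have "span B \<subseteq> span X" using order_trans[OF B(1) D] subspace_span by (rule span_minimal)
  finally show ?thesis .
qed

text \<open>The points with a positive multiple in \<open>K\<close> form a subspace: convexity
  handles sums, symmetry negative factors. Thus spanning lattice points of \<open>K\<close> yield
  the small multiples of the standard vectors that \<open>john_ellipsoid\<close> asks for.\<close>

lemma absorbing_span:
  assumes K: "convex K" "K = uminus ` K" "K \<noteq> {}" and x: "x \<in> span K"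
  shows "\<exists>\<epsilon>>0::real. \<epsilon> *\<^sub>R x \<in> K"
proof -
  have neg: "- x \<in> K" if "x \<in> K" for x using K(2) that by blast
  have zero: "0 \<in> K"
  proof -
    obtain y where y: "y \<in> K" using K(3) by blast
    have "(1/2) *\<^sub>R y + (1/2) *\<^sub>R (- y) \<in> K" using y neg[OF y] K(1) by (intro convexD) auto
    then show ?thesis by simp
  qed
  have "subspace {x. \<exists>\<epsilon>>0::real. \<epsilon> *\<^sub>R x \<in> K}"
    unfolding subspace_def
  proof (intro conjI ballI allI)
    show "0 \<in> {x. \<exists>\<epsilon>>0::real. \<epsilon> *\<^sub>R x \<in> K}" using zero by (auto intro: exI[of _ 1])
  next
    fix x y assume "x \<in> {x. \<exists>\<epsilon>>0::real. \<epsilon> *\<^sub>R x \<in> K}" "y \<in> {x. \<exists>\<epsilon>>0::real. \<epsilon> *\<^sub>R x \<in> K}"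
    then obtain \<epsilon> \<delta> :: real where e: "0 < \<epsilon>" "\<epsilon> *\<^sub>R x \<in> K" "0 < \<delta>" "\<delta> *\<^sub>R y \<in> K" by auto
    \<comment> \<open>The convex weights \<open>\<delta> / (\<epsilon> + \<delta>)\<close> and
      \<open>\<epsilon> / (\<epsilon> + \<delta>)\<close> give both summands this
      coefficient.\<close>
    define \<eta> where "\<eta> = \<epsilon> * \<delta> / (\<epsilon> + \<delta>)"
    have "(\<delta> / (\<epsilon> + \<delta>)) *\<^sub>R (\<epsilon> *\<^sub>R x) + (\<epsilon> / (\<epsilon> + \<delta>)) *\<^sub>R (\<delta> *\<^sub>R y) \<in> K"
    proof (intro convexD K(1) e)
      show "\<delta> / (\<epsilon> + \<delta>) + \<epsilon> / (\<epsilon> + \<delta>) = 1"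
        unfolding add_divide_distrib[symmetric] using e by simp
    qed (use e in auto)
    then have "\<eta> *\<^sub>R (x + y) \<in> K" by (simp add: \<eta>_def scaleR_add_right mult.commute)
    moreover have "0 < \<eta>" using e by (simp add: \<eta>_def)
    ultimately show "x + y \<in> {x. \<exists>\<epsilon>>0::real. \<epsilon> *\<^sub>R x \<in> K}" by blast
  next
    fix c :: real and x assume "x \<in> {x. \<exists>\<epsilon>>0::real. \<epsilon> *\<^sub>R x \<in> K}"
    then obtain \<epsilon> :: real where e: "0 < \<epsilon>" "\<epsilon> *\<^sub>R x \<in> K" by auto
    show "c *\<^sub>R x \<in> {x. \<exists>\<epsilon>>0::real. \<epsilon> *\<^sub>R x \<in> K}"
    proof (cases "c = 0")
      case True
      then show ?thesis using zero by (auto intro: exI[of _ 1])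
    next
      case False
      have "(\<epsilon> / \<bar>c\<bar>) *\<^sub>R (c *\<^sub>R x) = (if c > 0 then \<epsilon> *\<^sub>R x else - (\<epsilon> *\<^sub>R x))"
        using False by (auto simp: abs_if)
      then have "(\<epsilon> / \<bar>c\<bar>) *\<^sub>R (c *\<^sub>R x) \<in> K" using e(2) neg[OF e(2)] by (simp split: if_splits)
      moreover have "0 < \<epsilon> / \<bar>c\<bar>" using e(1) False by simp
      ultimately show ?thesis by blast
    qed
  qed
  moreover have "K \<subseteq> {x. \<exists>\<epsilon>>0::real. \<epsilon> *\<^sub>R x \<in> K}" by (auto intro: exI[of _ 1])
  ultimately have "span K \<subseteq> {x. \<exists>\<epsilon>>0::real. \<epsilon> *\<^sub>R x \<in> K}" by (intro span_minimal)
  then show ?thesis using x by blast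
qed

lemma of_int_floor_Ints: "x \<in> \<int> \<Longrightarrow> real_of_int \<lfloor>x\<rfloor> = x"
  by (elim Ints_cases) simp

lemma finite_bounded_lattice:
  assumes "compact K"
  shows "finite (K \<inter> int_lattice d)"
proof -
  obtain R where R: "0 < R" "\<And>x i. x \<in> K \<Longrightarrow> i < d \<Longrightarrow> \<bar>x i\<bar> \<le> R"
    using compact_coords_bounded[OF assms, of d] by blast
  let ?g = "\<lambda>n::nat \<Rightarrow> int. \<lambda>i. if i < d then real_of_int (n i) else 0"
  have "K \<inter> int_lattice d \<subseteq> ?g ` ({..<d} \<rightarrow>\<^sub>E {- \<lceil>R\<rceil>..\<lceil>R\<rceil>})"
  proof
    fix x assume x: "x \<in> K \<inter> int_lattice d"
    define n where "n = (\<lambda>i\<in>{..<d}. \<lfloor>x i\<rfloor>)"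
    have int: "of_int \<lfloor>x i\<rfloor> = x i" for i using x by (intro of_int_floor_Ints) (simp add: int_lattice_def)
    have "n i \<in> {- \<lceil>R\<rceil>..\<lceil>R\<rceil>}" if "i < d" for i
    proof -
      have "\<bar>real_of_int \<lfloor>x i\<rfloor>\<bar> \<le> R" using R(2)[of x i] x that by (simp only: int) simp
      then have "- \<lceil>R\<rceil> \<le> \<lfloor>x i\<rfloor>" "\<lfloor>x i\<rfloor> \<le> \<lceil>R\<rceil>" by linarith+
      then show ?thesis using that by (simp add: n_def)
    qed
    then have "n \<in> {..<d} \<rightarrow>\<^sub>E {- \<lceil>R\<rceil>..\<lceil>R\<rceil>}" by (auto simp: n_def)
    moreover have "x \<in> coord_space d" using x by (simp add: int_lattice_def coord_space_eq)
    then have "x i = ?g n i" for i by (cases "i < d") (simp_all only: n_def int restrict_apply lessThan_iff if_True if_False, simp add: coord_space_def)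
    then have "x = ?g n" by (rule ext)
    ultimately show "x \<in> ?g ` ({..<d} \<rightarrow>\<^sub>E {- \<lceil>R\<rceil>..\<lceil>R\<rceil>})" by blast
  qed
  then show ?thesis by (rule finite_subset) (intro finite_imageI finite_PiE, auto)
qed

text \<open>The \<open>a j\<close> are the columns of \<open>A\<close>, the \<open>w j\<close> the
  rows of its inverse \<open>B\<close>. Then \<open>B A = 1\<close> is biorthogonality and
  \<open>A B = 1\<close> is the expansion property.\<close>

lemma dual_frame_of_matrix:
  assumes AB: "\<And>i j. i < d \<Longrightarrow> j < d \<Longrightarrow> (\<Sum>l<d. A i l * B l j) = of_bool (i = j)"
    and BA: "\<And>i j. i < d \<Longrightarrow> j < d \<Longrightarrow> (\<Sum>l<d. B i l * A l j) = of_bool (i = j)"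
  shows "dual_frame d (\<lambda>j i. if i < d then A i j else 0) (\<lambda>j i. if i < d then B j i else 0)"
proof
  let ?a = "\<lambda>j i. if i < d then A i j else 0" and ?w = "\<lambda>j i. if i < d then B j i else 0"
  show "?a j \<in> coord_space d" "?w j \<in> coord_space d" if "j < d" for j
    by (auto simp: coord_space_def)
  show "ip d (?w i) (?a j) = of_bool (i = j)" if "i < d" "j < d" for i j
    using BA[OF that] by (simp add: ip_def)
  show "z = (\<lambda>i. \<Sum>j<d. ip d (?w j) z * ?a j i)" if z: "z \<in> coord_space d" for z
  proof
    fix i
    show "z i = (\<Sum>j<d. ip d (?w j) z * ?a j i)"
    proof (cases "i < d")
      case True
      have "(\<Sum>j<d. ip d (?w j) z * ?a j i) = (\<Sum>j<d. \<Sum>l<d. B j l * z l * A i j)"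
        using True by (simp add: ip_def sum_distrib_right)
      also have "\<dots> = (\<Sum>l<d. \<Sum>j<d. B j l * z l * A i j)" by (rule sum.swap)
      also have "\<dots> = (\<Sum>l<d. (\<Sum>j<d. A i j * B j l) * z l)"
        by (simp add: sum_distrib_left sum_distrib_right algebra_simps)
      also have "\<dots> = (\<Sum>l<d. if i = l then z l else 0)"
        using True by (intro sum.cong) (auto simp: AB)
      finally show ?thesis using True by simp
    next
      case False
      then show ?thesis using z by (simp add: coord_space_def)
    qed
  qed
qed

context hkz_dual_frame
begin

definition cut :: "nat \<Rightarrow> (nat \<Rightarrow> real) set"
  where "cut k = {x \<in> coord_space d. \<forall>i<k. ip d (u i) (emb x) = 0}"

lemma subspace_ip_emb: "subspace {x. ip d z (emb x) = 0}"
  by (auto simp: subspace_def scaleR_fun_def plus_fun_def zero_fun_def emb_linear ip_linear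
      emb_def[of "\<lambda>_. 0"])

text \<open>The integer vectors \<open>C i\<close> with \<open>k \<le> i < d\<close> are a basis:
  duality with the \<open>u i\<close> gives independence, and \<open>emb_expand\<close> gives
  spanning.\<close>

lemma cut_rational_subspace:
  assumes k: "k \<le> d"
  shows "cut k \<in> rational_subspaces (d - k) d"
proof -
  let ?B = "C ` {k..<d}"
  have dual: "ip d (u l) (emb (C i)) = of_bool (l = i)" if "l < d" "i < d" for l i
    using C_dual that .
  have inj: "inj_on C {k..<d}"
  proof (rule inj_onI)
    fix i j assume ij: "i \<in> {k..<d}" "j \<in> {k..<d}" "C i = C j"
    then show "i = j" using dual[of i i] dual[of i j] by (auto split: if_splits)
  qed
  have ind: "independent ?B"
  proof
    assume "dependent ?B"
    then obtain i where i: "k \<le> i" "i < d" "C i \<in> span (?B - {C i})" by (auto simp: dependent_def)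
    have "span (?B - {C i}) \<subseteq> {x. ip d (u i) (emb x) = 0}"
      using i dual by (intro span_minimal subspace_ip_emb) auto
    then have "ip d (u i) (emb (C i)) = 0" using i(3) by blast
    then show False using dual[OF i(2,2)] by simp
  qed
  have card: "card ?B = d - k" using inj by (simp add: card_image)
  have sub: "?B \<subseteq> cut k" using C_in dual k by (auto simp: cut_def)
  have lat: "?B \<subseteq> int_lattice d" using C_in C_int by (auto simp: int_lattice_def coord_space_eq)
  have spn: "cut k \<subseteq> span ?B"
  proof
    fix x assume x: "x \<in> cut k"
    define x' where "x' = (\<lambda>m. \<Sum>i\<in>{k..<d}. ip d (u i) (emb x) * C i m)"
    have "emb x = (\<lambda>m. \<Sum>i\<in>{k..<d}. ip d (u i) (emb x) * emb (C i) m)"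
    proof
      fix m
      have "emb x m = (\<Sum>i<d. ip d (u i) (emb x) * emb (C i) m)" using emb_expand[of x] by (rule fun_cong)
      also have "\<dots> = (\<Sum>i\<in>{k..<d}. ip d (u i) (emb x) * emb (C i) m)"
        using x by (intro sum.mono_neutral_right) (auto simp: cut_def)
      finally show "emb x m = (\<Sum>i\<in>{k..<d}. ip d (u i) (emb x) * emb (C i) m)" .
    qed
    then have e: "emb x = emb x'" unfolding x'_def emb_linear .
    have "x \<in> coord_space d" "x' \<in> coord_space d"
      using x C_in by (auto simp: cut_def x'_def coord_space_def)
    then have "x = x'" using e by (rule emb_inj)
    also have "x' = (\<Sum>i\<in>{k..<d}. ip d (u i) (emb x) *\<^sub>R C i)"
      by (simp add: x'_def fun_eq_iff sum_apply scaleR_fun_def)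
    also have "\<dots> \<in> span ?B" by (intro span_sum span_scale span_base) auto
    finally show "x \<in> span ?B" .
  qed
  have "cut k = coord_space d \<inter> (\<Inter>i<k. {x. ip d (u i) (emb x) = 0})" by (auto simp: cut_def)
  moreover have "subspace \<dots>"
    by (intro subspace_inter subspace_coord_space subspace_Inter) (auto intro: subspace_ip_emb)
  ultimately have "subspace (cut k)" by simp
  moreover have "dim (cut k) = d - k" using sub spn ind card by (rule dim_unique)
  moreover have "cut k \<subseteq> topspace (Euclidean_space d)" by (auto simp: cut_def coord_space_eq)
  moreover have "\<exists>B \<subseteq> cut k \<inter> int_lattice d. finite B \<and> independent B \<and> card B = d - k"
    using sub lat ind card by (intro exI[of _ ?B]) blast
  ultimately show ?thesis unfolding rational_subspaces_def by blast
qed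

text \<open>Points with the same values under \<open>u i\<close>, \<open>i < k\<close>, and the same parities differ by twice a lattice
  point of \<open>K \<inter> cut k\<close>.\<close>

lemma lattice_count_le_cut:
  assumes d: "1 \<le> d" and k: "k \<le> d" and K: "compact K" "convex K" "K = uminus ` K" "K \<subseteq> coord_space d"
    and unit: "\<And>x. x \<in> K \<Longrightarrow> ip d (emb x) (emb x) \<le> 1"
  shows "real (lattice_count d K)
    \<le> 48 ^ d * (\<Prod>i<k. b i / sqrt d + 1) * 2 ^ d * real (lattice_count d (K \<inter> cut k))"
proof -
  let ?X = "K \<inter> int_lattice d" and ?Z = "K \<inter> cut k \<inter> int_lattice d"
  define Y where "Y = {y \<in> {..<k} \<rightarrow>\<^sub>E (UNIV::int set). (\<Sum>i<k. ((of_int (y i) + shift i y) / b i)\<^sup>2) \<le> 1}"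
  have Y: "finite Y" "real (card Y) \<le> 48 ^ d * (\<Prod>i<k. b i / sqrt d + 1)"
  proof -
    have "finite Y \<and> real (card Y) \<le> 48 ^ d * (\<Prod>i<k. b i / sqrt d + 1)"
      unfolding Y_def
    proof (rule tri_ball_count)
      show "0 < b i" if "i < k" for i using pos[of i] that k by linarith
      show "shift i y = shift i y'" if "\<And>l. l < i \<Longrightarrow> y l = y' l" for i y y'
        using that by (rule shift_cong)
    qed (use k d in auto)
    then show "finite Y" "real (card Y) \<le> 48 ^ d * (\<Prod>i<k. b i / sqrt d + 1)" by auto
  qed
  \<comment> \<open>On lattice points of \<open>K\<close> both floors are exact; they only convert
    to integers.\<close>
  define val where "val x = (\<lambda>i\<in>{..<k}. \<lfloor>ip d (u i) (emb x)\<rfloor>)" for x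
  define par where "par x = (\<lambda>j\<in>{..<d}. \<lfloor>x j\<rfloor> mod 2)" for x :: "nat \<Rightarrow> real"
  let ?P = "{..<d} \<rightarrow>\<^sub>E {0, 1::int}"
  have Xint: "x j \<in> \<int>" if "x \<in> ?X" for x j using that by (auto simp: int_lattice_def)
  have uint: "ip d (u i) (emb x) = of_int \<lfloor>ip d (u i) (emb x)\<rfloor>" if "x \<in> ?X" "i < d" for x i
  proof -
    have "ip d (u i) (emb x) \<in> \<int>" using Xint[OF that(1)] by (intro ip_dlat_emb u that(2))
    then show ?thesis by (simp only: of_int_floor_Ints)
  qed
  have val: "val x \<in> Y" if x: "x \<in> ?X" for x
  proof -
    have "ip d (emb x) (f i) = (of_int (val x i) + shift i (val x)) / b i" if i: "i < k" for i
      using i k uint[OF x] by (intro ip_emb_f) (auto simp: val_def)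
    then have "(\<Sum>i<k. ((of_int (val x i) + shift i (val x)) / b i)\<^sup>2) = (\<Sum>i<k. (ip d (emb x) (f i))\<^sup>2)"
      by simp
    also have "\<dots> \<le> (\<Sum>i<d. (ip d (emb x) (f i))\<^sup>2)" using k by (intro sum_mono2) auto
    also have "\<dots> \<le> 1"
      using parseval(2)[OF f emb_in, of x "emb x"] unit[of x] x by (simp add: power2_eq_square)
    finally show ?thesis by (auto simp: Y_def val_def)
  qed
  have par: "par x \<in> ?P" for x by (auto simp: par_def)
  have finX: "finite ?X" by (rule finite_bounded_lattice[OF K(1)])
  have finZ: "finite ?Z" by (rule finite_subset[OF _ finX]) auto
  have finP: "finite ?P" by (intro finite_PiE) auto
  define F where "F v = {x \<in> ?X. (val x, par x) = v}" for v
  have F: "card (F v) \<le> card ?Z" for v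
  proof (cases "F v = {}")
    case False
    then obtain x0 where x0: "x0 \<in> F v" by blast
    \<comment> \<open>Fixing one member \<open>x0\<close> of the class, halving differences injects
      the class into the section: symmetry and convexity keep the result in \<open>K\<close>, equal
      parities make it integral, and equal values put it into \<open>cut k\<close>.\<close>
    let ?h = "\<lambda>x j. (x j - x0 j) / 2"
    have h: "?h x \<in> ?Z" if x: "x \<in> F v" for x
    proof -
      have xX: "x \<in> ?X" "x0 \<in> ?X" "val x = val x0" "par x = par x0" using x x0 by (auto simp: F_def)
      have coord: "x \<in> coord_space d" "x0 \<in> coord_space d" using xX K(4) by auto
      have hc: "?h x \<in> coord_space d" using coord by (auto simp: coord_space_def)
      have "- x0 \<in> K" using K(3) xX(2) by blast
      then have "(1/2) *\<^sub>R x + (1/2) *\<^sub>R (- x0) \<in> K" using K(2) xX(1) by (intro convexD) auto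
      moreover have "(1/2) *\<^sub>R x + (1/2) *\<^sub>R (- x0) = ?h x"
        by (simp add: fun_eq_iff scaleR_fun_def diff_divide_distrib)
      ultimately have hK: "?h x \<in> K" by simp
      have "?h x j \<in> \<int>" for j
      proof (cases "j < d")
        case True
        obtain p q where pq: "x j = of_int p" "x0 j = of_int q"
          using Xint[OF xX(1), of j] Xint[OF xX(2), of j] by (meson Ints_cases)
        have "p mod 2 = q mod 2" using fun_cong[OF xX(4), of j] True pq by (simp add: par_def)
        then have "2 dvd p - q" by (simp add: mod_eq_dvd_iff)
        then obtain r where "p - q = 2 * r" by blast
        then have "real_of_int p - real_of_int q = 2 * real_of_int r"
          by (metis of_int_diff of_int_mult of_int_numeral)
        then show ?thesis using pq by simp
      next
        case False
        then show ?thesis using hc by (simp add: coord_space_def)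
      qed
      then have hl: "?h x \<in> int_lattice d" using hc by (simp add: int_lattice_def coord_space_eq)
      have "ip d (u i) (emb (?h x)) = 0" if i: "i < k" for i
      proof -
        have "ip d (u i) (emb x) = ip d (u i) (emb x0)"
          using uint[OF xX(1), of i] uint[OF xX(2), of i] fun_cong[OF xX(3), of i] i k
          by (simp add: val_def)
        moreover have "?h x = (\<lambda>j. (1/2) * (x j - x0 j))" by (simp add: fun_eq_iff)
        ultimately show ?thesis by (simp only: emb_linear ip_linear) simp
      qed
      then show ?thesis using hK hl hc by (simp add: cut_def)
    qed
    have "inj_on ?h (F v)" by (rule inj_onI) (auto simp: fun_eq_iff)
    then show ?thesis using h finZ by (intro card_inj_on_le[of ?h]) auto
  qed simp
  have "?X = (\<Union>v\<in>Y \<times> ?P. F v)" using val par by (auto simp: F_def)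
  then have "card ?X \<le> (\<Sum>v\<in>Y \<times> ?P. card (F v))"
    using card_UN_le[of "Y \<times> ?P" F] Y(1) finP by simp
  also have "\<dots> \<le> (\<Sum>v\<in>Y \<times> ?P. card ?Z)" by (intro sum_mono F)
  also have "\<dots> = card Y * 2 ^ d * card ?Z"
    by (simp add: card_cartesian_product card_PiE numeral_2_eq_2)
  finally have "real (card ?X) \<le> real (card Y * 2 ^ d * card ?Z)" by (simp only: of_nat_le_iff)
  also have "\<dots> = real (card Y) * 2 ^ d * real (card ?Z)" by simp
  also have "\<dots> \<le> 48 ^ d * (\<Prod>i<k. b i / sqrt d + 1) * 2 ^ d * real (card ?Z)"
    using Y(2) by (intro mult_right_mono) auto
  finally show ?thesis by (simp add: lattice_count_def)
qed

text \<open>With \<open>s i = ln (b i / (2 sqrt d))\<close> a factor is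
  \<open>2 * exp (s i) + 1\<close>, hence at most \<open>3 * exp (max 0 (s i))\<close>. The
  geometric-mean bound is the slope hypothesis of \<open>sum_slope_bound\<close> for
  \<open>h l = ln (b l)\<close>, and \<open>ge1\<close> is its nonnegativity hypothesis.\<close>

lemma prod_b_prefix:
  assumes d: "1 \<le> d" and k: "k \<le> d" and ge1: "\<And>j. j \<le> d \<Longrightarrow> 1 \<le> (\<Prod>i<j. b i)"
  shows "(\<Prod>i<k. b i / sqrt d + 1) \<le> 3 ^ d * (\<Prod>i<d. b i) powr (real k / real d)"
proof -
  define s where "s i = ln (b i) - ln (2 * sqrt d)" for i
  have sd: "0 < sqrt (real d)" using d by simp
  have ln_eq: "ln (\<Prod>i\<in>S. b i) = (\<Sum>i\<in>S. ln (b i))" if "S \<subseteq> {..<d}" for S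
  proof (rule ln_prod)
    show "b i \<noteq> 0" if "i \<in> S" for i using pos[of i] \<open>S \<subseteq> {..<d}\<close> that by fastforce
  qed (use finite_subset[OF that] in simp)
  have slope: "s i * real (q - i) \<le> (\<Sum>l\<in>{i..<q}. ln (b l))" if iq: "i < q" "q \<le> d" for i q
  proof -
    define G where "G = exp ((\<Sum>l\<in>{i..<q}. ln (b l)) / real (q - i))"
    have "G ^ (q - i) = exp (\<Sum>l\<in>{i..<q}. ln (b l))"
      using iq by (simp add: G_def exp_of_nat_mult[symmetric])
    also have "\<dots> = (\<Prod>l\<in>{i..<q}. b l)"
      using iq pos by (simp add: exp_sum)
    finally have "b i \<le> 2 * sqrt (real d) * G"
      using iq by (intro b_le_geometric_mean) (auto simp: G_def)
    then have "ln (b i) \<le> ln (2 * sqrt (real d) * G)"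
      using pos[of i] iq by (subst ln_le_cancel_iff) (auto simp: G_def intro!: mult_pos_pos sd)
    also have "\<dots> = ln (2 * sqrt d) + (\<Sum>l\<in>{i..<q}. ln (b l)) / real (q - i)"
      using sd by (subst ln_mult) (auto simp: G_def)
    finally have "s i \<le> (\<Sum>l\<in>{i..<q}. ln (b l)) / real (q - i)" by (simp add: s_def)
    then show ?thesis using iq by (simp add: pos_le_divide_eq)
  qed
  have nonneg: "0 \<le> (\<Sum>l<j. ln (b l))" if "j \<le> d" for j
    using ge1[OF that] ln_eq[of "{..<j}"] that by (metis ln_ge_zero lessThan_subset_iff)
  have "real d * (\<Sum>i<k. max 0 (s i)) \<le> real k * (\<Sum>l<d. ln (b l))"
    by (rule sum_slope_bound[OF slope nonneg k])
  then have sum: "(\<Sum>i<k. max 0 (s i)) \<le> real k / real d * ln (\<Prod>i<d. b i)"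
    using d by (simp add: ln_eq field_simps)
  have "(\<Prod>i<k. b i / sqrt d + 1) \<le> (\<Prod>i<k. 3 * exp (max 0 (s i)))"
  proof (rule prod_mono)
    fix i assume "i \<in> {..<k}"
    then have i: "i < d" using k by simp
    have "b i / sqrt d = 2 * exp (s i)"
      using pos[OF i] sd by (simp add: s_def exp_diff)
    moreover have "exp (s i) \<le> exp (max 0 (s i))" "1 \<le> exp (max 0 (s i))" by simp_all
    ultimately show "0 \<le> b i / sqrt d + 1 \<and> b i / sqrt d + 1 \<le> 3 * exp (max 0 (s i))"
      by (smt (verit) exp_gt_zero)
  qed
  also have "\<dots> = 3 ^ k * exp (\<Sum>i<k. max 0 (s i))" by (simp add: prod.distrib exp_sum)
  also have "\<dots> \<le> 3 ^ d * exp (real k / real d * ln (\<Prod>i<d. b i))"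
    using k sum by (intro mult_mono power_increasing) auto
  also have "exp (real k / real d * ln (\<Prod>i<d. b i)) = (\<Prod>i<d. b i) powr (real k / real d)"
  proof -
    have "(\<Prod>i<d. b i) \<noteq> 0" using ge1[of d] by linarith
    then show ?thesis by (simp only: powr_def if_False)
  qed
  finally show ?thesis .
qed

end

theorem theorem8:
  shows "\<exists>C::real. C > 0 \<and>
    (\<forall>(d::nat) (m::nat) (K :: (nat \<Rightarrow> real) set).
      1 \<le> d \<longrightarrow> 1 \<le> m \<longrightarrow> m \<le> d \<longrightarrow>
      convex_body d K \<longrightarrow> origin_symmetric K \<longrightarrow>
      affine_dimension (K \<inter> int_lattice d) = d \<longrightarrow>
      real (lattice_count d K)
        \<le> C ^ d * real d ^ (d - m)
          * real (Max {lattice_count d (K \<inter> H) |H. H \<in> rational_subspaces m d})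
          * vol d K powr (real (d - m) / real d))"
proof (intro exI[of _ "1152::real"] conjI allI impI)
  fix d m :: nat and K :: "(nat \<Rightarrow> real) set"
  assume d: "1 \<le> d" and m: "1 \<le> m" "m \<le> d" and body: "convex_body d K"
    and sym: "origin_symmetric K" and full: "affine_dimension (K \<inter> int_lattice d) = d"
  define k where "k = d - m"
  have k: "k \<le> d" "d - k = m" using m by (auto simp: k_def)
  let ?X = "K \<inter> int_lattice d"
  have convex: "convex K" using body by (simp add: convex_body_def)
  have cin: "compactin (Euclidean_space d) K" using body by (simp add: convex_body_def)
  have coord: "K \<subseteq> coord_space d" using compactin_subset_topspace[OF cin] by (simp add: coord_space_eq)
  have compact: "compact K"
    using cin unfolding Euclidean_space_def compactin_subtopology euclidean_product_topology by simp
  have symK: "K = uminus ` K" using sym by (simp add: origin_symmetric_def)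
  have span: "coord_space d \<subseteq> span ?X"
    using coord full by (intro affine_dimension_full_span) auto
  have K_ne: "K \<noteq> {}"
  proof
    assume "K = {}"
    then have "coord_space d \<subseteq> {0}" using span by simp
    moreover have "std_vec 0 \<in> coord_space d" using d by simp
    ultimately have "std_vec 0 0 = (0::real)" by auto
    then show False by (simp add: std_vec_def)
  qed
  have inner: "\<exists>\<epsilon>>0. (\<lambda>i. \<epsilon> * std_vec j i) \<in> K" if "j < d" for j
  proof -
    have "std_vec j \<in> span K" using span std_vec_in[OF that] span_mono[of ?X K] by blast
    from absorbing_span[OF convex symK K_ne this] show ?thesis by (simp add: scaleR_fun_def)
  qed
  obtain A where A: "mdet d A \<noteq> 0" "\<And>x. x \<in> K \<Longrightarrow> ip d (lin d A x) (lin d A x) \<le> 1"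
    "\<And>x. x \<in> coord_space d \<Longrightarrow> 4 * real d * ip d (lin d A x) (lin d A x) \<le> 1 \<Longrightarrow> x \<in> K"
    using john_ellipsoid[OF d compact convex symK coord inner] by blast
  obtain B where B: "\<And>i j. i < d \<Longrightarrow> j < d \<Longrightarrow> (\<Sum>l<d. A i l * B l j) = of_bool (i = j)"
    "\<And>i j. i < d \<Longrightarrow> j < d \<Longrightarrow> (\<Sum>l<d. B i l * A l j) = of_bool (i = j)"
    using mdet_inverse[OF A(1)] by blast
  define a where "a = (\<lambda>j i. if i < d then A i j else 0)"
  define w where "w = (\<lambda>j i. if i < d then B j i else 0)"
  have "dual_frame d a w" unfolding a_def w_def using B by (rule dual_frame_of_matrix)
  then obtain u f where "hkz_frame d a w u f" using dual_frame.exists_hkz_frame by blast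
  then obtain C where "hkz_dual_frame d a w u f C" using hkz_frame.exists_hkz_dual_frame by blast
  then interpret hkz_dual_frame d a w u f C .
  have emb: "emb x = lin d A x" for x
    unfolding emb_def lin_def by (rule ext) (simp add: a_def mult.commute)
  note unit = A(2)[folded emb] and ell = A(3)[folded emb]
  \<comment> \<open>The lattice points of \<open>K\<close> span, so \<open>z\<close> is orthogonal
    to every \<open>emb (std_vec j) = a j\<close>, hence by \<open>expand\<close> to itself.\<close>
  have spans: "z = (\<lambda>_. 0)" if z: "z \<in> coord_space d" "\<And>x. x \<in> ?X \<Longrightarrow> ip d z (emb x) = 0" for z
  proof -
    have "span ?X \<subseteq> {x. ip d z (emb x) = 0}" using z(2) by (intro span_minimal subspace_ip_emb) auto
    then have "ip d z (emb (std_vec j)) = 0" if "j < d" for j using span std_vec_in[OF that] by blast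
    moreover have "emb (std_vec j) = a j" if "j < d" for j
      using that by (simp add: emb_def std_vec_def of_bool_def if_distrib if_distribR fun_eq_iff cong: if_cong)
    ultimately have "ip d z (a j) = 0" if "j < d" for j using that by simp
    then have "ip d z (\<lambda>i. \<Sum>j<d. ip d (w j) z * a j i) = 0" by (simp add: ip_linear)
    then have "ip d z z = 0" using expand[OF z(1)] by simp
    then show ?thesis using ip_self_eq_0[OF z(1)] by simp
  qed
  have ge1: "1 \<le> (\<Prod>i<j. b i)" if "j \<le> d" for j
    by (rule prod_b_ge_1[of ?X]) (use spans unit that in \<open>auto simp: int_lattice_def\<close>)
  let ?V = "vol d K" and ?S = "{lattice_count d (K \<inter> H) |H. H \<in> rational_subspaces m d}"
  have V: "(\<Prod>i<d. b i) \<le> (4 * real d) ^ d * ?V"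
    by (rule prod_b_le_vol[OF d compact coord ell])
  have "(\<Prod>i<d. b i) powr (real k / real d) \<le> ((4 * real d) ^ d * ?V) powr (real k / real d)"
    using V ge1[of d] by (intro powr_mono2) auto
  also have "\<dots> = ((4 * real d) ^ d) powr (real k / real d) * ?V powr (real k / real d)"
    by (rule powr_mult)
  also have "((4 * real d) ^ d) powr (real k / real d) = (4 * real d) ^ k"
  proof -
    have r: "0 < 4 * real d" using d by simp
    have "((4 * real d) ^ d) powr (real k / real d) = (4 * real d) powr (real d * (real k / real d))"
      unfolding powr_realpow[OF r, symmetric] by (rule powr_powr)
    also have "real d * (real k / real d) = real k" using d by simp
    finally show ?thesis by (simp only: powr_realpow[OF r])
  qed
  finally have P: "(\<Prod>i<d. b i) powr (real k / real d) \<le> 4 ^ k * real d ^ k * ?V powr (real k / real d)"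
    by (simp add: power_mult_distrib)
  \<comment> \<open>\<open>Max\<close> bounds its elements only on a finite set; here every count is
    at most that of \<open>K\<close>.\<close>
  have "finite ?S"
  proof (rule finite_subset)
    show "?S \<subseteq> {..card ?X}"
    proof
      fix n assume "n \<in> ?S"
      then obtain H where "n = card (K \<inter> H \<inter> int_lattice d)" unfolding lattice_count_def by blast
      moreover have "card (K \<inter> H \<inter> int_lattice d) \<le> card ?X"
        by (intro card_mono finite_bounded_lattice compact) blast
      ultimately show "n \<in> {..card ?X}" by simp
    qed
  qed simp
  moreover have "lattice_count d (K \<inter> cut k) \<in> ?S"
    using cut_rational_subspace[OF k(1)] k(2) by auto
  ultimately have Max: "lattice_count d (K \<inter> cut k) \<le> Max ?S" by (rule Max_ge)
  have pos_prod: "0 \<le> (\<Prod>i<k. b i / sqrt d + 1)"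
    using pos k by (intro prod_nonneg ballI add_nonneg_nonneg divide_nonneg_nonneg) (auto intro: less_imp_le)
  have "real (lattice_count d K)
      \<le> 48 ^ d * (\<Prod>i<k. b i / sqrt d + 1) * 2 ^ d * real (lattice_count d (K \<inter> cut k))"
    by (rule lattice_count_le_cut[OF d k(1) compact convex symK coord unit])
  also have "\<dots> \<le> 48 ^ d * (\<Prod>i<k. b i / sqrt d + 1) * 2 ^ d * real (Max ?S)"
    using Max pos_prod by (intro mult_left_mono) auto
  also have "\<dots> \<le> 48 ^ d * (3 ^ d * (4 ^ d * real d ^ k * ?V powr (real k / real d))) * 2 ^ d * real (Max ?S)"
  proof (intro mult_right_mono mult_left_mono)
    have "(\<Prod>i<k. b i / sqrt d + 1) \<le> 3 ^ d * (\<Prod>i<d. b i) powr (real k / real d)"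
      by (rule prod_b_prefix[OF d k(1) ge1])
    also have "\<dots> \<le> 3 ^ d * (4 ^ k * real d ^ k * ?V powr (real k / real d))"
      using P by (intro mult_left_mono) auto
    also have "\<dots> \<le> 3 ^ d * (4 ^ d * real d ^ k * ?V powr (real k / real d))"
      using k by (intro mult_left_mono mult_right_mono power_increasing) auto
    finally show "(\<Prod>i<k. b i / sqrt d + 1) \<le> 3 ^ d * (4 ^ d * real d ^ k * ?V powr (real k / real d))" .
  qed auto
  also have "\<dots> = (48 ^ d * 3 ^ d * 4 ^ d * 2 ^ d) * real d ^ k * real (Max ?S) * ?V powr (real k / real d)"
    by (simp only: mult_ac)
  \<comment> \<open>Per dimension, 48 comes from the cells of the unit ball, 2 from the parities, 3
    from the factors \<open>b i / sqrt d + 1\<close>, and 4 from the volume comparison, after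
    enlarging \<open>4 ^ k\<close> to \<open>4 ^ d\<close>.\<close>
  also have "(48 ^ d * 3 ^ d * 4 ^ d * 2 ^ d :: real) = 1152 ^ d"
    unfolding power_mult_distrib[symmetric] by simp
  finally show "real (lattice_count d K) \<le> 1152 ^ d * real d ^ (d - m) * real (Max ?S)
      * ?V powr (real (d - m) / real d)"
    unfolding k_def .
qed simp

end
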